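(* For $A,B\in\mathbb{Z}$ let $\Delta_{A,B}=4A^3+27B^2$, and for $X\ge 1$ let $$S(X)=\sum_{\substack{(A,B)\in\mathbb{Z}^2\\ |A|\le X^4,\ |B|\le X^6}}\mu^2(\Delta_{A,B}).$$ For $q\in\mathbb{N}$ let $\varrho(q)=\#\{(\alpha,\beta)\ \mathrm{mod}\ q:\ \Delta_{\alpha,\beta}\equiv 0\ (\mathrm{mod}\ q)\}$. Then for any $\varepsilon>0$, $$S(X)=4X^{10}\prod_p\left(1-\frac{\varrho(p^2)}{p^4}\right)+O_\varepsilon(X^{7+\varepsilon}).$$
   Context: $\mu$ is the Möbius function, with the conventions $\mu(0)=0$ and $\mu(-n)=\mu(n)$ for $n\in\mathbb{N}$. The product is over all primes $p$. *)

theory Defs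
  imports "HOL-Analysis.Analysis" "HOL-Computational_Algebra.Computational_Algebra"
begin

definition moebius_int :: "int \<Rightarrow> int" where
  "moebius_int n = (if n \<noteq> 0 \<and> squarefree n then (-1) ^ card (prime_factors n) else 0)"

definition Delta :: "int \<Rightarrow> int \<Rightarrow> int" where
  "Delta A B = 4 * A ^ 3 + 27 * B ^ 2"

definition S_count :: "real \<Rightarrow> real" where
  "S_count X = (\<Sum>(A, B) \<in> {p :: int \<times> int. real_of_int \<bar>fst p\<bar> \<le> X ^ 4 \<and> real_of_int \<bar>snd p\<bar> \<le> X ^ 6}.
                   real_of_int ((moebius_int (Delta A B))\<^sup>2))"

definition rho :: "nat \<Rightarrow> nat" where
  "rho q = card ({(\<alpha>, \<beta>). 0 \<le> \<alpha> \<and> \<alpha> < int q \<and> 0 \<le> \<beta> \<and> \<beta> < int q \<and>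
                   int q dvd Delta \<alpha> \<beta>} :: (int \<times> int) set)"

end

theory Submission
  imports Defs "HOL-Number_Theory.Cong"
begin

text \<open>
  Write \<mu>^2(\<Delta>) as the sum of \<mu>(d) over d^2 | \<Delta> and cut it at d \<le> X^3. For squarefree d the number of
  roots B modulo d^2 of \<Delta>(A, B) depends on A modulo d only, so counting first B modulo d^2 and then
  A modulo d yields the main term with an error of size X^4 + X^6/d for each d, up to a constant
  factor for each prime dividing d.

  There remain the pairs for which the product N of all p with p^2 | \<Delta> exceeds X^3. Up to a divisor
  of 6, N = de with d odd and coprime to A, and e | gcd(A, B). If d \<le> X^3 one counts the pairs for
  fixed d and e. If d > X^3, the cubic x^3 + Ax + B has a double root t modulo d^2, so that
  s^3 + Asy^2 + By^3 is divisible by d^2 on the lattice s \<equiv> ty (mod d). In a reduced basis of this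
  lattice the quotient is a binary cubic form with small coefficients, which is a form of
  discriminant -\<Delta>/d^2 representing d. Together with the coordinates of the vector (d, 0) it
  determines A and B through its covariants. Counting these forms gives O(X^{10} log X / D)
  pairs with d of size D, provided that both extreme coefficients are nonzero; otherwise x^3 + Ax + B has
  an integer root, which happens for O(X^6) pairs only.
\<close>

section \<open>Roots of the discriminant modulo squares\<close>

text \<open>The cutoff X^3 balances three quantities at X^7: the errors X^4 + X^6/d summed over d
  \<le> X^3, the tail X^10/X^3 of the Euler product, and the exceptional pairs with d just above
  X^3, again X^10/X^3. Reducing A modulo d rather than d^2 is what makes the first affordable: a
  count of A modulo d^2 would leave an error of size X^6 for each d, hence X^9 in total. The
  obstacle is that d may be as large as a constant times X^6, where d^2 far exceeds both sides of
  the box and counting residues gives nothing. With R = X^2 the box reads |A| \<le> R^2, |B| \<le>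
  R^3, so the roots of x^3 + Ax + B have size at most of order R. Lattice vectors are therefore
  measured by s^2 + R^2 y^2, for which the three terms of s^3 + Asy^2 + By^3 obey the same bound.
  The ranges of the four coefficients and two coordinates multiply to R^5/D = X^10/D whatever the
  length of the shorter basis vector, so the only loss is logarithmic, from the dyadic
  ranges.\<close>

definition roots_count :: "int \<Rightarrow> nat \<Rightarrow> nat" where
  "roots_count A q = card {b. 0 \<le> b \<and> b < int q \<and> int q dvd Delta A b}"

lemma Delta_cong:
  assumes "[A = A'] (mod q)" "[B = B'] (mod q)"
  shows "q dvd Delta A B \<longleftrightarrow> q dvd Delta A' B'"
proof -
  have "[Delta A B = Delta A' B'] (mod q)"
    unfolding Delta_def using assms by (intro cong_add cong_mult cong_pow cong_refl)
  thus ?thesis by (rule cong_dvd_iff)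
qed

lemma Delta_mod:
  assumes "m dvd q"
  shows "m dvd Delta (A mod q) B \<longleftrightarrow> m dvd Delta A B"
    and "m dvd Delta A (B mod q) \<longleftrightarrow> m dvd Delta A B"
  using assms by (auto intro!: Delta_cong simp: cong_def mod_mod_cancel)

lemma finite_int_segment [simp]: "finite {b::int. 0 \<le> b \<and> b < n \<and> P b}"
  by (rule finite_subset[of _ "{0..<n}"]) auto

lemma crt_bij:
  fixes m n :: int
  assumes "coprime m n" "m > 0" "n > 0"
  shows "bij_betw (\<lambda>b. (b mod m, b mod n)) {0..<m * n} ({0..<m} \<times> {0..<n})"
proof -
  let ?f = "\<lambda>b. (b mod m, b mod n)"
  have inj: "inj_on ?f {0..<m * n}"
  proof (rule inj_onI)
    fix x y assume x: "x \<in> {0..<m * n}" and y: "y \<in> {0..<m * n}" and e: "?f x = ?f y"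
    hence "[x = y] (mod m)" "[x = y] (mod n)" by (auto simp: cong_def)
    hence "[x = y] (mod (m * n))" using assms by (simp add: coprime_cong_mult)
    thus "x = y" using x y by (auto simp: cong_def)
  qed
  have sub: "?f ` {0..<m * n} \<subseteq> {0..<m} \<times> {0..<n}" using assms by auto
  have "card (?f ` {0..<m * n}) = card ({0..<m} \<times> {0..<n})"
    using inj assms by (simp add: card_image card_cartesian_product nat_mult_distrib)
  hence "?f ` {0..<m * n} = {0..<m} \<times> {0..<n}"
    using sub by (intro card_subset_eq) auto
  with inj show ?thesis by (auto simp: bij_betw_def)
qed

lemma roots_count_mult:
  assumes "coprime m n" "m > 0" "n > 0"
  shows "roots_count A (m * n) = roots_count A m * roots_count A n"
proof -
  let ?f = "\<lambda>b. (b mod int m, b mod int n)"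
  let ?T = "\<lambda>q. {b. 0 \<le> b \<and> b < int q \<and> int q dvd Delta A b}"
  have cop: "coprime (int m) (int n)" using assms by simp
  have b: "bij_betw ?f {0..<int m * int n} ({0..<int m} \<times> {0..<int n})"
    using crt_bij[OF cop] assms by simp
  have dv: "int (m * n) dvd z \<longleftrightarrow> int m dvd z \<and> int n dvd z" for z
    by (metis cop divides_mult dvd_mult_left dvd_mult_right of_nat_mult)
  have "bij_betw ?f (?T (m * n)) (?T m \<times> ?T n)"
  proof (rule bij_betw_imageI)
    show "inj_on ?f (?T (m * n))"
      using b by (auto simp: bij_betw_def intro: inj_on_subset)
    show "?f ` ?T (m * n) = ?T m \<times> ?T n"
    proof
      show "?f ` ?T (m * n) \<subseteq> ?T m \<times> ?T n"
        using assms by (auto simp del: of_nat_mult simp: dv Delta_mod)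
      show "?T m \<times> ?T n \<subseteq> ?f ` ?T (m * n)"
      proof clarify
        fix x y assume h: "0 \<le> x" "x < int m" "int m dvd Delta A x" "0 \<le> y" "y < int n" "int n dvd Delta A y"
        hence "(x, y) \<in> ?f ` {0..<int m * int n}" using b by (auto simp: bij_betw_def)
        then obtain z where z: "z \<in> {0..<int m * int n}" "x = z mod int m" "y = z mod int n" by auto
        have "z \<in> ?T (m * n)" using z h by (simp only: mem_Collect_eq dv) (auto simp: Delta_mod)
        with z show "(x, y) \<in> ?f ` ?T (m * n)" by auto
      qed
    qed
  qed
  hence "card (?T (m * n)) = card (?T m \<times> ?T n)" by (rule bij_betw_same_card)
  thus ?thesis by (simp add: roots_count_def card_cartesian_product)
qed

lemma rho_eq_sum:
  "rho q = (\<Sum>a\<in>{0..<int q}. roots_count a q)"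
proof -
  have "{(\<alpha>, \<beta>). 0 \<le> \<alpha> \<and> \<alpha> < int q \<and> 0 \<le> \<beta> \<and> \<beta> < int q \<and> int q dvd Delta \<alpha> \<beta>}
      = Sigma {0..<int q} (\<lambda>a. {b. 0 \<le> b \<and> b < int q \<and> int q dvd Delta a b})"
    by auto
  thus ?thesis by (simp add: rho_def roots_count_def card_SigmaI)
qed

lemma roots_count_cong:
  assumes "[A = A'] (mod int q)"
  shows "roots_count A q = roots_count A' q"
  unfolding roots_count_def using Delta_cong[OF assms cong_refl] by simp

lemma rho_mult:
  assumes "coprime m n" "m > 0" "n > 0"
  shows "rho (m * n) = rho m * rho n"
proof -
  have cop: "coprime (int m) (int n)" using assms by simp
  have b: "bij_betw (\<lambda>b. (b mod int m, b mod int n)) {0..<int m * int n} ({0..<int m} \<times> {0..<int n})"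
    using crt_bij[OF cop] assms by simp
  have "rho (m * n) = (\<Sum>a\<in>{0..<int m * int n}. roots_count a m * roots_count a n)"
    by (simp add: rho_eq_sum roots_count_mult assms)
  also have "\<dots> = (\<Sum>a\<in>{0..<int m * int n}. (case (a mod int m, a mod int n) of (x, y) \<Rightarrow> roots_count x m * roots_count y n))"
  proof (rule sum.cong)
    fix a
    have "roots_count a m = roots_count (a mod int m) m" "roots_count a n = roots_count (a mod int n) n"
      by (auto intro!: roots_count_cong)
    thus "roots_count a m * roots_count a n = (case (a mod int m, a mod int n) of (x, y) \<Rightarrow> roots_count x m * roots_count y n)"
      by simp
  qed simp
  also have "\<dots> = (\<Sum>z\<in>{0..<int m} \<times> {0..<int n}. case z of (x, y) \<Rightarrow> roots_count x m * roots_count y n)"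
    by (rule sum.reindex_bij_betw[OF b])
  also have "\<dots> = rho m * rho n"
    by (simp add: rho_eq_sum sum_product sum.cartesian_product)
  finally show ?thesis .
qed

text \<open>The weighted scaling (A, B) \<mapsto> (l^2 A, l^3 B) multiplies the discriminant by l^6.\<close>

lemma roots_count_scale_le:
  assumes l: "coprime l (int q)" and A': "[A' = l ^ 2 * A] (mod int q)" and q: "q > 0"
  shows "roots_count A q \<le> roots_count A' q"
  unfolding roots_count_def
proof (rule card_inj_on_le[where f = "\<lambda>b. l ^ 3 * b mod int q"])
  let ?T = "\<lambda>A. {b. 0 \<le> b \<and> b < int q \<and> int q dvd Delta A b}"
  show "inj_on (\<lambda>b. l ^ 3 * b mod int q) (?T A)"
  proof (rule inj_onI)
    fix x y assume x: "x \<in> ?T A" and y: "y \<in> ?T A" and e: "l ^ 3 * x mod int q = l ^ 3 * y mod int q"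
    from e have "[l ^ 3 * x = l ^ 3 * y] (mod int q)" by (simp add: cong_def)
    hence "[x = y] (mod int q)" using l by (simp add: cong_mult_lcancel)
    thus "x = y" using x y by (auto simp: cong_def)
  qed
  show "(\<lambda>b. l ^ 3 * b mod int q) ` ?T A \<subseteq> ?T A'"
  proof clarify
    fix b assume b: "0 \<le> b" "b < int q" "int q dvd Delta A b"
    have "int q dvd Delta A' (l ^ 3 * b mod int q) \<longleftrightarrow> int q dvd Delta (l ^ 2 * A) (l ^ 3 * b)"
      using A' by (intro Delta_cong) auto
    also have "Delta (l ^ 2 * A) (l ^ 3 * b) = l ^ 6 * Delta A b"
      by (simp add: Delta_def power_mult_distrib power_mult[symmetric] algebra_simps)
    finally show "0 \<le> l ^ 3 * b mod int q \<and> l ^ 3 * b mod int q < int q \<and> int q dvd Delta A' (l ^ 3 * b mod int q)"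
      using b q by auto
  qed
qed simp

text \<open>For p odd and A prime to p, the scalings by l \<equiv> 1 (mod p) carry A to every class
  modulo \<open>p ^ 2\<close> that agrees with A modulo p. Only one inequality is proved, since the
  roles of A and A' can be exchanged.\<close>

lemma roots_count_prime_square_mono:
  assumes p: "prime p" and AA': "[A = A'] (mod int p)" and pA: "\<not> int p dvd A" and p2: "p \<noteq> 2"
  shows "roots_count A (p ^ 2) \<le> roots_count A' (p ^ 2)"
proof -
  obtain k where k: "A' = A + int p * k" using AA'
    by (metis cong_iff_lin)
  have pp: "prime (int p)" using p by simp
  have "\<not> int p dvd 2" using p2 p
    by (metis of_nat_dvd_iff of_nat_numeral primes_dvd_imp_eq two_is_prime_nat)
  with pA pp have "coprime (2 * A) (int p)"
    by (metis coprime_commute prime_dvd_mult_iff prime_imp_coprime)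
  then obtain j where j: "[(2 * A) * j = k] (mod int p)"
    by (metis cong_solve_coprime_int cong_scalar_left mult.assoc mult.commute mult_1)
  define l where "l = 1 + int p * j"
  have "coprime l (int p)" unfolding l_def
    by (metis coprime_1_left coprime_iff_gcd_eq_1 gcd.commute gcd_add_mult mult.commute add.commute)
  hence l: "coprime l (int (p ^ 2))" by simp
  \<comment> \<open>With l = 1 + pj one has l^2 A \<equiv> A + 2pjA (mod p^2), and 2Aj \<equiv> k (mod p) makes this A'.\<close>
  obtain i where i: "k = 2 * A * j + int p * i" using j by (metis cong_iff_lin)
  have "A' - l ^ 2 * A = int (p ^ 2) * (i - j ^ 2 * A)"
    unfolding l_def k i by (simp add: power2_eq_square algebra_simps)
  hence "[A' = l ^ 2 * A] (mod int (p ^ 2))" by (simp add: cong_iff_dvd_diff)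
  with l show ?thesis using roots_count_scale_le p by (simp add: prime_gt_0_nat)
qed

text \<open>If p = 2 the factor 4, and if p divides A the cube, removes A from the condition modulo
  \<open>p ^ 2\<close> altogether. In the remaining case the scaling inequality applies in both
  directions.\<close>

lemma roots_count_prime_square_cong:
  assumes p: "prime p" and AA': "[A = A'] (mod int p)"
  shows "roots_count A (p ^ 2) = roots_count A' (p ^ 2)"
proof -
  consider "p = 2" | "int p dvd A" | "\<not> int p dvd A" "p \<noteq> 2" by blast
  thus ?thesis
  proof cases
    case 1
    have "int (p ^ 2) dvd Delta A b \<longleftrightarrow> int (p ^ 2) dvd 27 * b ^ 2" for A b
      using 1 by (simp add: Delta_def dvd_add_right_iff)
    thus ?thesis unfolding roots_count_def by simp
  next
    case 2
    hence 3: "int p dvd A'" using AA' by (simp add: cong_dvd_iff)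
    have "int (p ^ 2) dvd Delta A b \<longleftrightarrow> int (p ^ 2) dvd 27 * b ^ 2" if "int p dvd A" for A b
    proof -
      have "int p ^ 2 dvd A ^ 2" using that by (rule dvd_power_same)
      hence "int p ^ 2 dvd 4 * A ^ 3" by (simp add: power3_eq_cube power2_eq_square)
      thus ?thesis by (simp add: Delta_def dvd_add_right_iff)
    qed
    with 2 3 show ?thesis unfolding roots_count_def by simp
  next
    case 3
    have "\<not> int p dvd A'" using AA' 3 by (simp add: cong_dvd_iff)
    with 3 show ?thesis using roots_count_prime_square_mono[OF p] AA' cong_sym by (metis order_antisym)
  qed
qed

lemma roots_count_trivial: "roots_count A q \<le> q"
proof -
  have "card {b. 0 \<le> b \<and> b < int q \<and> int q dvd Delta A b} \<le> card {0..<int q}"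
    by (rule card_mono) auto
  thus ?thesis by (simp add: roots_count_def)
qed

lemma not_dvd_small:
  fixes p n :: nat
  assumes "prime p" "p > 3" "n \<in> {4, 27, 2}"
  shows "\<not> int p dvd int n"
proof
  assume "int p dvd int n"
  hence "p dvd n" by simp
  moreover have "n \<in> {2 ^ 2, 3 ^ 3, 2 ^ 1}" using assms(3) by simp
  ultimately have "p dvd 2 \<or> p dvd 3" using assms(1) prime_dvd_power by blast
  thus False using assms(2) by (auto dest: dvd_imp_le)
qed

text \<open>For p > 3 there are at most two roots: a root b is prime to p because A is, so p cannot
  divide both b - c and b + c for a further root c, and \<open>p ^ 2\<close> divides one of them.
  The constant 9 is the trivial bound \<open>p ^ 2\<close> for p \<le> 3.\<close>

lemma roots_count_prime_square_le:
  assumes p: "prime p" and pA: "\<not> int p dvd A"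
  shows "roots_count A (p ^ 2) \<le> 9"
proof (cases "p \<le> 3")
  case True
  hence "p ^ 2 \<le> 3 ^ 2" by (intro power_mono) auto
  thus ?thesis using roots_count_trivial[of A "p ^ 2"] by simp
next
  case False
  let ?T = "{b. 0 \<le> b \<and> b < int (p ^ 2) \<and> int (p ^ 2) dvd Delta A b}"
  have pp: "prime (int p)" using p by simp
  have nd: "\<not> int p dvd 4" "\<not> int p dvd 27" "\<not> int p dvd 2"
    using not_dvd_small[OF p, of 4] not_dvd_small[OF p, of 27] not_dvd_small[OF p, of 2] False by auto
  show ?thesis
  proof (cases "?T = {}")
    case True show ?thesis unfolding roots_count_def True by simp
  next
    case ne: False
    then obtain b where b: "b \<in> ?T" by blast
    have pb: "\<not> int p dvd b"
    proof
      assume "int p dvd b"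
      hence "int p dvd 27 * b ^ 2" by (simp add: power2_eq_square)
      moreover have "int p dvd Delta A b" using b by (auto intro: dvd_trans[of _ "int (p^2)"])
      ultimately have "int p dvd 4 * A ^ 3" by (simp add: Delta_def dvd_add_left_iff)
      thus False using pp nd(1) pA by (auto simp: prime_dvd_mult_iff prime_dvd_power_iff)
    qed
    have "?T \<subseteq> {b, int (p ^ 2) - b}"
    proof
      fix c assume c: "c \<in> ?T"
      have "int (p ^ 2) dvd Delta A b - Delta A c" using b c by (intro dvd_diff) auto
      also have "Delta A b - Delta A c = 27 * ((b - c) * (b + c))"
        by (simp add: Delta_def power2_eq_square algebra_simps)
      finally have d: "int (p ^ 2) dvd 27 * ((b - c) * (b + c))" .
      have cop27: "coprime (int (p ^ 2)) 27" using pp nd(2) prime_imp_coprime[of "int p" 27] by simp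
      from d have d: "int p ^ 2 dvd (b - c) * (b + c)" using cop27 by (simp add: coprime_dvd_mult_right_iff)
      have "\<not> (int p dvd (b - c) \<and> int p dvd (b + c))"
      proof
        assume "int p dvd (b - c) \<and> int p dvd (b + c)"
        hence "int p dvd (b - c) + (b + c)" by (metis dvd_add)
        hence "int p dvd 2 * b" by simp
        thus False using pp nd(3) pb by (auto simp: prime_dvd_mult_iff)
      qed
      then consider "coprime (int p ^ 2) (b - c)" | "coprime (int p ^ 2) (b + c)"
        using pp prime_imp_coprime by (metis coprime_power_left_iff)
      thus "c \<in> {b, int (p ^ 2) - b}"
      proof cases
        case 1
        with d have "int p ^ 2 dvd b + c" by (simp add: coprime_dvd_mult_right_iff)
        then obtain k where k: "b + c = int p ^ 2 * k" by blast
        have "b \<noteq> 0" using pb by auto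
        hence "0 < int p ^ 2 * k" "int p ^ 2 * k < int p ^ 2 * 2" using b c k by auto
        hence "0 < k" "k < 2" using p by (auto simp: zero_less_mult_iff prime_gt_0_nat)
        hence "k = 1" by simp
        thus ?thesis using k by simp
      next
        case 2
        with d have "int p ^ 2 dvd b - c" by (simp add: coprime_dvd_mult_left_iff)
        hence "[b = c] (mod int p ^ 2)" by (simp add: cong_iff_dvd_diff)
        thus ?thesis using b c by (auto simp: cong_def)
      qed
    qed
    hence "card ?T \<le> card {b, int (p ^ 2) - b}" by (intro card_mono) auto
    also have "\<dots> \<le> 2" by (simp add: card_insert_if)
    finally show ?thesis unfolding roots_count_def by simp
  qed
qed

text \<open>For p > 3 a root must be a multiple of p once A is, which leaves at most p roots. The
  factor 9 covers p \<le> 3 by the trivial bound.\<close>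

lemma roots_count_prime_square_le':
  assumes p: "prime p" and pA: "int p dvd A"
  shows "roots_count A (p ^ 2) \<le> 9 * p"
proof (cases "p \<le> 3")
  case True
  hence "p ^ 2 \<le> 9 * p" by (simp add: power2_eq_square)
  thus ?thesis using roots_count_trivial[of A "p ^ 2"] by simp
next
  case False
  let ?T = "{b. 0 \<le> b \<and> b < int (p ^ 2) \<and> int (p ^ 2) dvd Delta A b}"
  have pp: "prime (int p)" using p by simp
  have nd: "\<not> int p dvd 27" using not_dvd_small[OF p, of 27] False by auto
  have "?T \<subseteq> (\<lambda>k. int p * k) ` {0..<int p}"
  proof
    fix b assume b: "b \<in> ?T"
    have "int p dvd Delta A b" using b by (auto intro: dvd_trans[of _ "int (p^2)"])
    moreover have "int p dvd 4 * A ^ 3" using pA by (simp add: power3_eq_cube)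
    ultimately have "int p dvd 27 * b ^ 2" by (simp add: Delta_def dvd_add_right_iff)
    hence "int p dvd b" using pp nd by (auto simp: prime_dvd_mult_iff prime_dvd_power_iff)
    then obtain k where k: "b = int p * k" by blast
    have "0 \<le> int p * k" "int p * k < int p * int p" using b k by (auto simp: power2_eq_square)
    hence "0 \<le> k" "k < int p" using p by (auto simp: zero_le_mult_iff prime_gt_0_nat)
    thus "b \<in> (\<lambda>k. int p * k) ` {0..<int p}" using k by auto
  qed
  hence "card ?T \<le> card ((\<lambda>k. int p * k) ` {0..<int p})" by (intro card_mono) auto
  also have "\<dots> \<le> card {0..<int p}" by (intro card_image_le) auto
  finally show ?thesis unfolding roots_count_def by simp
qed

lemma squarefree_eq_prod_prime_factors:
  fixes d :: nat
  assumes "squarefree d"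
  shows "d = \<Prod>(prime_factors d)"
proof -
  have "d \<noteq> 0" using assms by (metis not_squarefree_0)
  hence "d = (\<Prod>p\<in>prime_factors d. p ^ multiplicity p d)"
    using prime_factorization_nat by auto
  also have "\<dots> = \<Prod>(prime_factors d)"
  proof (rule prod.cong)
    fix p assume p: "p \<in> prime_factors d"
    hence "multiplicity p d = 1" using assms \<open>d \<noteq> 0\<close>
      by (metis squarefree_factorial_semiring' not_prime_0)
    thus "p ^ multiplicity p d = p" by simp
  qed simp
  finally show ?thesis .
qed

lemma multiplicative_square_squarefree:
  fixes f :: "nat \<Rightarrow> 'a :: comm_monoid_mult"
  assumes mult: "\<And>m n. coprime m n \<Longrightarrow> m > 0 \<Longrightarrow> n > 0 \<Longrightarrow> f (m * n) = f m * f n"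
    and one: "f 1 = 1" and sq: "squarefree d"
  shows "f (d ^ 2) = (\<Prod>p\<in>prime_factors d. f (p ^ 2))"
proof -
  have "f ((\<Prod>Q) ^ 2) = (\<Prod>p\<in>Q. f (p ^ 2))" if "finite Q" "\<And>p. p \<in> Q \<Longrightarrow> prime p" for Q
    using that
  proof (induction Q rule: finite_induct)
    case (insert p Q)
    have "coprime p (\<Prod>Q)"
      using insert by (intro prod_coprime_right) (metis insertCI primes_coprime)
    hence "coprime (p ^ 2) ((\<Prod>Q) ^ 2)" by simp
    moreover have "\<Prod>Q > 0" using insert by (intro prod_pos) (auto simp: prime_gt_0_nat)
    moreover have "p > 0" using insert by (simp add: prime_gt_0_nat)
    ultimately show ?case using insert by (simp add: power_mult_distrib mult)
  qed (use one in simp)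
  from this[of "prime_factors d"] show ?thesis
    using squarefree_eq_prod_prime_factors[OF sq] by auto
qed

lemma roots_count_1: "roots_count A 1 = 1"
proof -
  have "{b. 0 \<le> b \<and> b < int 1 \<and> int 1 dvd Delta A b} = {0}" by auto
  thus ?thesis by (simp add: roots_count_def)
qed

lemma rho_1: "rho 1 = 1"
  by (simp add: rho_eq_sum roots_count_1[simplified])

lemma roots_count_squarefree:
  assumes "squarefree d"
  shows "roots_count A (d ^ 2) = (\<Prod>p\<in>prime_factors d. roots_count A (p ^ 2))"
  using roots_count_mult roots_count_1 by (rule multiplicative_square_squarefree) (use assms in auto)

lemma rho_squarefree:
  assumes "squarefree d"
  shows "rho (d ^ 2) = (\<Prod>p\<in>prime_factors d. rho (p ^ 2))"
  using rho_mult rho_1 by (rule multiplicative_square_squarefree) (use assms in auto)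

lemma roots_count_squarefree_cong:
  assumes "squarefree d" "[A = A'] (mod int d)"
  shows "roots_count A (d ^ 2) = roots_count A' (d ^ 2)"
  unfolding roots_count_squarefree[OF assms(1)]
proof (rule prod.cong)
  fix p assume "p \<in> prime_factors d"
  hence "prime p" "int p dvd int d" by auto
  thus "roots_count A (p ^ 2) = roots_count A' (p ^ 2)"
    using assms(2) by (meson cong_dvd_modulus roots_count_prime_square_cong)
qed simp

lemma roots_count_squarefree_le:
  assumes "squarefree d" "coprime (int d) A"
  shows "roots_count A (d ^ 2) \<le> 9 ^ card (prime_factors d)"
proof -
  have "roots_count A (d ^ 2) \<le> (\<Prod>p\<in>prime_factors d. 9)"
    unfolding roots_count_squarefree[OF assms(1)]
  proof (rule prod_mono)
    fix p assume p: "p \<in> prime_factors d"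
    hence "int p dvd int d" by auto
    moreover have "\<not> is_unit (int p)" using p
      by (metis in_prime_factors_imp_prime not_prime_unit prime_nat_int_transfer)
    ultimately have "\<not> int p dvd A" using assms(2) coprime_common_divisor by blast
    thus "0 \<le> roots_count A (p ^ 2) \<and> roots_count A (p ^ 2) \<le> 9"
      using p by (auto intro: roots_count_prime_square_le)
  qed
  thus ?thesis by simp
qed

lemma sum_periodic_mult:
  fixes \<phi> :: "int \<Rightarrow> 'a :: comm_semiring_1"
  assumes "\<And>x. \<phi> (x + int d) = \<phi> x"
  shows "(\<Sum>a\<in>{0..<int d * int k}. \<phi> a) = of_nat k * (\<Sum>a\<in>{0..<int d}. \<phi> a)"
proof (induction k)
  case (Suc k)
  have shift: "\<phi> (x + int d * int k) = \<phi> x" for x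
  proof (induction k)
    case (Suc k)
    have "x + int d * int (Suc k) = (x + int d * int k) + int d" by (simp add: algebra_simps)
    thus ?case using Suc assms by metis
  qed simp
  define n where "n = int d * int k"
  have n: "n \<ge> 0" by (simp add: n_def)
  have e: "int d * int (Suc k) = n + int d" by (simp add: n_def algebra_simps)
  have "{0..<int d * int (Suc k)} = {0..<n} \<union> {n..<n + int d}"
    unfolding e using n by auto
  hence "(\<Sum>a\<in>{0..<int d * int (Suc k)}. \<phi> a) = (\<Sum>a\<in>{0..<n}. \<phi> a) + (\<Sum>a\<in>{n..<n + int d}. \<phi> a)"
    by (simp add: sum.union_disjoint)
  also have "(\<Sum>a\<in>{n..<n + int d}. \<phi> a) = (\<Sum>a\<in>{0..<int d}. \<phi> (a + n))"
    by (rule sum.reindex_bij_witness[of _ "\<lambda>a. a + n" "\<lambda>a. a - n"]) auto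
  finally show ?case using Suc shift by (simp add: n_def algebra_simps)
qed simp

text \<open>The root count depends on A modulo d only, so the interval of all A modulo
  \<open>d ^ 2\<close> consists of d equal periods.\<close>

lemma rho_square_eq:
  assumes "squarefree d"
  shows "rho (d ^ 2) = d * (\<Sum>a\<in>{0..<int d}. roots_count a (d ^ 2))"
proof -
  have "roots_count (x + int d) (d ^ 2) = roots_count x (d ^ 2)" for x
    by (rule roots_count_squarefree_cong[OF assms]) (simp add: cong_def)
  from sum_periodic_mult[of "\<lambda>x. roots_count x (d ^ 2)", OF this, of d]
  show ?thesis unfolding rho_eq_sum by (simp add: power2_eq_square)
qed

text \<open>The class of multiples of p contributes at most 9p roots and the remaining p - 1 classes
  at most 9 each; together 18p, taken p times.\<close>

lemma rho_prime_square_le: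
  assumes p: "prime p"
  shows "rho (p ^ 2) \<le> 18 * p ^ 2"
proof -
  have "{0..<int p} = insert 0 {1..<int p}" using p by (auto simp: prime_gt_0_nat)
  hence "(\<Sum>a\<in>{0..<int p}. roots_count a (p ^ 2)) = roots_count 0 (p ^ 2) + (\<Sum>a\<in>{1..<int p}. roots_count a (p ^ 2))"
    by simp
  also have "roots_count 0 (p ^ 2) \<le> 9 * p" using p by (intro roots_count_prime_square_le') auto
  also have "(\<Sum>a\<in>{1..<int p}. roots_count a (p ^ 2)) \<le> (\<Sum>a\<in>{1..<int p}. 9)"
    using p by (intro sum_mono roots_count_prime_square_le) (auto dest: zdvd_imp_le)
  also have "\<dots> \<le> 9 * p" by simp
  finally have "(\<Sum>a\<in>{0..<int p}. roots_count a (p ^ 2)) \<le> 18 * p" by simp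
  hence "p * (\<Sum>a\<in>{0..<int p}. roots_count a (p ^ 2)) \<le> p * (18 * p)" by (rule mult_le_mono2)
  thus ?thesis using rho_square_eq[of p] p by (simp add: squarefree_prime power2_eq_square)
qed

lemma rho_squarefree_le:
  assumes sq: "squarefree d"
  shows "rho (d ^ 2) \<le> 18 ^ card (prime_factors d) * d ^ 2"
proof -
  have "rho (d ^ 2) \<le> (\<Prod>p\<in>prime_factors d. 18 * p ^ 2)"
    unfolding rho_squarefree[OF sq] by (intro prod_mono) (auto intro: rho_prime_square_le)
  also have "\<dots> = 18 ^ card (prime_factors d) * (\<Prod>(prime_factors d)) ^ 2"
    by (simp add: prod.distrib prod_power_distrib)
  also have "\<Prod>(prime_factors d) = d" using squarefree_eq_prod_prime_factors[OF sq] by simp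
  finally show ?thesis .
qed

section \<open>Equidistribution of periodic conditions in boxes\<close>

lemma finite_int_box [simp]: "finite {x :: int. \<bar>real_of_int x\<bar> \<le> Z}"
proof (rule finite_subset)
  show "{x :: int. \<bar>real_of_int x\<bar> \<le> Z} \<subseteq> {-\<lfloor>Z\<rfloor>..\<lfloor>Z\<rfloor>}"
    by (auto simp: le_floor_iff minus_le_iff abs_le_iff)
qed simp

lemma finite_int_box_conj [simp]: "finite {x :: int. \<bar>real_of_int x\<bar> \<le> Z \<and> P x}"
  by (rule finite_subset[OF _ finite_int_box[of Z]]) auto

text \<open>The members are \<open>a + q * k\<close> with k in a closed interval of length
  \<open>2 * Z / q\<close>, and a closed interval of length L \<ge> 0 contains between L - 1 and L +
  1 integers.\<close>

lemma card_residue_class: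
  fixes q a :: int and Z :: real
  assumes q: "q > 0" and Z: "Z \<ge> 0" and a: "0 \<le> a" "a < q"
  shows "\<bar>real (card {x. real_of_int \<bar>x\<bar> \<le> Z \<and> x mod q = a}) - 2 * Z / q\<bar> \<le> 1"
proof -
  define u where "u = (- Z - a) / q"
  define v where "v = (Z - a) / q"
  have "bij_betw (\<lambda>k. a + q * k) {\<lceil>u\<rceil>..\<lfloor>v\<rfloor>} {x. real_of_int \<bar>x\<bar> \<le> Z \<and> x mod q = a}"
  proof (rule bij_betwI')
    fix x y :: int show "(a + q * x = a + q * y) = (x = y)" using q by simp
  next
    have iff: "k \<in> {\<lceil>u\<rceil>..\<lfloor>v\<rfloor>} \<longleftrightarrow> real_of_int \<bar>a + q * k\<bar> \<le> Z" for k :: int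
    proof -
      have "k \<in> {\<lceil>u\<rceil>..\<lfloor>v\<rfloor>} \<longleftrightarrow> u \<le> k \<and> k \<le> v" by (simp add: ceiling_le_iff le_floor_iff)
      also have "u \<le> k \<longleftrightarrow> -Z \<le> a + q * k" using q by (simp add: u_def field_simps)
      also have "k \<le> v \<longleftrightarrow> a + q * k \<le> Z" using q by (simp add: v_def field_simps)
      finally show ?thesis by (simp add: abs_le_iff) linarith
    qed
    {
      fix k assume "k \<in> {\<lceil>u\<rceil>..\<lfloor>v\<rfloor>}"
      thus "a + q * k \<in> {x. real_of_int \<bar>x\<bar> \<le> Z \<and> x mod q = a}" using iff a by simp
    next
      fix x assume x: "x \<in> {x. real_of_int \<bar>x\<bar> \<le> Z \<and> x mod q = a}"
      hence e: "x = a + q * (x div q)" by (metis (mono_tags) mem_Collect_eq mod_mult_div_eq)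
      hence "x div q \<in> {\<lceil>u\<rceil>..\<lfloor>v\<rfloor>}" using iff[of "x div q"] x by simp
      with e show "\<exists>k\<in>{\<lceil>u\<rceil>..\<lfloor>v\<rfloor>}. x = a + q * k" by blast
    }
  qed
  hence "card {x. real_of_int \<bar>x\<bar> \<le> Z \<and> x mod q = a} = nat (\<lfloor>v\<rfloor> - \<lceil>u\<rceil> + 1)"
    using bij_betw_same_card by fastforce
  moreover have "v - u = 2 * Z / q" using q by (simp add: u_def v_def field_simps)
  moreover have "v - u \<ge> 0" using calculation(2) Z q by simp
  ultimately show ?thesis by linarith
qed

text \<open>Every residue class is met \<open>2 * Z / q\<close> times up to an error of 1; weighting
  these errors by the nonnegative \<phi> costs at most the sum over one period.\<close>

lemma sum_int_box_periodic:
  fixes \<phi> :: "int \<Rightarrow> real" and q :: int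
  assumes q: "q > 0" and Z: "Z \<ge> 0" and nonneg: "\<And>x. \<phi> x \<ge> 0"
    and per: "\<And>x. \<phi> (x mod q) = \<phi> x"
  shows "\<bar>(\<Sum>x | real_of_int \<bar>x\<bar> \<le> Z. \<phi> x) - 2 * Z / q * (\<Sum>a\<in>{0..<q}. \<phi> a)\<bar> \<le> (\<Sum>a\<in>{0..<q}. \<phi> a)"
proof -
  define N where "N a = real (card {x. real_of_int \<bar>x\<bar> \<le> Z \<and> x mod q = a})" for a
  have "(\<Sum>x | real_of_int \<bar>x\<bar> \<le> Z. \<phi> x)
      = (\<Sum>a\<in>{0..<q}. \<Sum>x | x \<in> {x. real_of_int \<bar>x\<bar> \<le> Z} \<and> x mod q = a. \<phi> x)"
    using q by (intro sum.group[symmetric]) auto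
  also have "\<dots> = (\<Sum>a\<in>{0..<q}. N a * \<phi> a)"
  proof (rule sum.cong)
    fix a
    have "(\<Sum>x | x \<in> {x. real_of_int \<bar>x\<bar> \<le> Z} \<and> x mod q = a. \<phi> x)
        = (\<Sum>x | x \<in> {x. real_of_int \<bar>x\<bar> \<le> Z} \<and> x mod q = a. \<phi> a)"
      by (rule sum.cong) (auto simp: per)
    thus "(\<Sum>x | x \<in> {x. real_of_int \<bar>x\<bar> \<le> Z} \<and> x mod q = a. \<phi> x) = N a * \<phi> a"
      by (simp add: N_def)
  qed simp
  finally have "(\<Sum>x | real_of_int \<bar>x\<bar> \<le> Z. \<phi> x) - 2 * Z / q * (\<Sum>a\<in>{0..<q}. \<phi> a)
      = (\<Sum>a\<in>{0..<q}. (N a - 2 * Z / q) * \<phi> a)"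
    by (simp add: sum_distrib_left sum_subtractf left_diff_distrib)
  also have "\<bar>\<dots>\<bar> \<le> (\<Sum>a\<in>{0..<q}. 1 * \<phi> a)"
  proof (rule order_trans[OF sum_abs], rule sum_mono)
    fix a assume "a \<in> {0..<q}"
    hence "\<bar>N a - 2 * Z / q\<bar> \<le> 1" unfolding N_def using q Z by (intro card_residue_class) auto
    thus "\<bar>(N a - 2 * Z / q) * \<phi> a\<bar> \<le> 1 * \<phi> a"
      unfolding abs_mult using nonneg by (intro mult_mono) auto
  qed
  finally show ?thesis by simp
qed

lemma sum_indicator_eq_card:
  "finite S \<Longrightarrow> (\<Sum>x\<in>S. of_bool (P x)) = real (card {x \<in> S. P x})"
  by (simp add: of_bool_def sum.If_cases Collect_conj_eq Int_commute)

lemma card_roots_int_box: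
  assumes q: "q > 0" and Z: "Z \<ge> 0"
  shows "\<bar>real (card {B. real_of_int \<bar>B\<bar> \<le> Z \<and> int q dvd Delta A B}) - 2 * Z / q * roots_count A q\<bar>
           \<le> roots_count A q"
proof -
  let ?\<phi> = "\<lambda>B. of_bool (int q dvd Delta A B) :: real"
  have "(\<Sum>a\<in>{0..<int q}. ?\<phi> a) = roots_count A q"
    by (subst sum_indicator_eq_card) (auto simp: roots_count_def intro!: arg_cong[where f = card])
  moreover have "(\<Sum>x | real_of_int \<bar>x\<bar> \<le> Z. ?\<phi> x)
      = real (card {B. real_of_int \<bar>B\<bar> \<le> Z \<and> int q dvd Delta A B})"
    by (subst sum_indicator_eq_card) auto
  ultimately show ?thesis
    using sum_int_box_periodic[of "int q" Z ?\<phi>] q Z by (simp add: Delta_mod)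
qed

text \<open>Counting B modulo \<open>d ^ 2\<close> for each A costs T, the sum of the root counts
  over the A in the box. Evaluating T through periods of length d costs R, once in T itself and once
  multiplied by the density \<open>2 * Z / d ^ 2\<close>. As R is at most d up to the factor
  \<open>18 ^ card (prime_factors d)\<close>, the resulting errors are \<open>2 * Y\<close>,
  \<open>d\<close> and \<open>2 * Z / d\<close>.\<close>

lemma card_square_divisor_box:
  assumes sq: "squarefree d" and Y: "Y \<ge> 0" and Z: "Z \<ge> 0"
  shows "\<bar>real (card {p. real_of_int \<bar>fst p\<bar> \<le> Y \<and> real_of_int \<bar>snd p\<bar> \<le> Z \<and> int (d ^ 2) dvd Delta (fst p) (snd p)})
            - 4 * Y * Z * (real (rho (d ^ 2)) / d ^ 4)\<bar>
         \<le> 18 ^ card (prime_factors d) * (2 * Z / d + 2 * Y + d)"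
proof -
  have d: "d > 0" using sq by (metis gr0I not_squarefree_0)
  let ?r = "\<lambda>A. real (roots_count A (d ^ 2))"
  let ?N = "\<lambda>A. real (card {B. real_of_int \<bar>B\<bar> \<le> Z \<and> int (d ^ 2) dvd Delta A B})"
  define R where "R = (\<Sum>a\<in>{0..<int d}. ?r a)"
  define M where "M = real (card {p. real_of_int \<bar>fst p\<bar> \<le> Y \<and> real_of_int \<bar>snd p\<bar> \<le> Z \<and> int (d ^ 2) dvd Delta (fst p) (snd p)})"
  define T where "T = (\<Sum>A | real_of_int \<bar>A\<bar> \<le> Y. ?r A)"
  have R: "real (rho (d ^ 2)) = d * R" unfolding R_def rho_square_eq[OF sq] by simp
  have R0: "R \<ge> 0" unfolding R_def by (intro sum_nonneg) auto
  have "real (rho (d ^ 2)) \<le> real (18 ^ card (prime_factors d) * d ^ 2)"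
    using rho_squarefree_le[OF sq] by (simp only: of_nat_le_iff)
  hence "d * R \<le> d * (18 ^ card (prime_factors d) * d)"
    unfolding R by (simp add: power2_eq_square mult_ac)
  hence Rle: "R \<le> 18 ^ card (prime_factors d) * d" using d by simp
  have "{p. real_of_int \<bar>fst p\<bar> \<le> Y \<and> real_of_int \<bar>snd p\<bar> \<le> Z \<and> int (d ^ 2) dvd Delta (fst p) (snd p)}
      = Sigma {A. real_of_int \<bar>A\<bar> \<le> Y} (\<lambda>A. {B. real_of_int \<bar>B\<bar> \<le> Z \<and> int (d ^ 2) dvd Delta A B})"
    by auto
  hence "M = (\<Sum>A | real_of_int \<bar>A\<bar> \<le> Y. ?N A)"
    unfolding M_def by (subst \<open>_ = Sigma _ _\<close>, subst card_SigmaI) auto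
  hence "M - 2 * Z / d ^ 2 * T = (\<Sum>A | real_of_int \<bar>A\<bar> \<le> Y. ?N A - 2 * Z / d ^ 2 * ?r A)"
    by (simp add: T_def sum_subtractf sum_distrib_left)
  also have "\<bar>\<dots>\<bar> \<le> T"
    unfolding T_def
  proof (rule order_trans[OF sum_abs], rule sum_mono)
    fix A
    show "\<bar>?N A - 2 * Z / d ^ 2 * ?r A\<bar> \<le> ?r A"
      using card_roots_int_box[of "d ^ 2" Z A] d Z by simp
  qed
  finally have 1: "\<bar>M - 2 * Z / d ^ 2 * T\<bar> \<le> T" .
  have per: "?r (x mod int d) = ?r x" for x
    using roots_count_squarefree_cong[OF sq, of "x mod int d" x] by simp
  have 2: "\<bar>T - 2 * Y / d * R\<bar> \<le> R"
    using sum_int_box_periodic[of "int d" Y ?r] d Y per unfolding T_def R_def by simp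
  have "M - 4 * Y * Z * (d * R / d ^ 4) = (M - 2 * Z / d ^ 2 * T) + 2 * Z / d ^ 2 * (T - 2 * Y / d * R)"
    using d by (simp add: field_simps power2_eq_square power4_eq_xxxx)
  also have "\<bar>\<dots>\<bar> \<le> T + 2 * Z / d ^ 2 * R"
  proof -
    have "\<bar>2 * Z / d ^ 2 * (T - 2 * Y / d * R)\<bar> \<le> 2 * Z / d ^ 2 * R"
      unfolding abs_mult using 2 Z by (intro mult_mono) auto
    with 1 show ?thesis by (meson abs_triangle_ineq add_mono order_trans)
  qed
  also have "\<dots> \<le> (2 * Y / d * R + R) + 2 * Z / d ^ 2 * R" using 2 by linarith
  also have "\<dots> = R * (2 * Y / d + 1 + 2 * Z / d ^ 2)" by (simp add: algebra_simps)
  also have "\<dots> \<le> (18 ^ card (prime_factors d) * d) * (2 * Y / d + 1 + 2 * Z / d ^ 2)"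
    using Rle Y Z by (intro mult_right_mono) auto
  also have "\<dots> = 18 ^ card (prime_factors d) * (2 * Z / d + 2 * Y + d)"
    using d by (simp add: field_simps power2_eq_square)
  finally show ?thesis unfolding M_def R .
qed

section \<open>Sums over squarefree numbers and the Euler product\<close>

lemma bij_betw_prod_primes:
  fixes Q :: "nat set"
  assumes Q: "finite Q" "\<And>p. p \<in> Q \<Longrightarrow> prime p"
  shows "bij_betw \<Prod> (Pow Q) {d. squarefree d \<and> prime_factors d \<subseteq> Q}"
    and "S \<in> Pow Q \<Longrightarrow> prime_factors (\<Prod>S) = S"
proof -
  have pf: "prime_factors (\<Prod>S) = S" if "S \<in> Pow Q" for S
  proof -
    have fin: "finite S" and pr: "\<And>p. p \<in> S \<Longrightarrow> prime p" using that Q finite_subset by auto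
    \<comment> \<open>The instance \<open>pr[of 0]\<close> excludes 0 from \<open>S\<close>, as the
      rule for the prime factors of a product demands.\<close>
    have "prime_factors (prod (\<lambda>x. x) S) = \<Union>((prime_factors \<circ> (\<lambda>x. x)) ` S)"
      using fin pr[of 0] by (intro prime_factors_prod) auto
    also have "\<dots> = S" using pr by (auto simp: prime_prime_factors o_def)
    finally show ?thesis by simp
  qed
  thus "S \<in> Pow Q \<Longrightarrow> prime_factors (\<Prod>S) = S" .
  have sq: "squarefree (\<Prod>S)" if "S \<in> Pow Q" for S
  proof -
    have pr: "prime p" if "p \<in> S" for p using that \<open>S \<in> Pow Q\<close> Q by auto
    have "squarefree (prod (\<lambda>x. x) S)"
      by (rule squarefree_prod_coprime) (use pr in \<open>auto simp: primes_coprime squarefree_prime\<close>)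
    thus ?thesis by simp
  qed
  show "bij_betw \<Prod> (Pow Q) {d. squarefree d \<and> prime_factors d \<subseteq> Q}"
    by (rule bij_betw_byWitness[where f' = prime_factors])
       (use pf sq in \<open>auto simp: squarefree_eq_prod_prime_factors[symmetric]\<close>)
qed

lemma finite_squarefree_prime_factors_subset:
  fixes Q :: "nat set"
  assumes Q: "finite Q" "\<And>p. p \<in> Q \<Longrightarrow> prime p"
  shows "finite {d. squarefree d \<and> prime_factors d \<subseteq> Q}"
  using bij_betw_finite[OF bij_betw_prod_primes(1)[OF Q]] Q(1) by simp

text \<open>Expanding the right-hand side amounts to choosing a subset of Q, and these subsets are
  the prime factor sets of the squarefree d on the left. It serves both the Euler product and the
  vanishing of the Moebius sum.\<close>

lemma sum_squarefree_prod:
  fixes f :: "nat \<Rightarrow> 'a :: comm_semiring_1"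
  assumes Q: "finite Q" "\<And>p. p \<in> Q \<Longrightarrow> prime p"
  shows "(\<Sum>d | squarefree d \<and> prime_factors d \<subseteq> Q. \<Prod>p\<in>prime_factors d. f p) = (\<Prod>p\<in>Q. 1 + f p)"
proof -
  have "(\<Prod>p\<in>Q. f p + 1) = (\<Sum>S\<in>Pow Q. \<Prod>p\<in>S. f p)"
    using prod_add[of Q f "\<lambda>_. 1"] Q by simp
  also have "\<dots> = (\<Sum>S\<in>Pow Q. \<Prod>p\<in>prime_factors (\<Prod>S). f p)"
    by (intro sum.cong refl) (simp add: bij_betw_prod_primes(2)[OF Q])
  also have "\<dots> = (\<Sum>d | squarefree d \<and> prime_factors d \<subseteq> Q. \<Prod>p\<in>prime_factors d. f p)"
    by (rule sum.reindex_bij_betw[OF bij_betw_prod_primes(1)[OF Q]])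
  finally show ?thesis by (simp add: add.commute)
qed

section \<open>Powers of the number of prime factors, and tails of absolutely convergent
  series\<close>

text \<open>A prime p \<ge> m = \<open>nat \<lceil>k powr (1 / \<eta>)\<rceil>\<close> pays for its
  factor k with \<open>p powr \<eta>\<close>. At most m smaller primes remain, which gives C =
  \<open>k ^ m\<close>. The form with a set of primes is applied later to
  \<open>square_primes\<close> directly.\<close>

lemma power_card_primes_le:
  fixes k \<eta> :: real
  assumes k: "k \<ge> 1" and \<eta>: "\<eta> > 0"
  obtains C where "C \<ge> 1" "\<And>Q. finite Q \<Longrightarrow> (\<And>p. p \<in> Q \<Longrightarrow> prime p) \<Longrightarrow> k ^ card Q \<le> C * real (\<Prod>Q) powr \<eta>"
proof -
  define m where "m = nat \<lceil>k powr (1 / \<eta>)\<rceil>"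
  have m: "k \<le> real p powr \<eta>" if "p \<ge> m" for p
  proof -
    have "k powr (1 / \<eta>) \<le> real p" using that unfolding m_def by linarith
    hence "(k powr (1 / \<eta>)) powr \<eta> \<le> real p powr \<eta>" using \<eta> by (intro powr_mono2) auto
    thus ?thesis using \<eta> k by (simp add: powr_powr)
  qed
  have "k ^ card Q \<le> k ^ m * real (\<Prod>Q) powr \<eta>" if Q: "finite Q" "\<And>p. p \<in> Q \<Longrightarrow> prime p" for Q
  proof -
    have "k ^ card Q = (\<Prod>p\<in>Q. k)" by simp
    also have "\<dots> \<le> (\<Prod>p\<in>Q. (if p < m then k else 1) * real p powr \<eta>)"
    proof (rule prod_mono)
      fix p assume "p \<in> Q"
      hence "real p \<ge> 1" using Q(2) by (metis One_nat_def Suc_leI of_nat_1 of_nat_le_iff prime_gt_0_nat)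
      hence "real p powr \<eta> \<ge> 1" using \<eta> by (simp add: ge_one_powr_ge_zero)
      thus "0 \<le> k \<and> k \<le> (if p < m then k else 1) * real p powr \<eta>" using k m[of p] by auto
    qed
    also have "\<dots> = (\<Prod>p\<in>Q. if p < m then k else 1) * real (\<Prod>Q) powr \<eta>"
      by (simp add: prod.distrib prod_powr_distrib[symmetric])
    also have "(\<Prod>p\<in>Q. if p < m then k else 1) = k ^ card {p \<in> Q. p < m}"
      using Q by (simp add: prod.If_cases Collect_conj_eq Int_commute)
    also have "\<dots> \<le> k ^ m"
    proof (rule power_increasing[OF _ k])
      have "card {p \<in> Q. p < m} \<le> card {..<m}" by (rule card_mono) auto
      thus "card {p \<in> Q. p < m} \<le> m" by simp
    qed
    finally show ?thesis by (simp add: mult_right_mono)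
  qed
  thus ?thesis using that[of "k ^ m"] k by (simp add: one_le_power)
qed

lemma power_omega_le:
  fixes k \<eta> :: real
  assumes k: "k \<ge> 1" and \<eta>: "\<eta> > 0"
  obtains C where "C \<ge> 1" "\<And>d. squarefree d \<Longrightarrow> k ^ card (prime_factors d) \<le> C * real d powr \<eta>"
proof -
  obtain C where C: "C \<ge> 1" "\<And>Q. finite Q \<Longrightarrow> (\<And>p. p \<in> Q \<Longrightarrow> prime p) \<Longrightarrow> k ^ card Q \<le> C * real (\<Prod>Q) powr \<eta>"
    using power_card_primes_le[OF assms] by blast
  have "k ^ card (prime_factors d) \<le> C * real d powr \<eta>" if "squarefree d" for d
    using C(2)[of "prime_factors d"] squarefree_eq_prod_prime_factors[OF that] by auto
  with C(1) that show ?thesis by blast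
qed

lemma summable_powr_less_minus1: "\<eta> > 0 \<Longrightarrow> summable (\<lambda>n. real n powr (-1 - \<eta>))"
  by (simp add: summable_real_powr_iff)

text \<open>Rankin's device: beyond D a part \<open>d powr (-1 + \<eta>)\<close> of each term is
  replaced by \<open>D powr (-1 + \<eta>)\<close>, and \<open>d powr (-1 - \<eta> / 2)\<close> is
  left to ensure convergence. E is any finite set containing the support up to D, so that one bound
  serves truncation by size as well as by prime factors.\<close>

lemma tail_bound_rankin:
  fixes c :: "nat \<Rightarrow> real"
  assumes \<eta>: "0 < \<eta>" "\<eta> < 1" and C0: "C\<^sub>0 \<ge> 0" and c: "\<And>d. \<bar>c d\<bar> \<le> C\<^sub>0 * real d powr (\<eta> / 2 - 2)"
  obtains C where "C \<ge> 0" "summable (\<lambda>d. \<bar>c d\<bar>)"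
    "\<And>D E. D \<ge> 1 \<Longrightarrow> finite E \<Longrightarrow> {d. real d \<le> D \<and> c d \<noteq> 0} \<subseteq> E \<Longrightarrow> \<bar>(\<Sum>d\<in>E. c d) - suminf c\<bar> \<le> C * D powr (-1 + \<eta>)"
proof -
  define z where "z d = C\<^sub>0 * real d powr (-1 - \<eta> / 2)" for d :: nat
  have sz: "summable z" unfolding z_def using summable_powr_less_minus1[of "\<eta> / 2"] \<eta> by (intro summable_mult) auto
  have z0: "z d \<ge> 0" for d unfolding z_def using C0 by simp
  have cz: "\<bar>c d\<bar> \<le> D powr (-1 + \<eta>) * z d" if "D \<ge> 1" "real d \<ge> D" for d D
  proof -
    have "\<eta> / 2 - 2 = (-1 + \<eta>) + (-1 - \<eta> / 2)" by simp
    hence "real d powr (\<eta> / 2 - 2) = real d powr (-1 + \<eta>) * real d powr (-1 - \<eta> / 2)"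
      by (simp only: powr_add)
    also have "\<dots> \<le> D powr (-1 + \<eta>) * real d powr (-1 - \<eta> / 2)"
      using that \<eta> by (intro mult_right_mono powr_mono2') auto
    finally have "C\<^sub>0 * real d powr (\<eta> / 2 - 2) \<le> C\<^sub>0 * (D powr (-1 + \<eta>) * real d powr (-1 - \<eta> / 2))"
      using C0 by (rule mult_left_mono)
    with c[of d] show ?thesis by (simp add: z_def mult_ac)
  qed
  have cz1: "\<bar>c d\<bar> \<le> z d" for d
  proof (cases "d = 0")
    \<comment> \<open>Since \<open>0 powr x\<close> is 0, the hypothesis forces
      \<open>c 0 = 0\<close>.\<close>
    case True thus ?thesis using c[of 0] by (simp add: z_def)
  next
    case False thus ?thesis using cz[of 1 d] by simp
  qed
  have sc: "summable (\<lambda>d. \<bar>c d\<bar>)" by (rule summable_comparison_test[OF _ sz]) (use cz1 in auto)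
  hence sc': "summable c" by (rule summable_rabs_cancel)
  have "\<bar>(\<Sum>d\<in>E. c d) - suminf c\<bar> \<le> suminf z * D powr (-1 + \<eta>)"
    if D: "D \<ge> 1" and E: "finite E" "{d. real d \<le> D \<and> c d \<noteq> 0} \<subseteq> E" for D E
  proof -
    define g where "g d = (if d \<in> E then c d else 0) - c d" for d
    have "(\<lambda>d. if d \<in> E then c d else 0) sums (\<Sum>d\<in>E. c d)" by (rule sums_If_finite_set[OF E(1)])
    hence sg: "g sums ((\<Sum>d\<in>E. c d) - suminf c)" unfolding g_def
      using sc' by (intro sums_diff summable_sums)
    have gz: "\<bar>g d\<bar> \<le> D powr (-1 + \<eta>) * z d" for d
    proof (cases "d \<in> E")
      case True thus ?thesis using z0 by (simp add: g_def)
    next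
      case False
      show ?thesis
      proof (cases "real d \<le> D")
        case True with False E have "c d = 0" by blast
        with False z0 show ?thesis by (simp add: g_def)
      next
        case l: False
        with cz[of D d] D False show ?thesis by (simp add: g_def)
      qed
    qed
    have sm: "summable (\<lambda>d. D powr (-1 + \<eta>) * z d)" using sz by (rule summable_mult)
    have sag: "summable (\<lambda>d. \<bar>g d\<bar>)" by (rule summable_comparison_test[OF _ sm]) (use gz in auto)
    have "\<bar>suminf g\<bar> \<le> (\<Sum>d. \<bar>g d\<bar>)" by (rule summable_rabs[OF sag])
    also have "\<dots> \<le> (\<Sum>d. D powr (-1 + \<eta>) * z d)" by (rule suminf_le[OF gz sag sm])
    also have "\<dots> = D powr (-1 + \<eta>) * suminf z" by (rule suminf_mult[OF sz])
    finally show ?thesis using sums_unique[OF sg] by (simp add: mult_ac)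
  qed
  thus ?thesis using sc suminf_nonneg[OF sz z0] by (intro that[of "suminf z"]) auto
qed

text \<open>\<mu>(d) \<rho>(d^2) / d^4\<close>

definition euler_coeff :: "nat \<Rightarrow> real" where
  "euler_coeff d = (if squarefree d then \<Prod>p\<in>prime_factors d. - (real (rho (p ^ 2)) / real p ^ 4) else 0)"

lemma euler_coeff_eq:
  assumes "squarefree d"
  shows "euler_coeff d = (\<Prod>p\<in>prime_factors d. -1) * (real (rho (d ^ 2)) / real d ^ 4)"
proof -
  have "euler_coeff d = (\<Prod>p\<in>prime_factors d. -1 * (real (rho (p ^ 2)) / real p ^ 4))"
    using assms by (simp add: euler_coeff_def)
  also have "\<dots> = (\<Prod>p\<in>prime_factors d. -1) * (real (\<Prod>p\<in>prime_factors d. rho (p ^ 2)) / real (\<Prod>(prime_factors d)) ^ 4)"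
    by (simp only: prod.distrib prod_dividef of_nat_prod prod_power_distrib)
  finally show ?thesis
    using rho_squarefree[OF assms] squarefree_eq_prod_prime_factors[OF assms] by simp
qed

text \<open>The tail bound is used for two kinds of finite sets. With the squarefree numbers
  composed of primes up to m it shows that the partial products converge to the sum of all
  coefficients; with the squarefree numbers up to D it is the asserted estimate.\<close>

lemma euler_product_approx:
  fixes \<eta> :: real
  assumes \<eta>: "0 < \<eta>" "\<eta> < 1"
  obtains C where "C \<ge> 0"
    "\<And>D. D \<ge> 1 \<Longrightarrow> \<bar>(\<Sum>d | squarefree d \<and> real d \<le> D. euler_coeff d)
        - (\<Prod>n. if prime n then 1 - real (rho (n ^ 2)) / real n ^ 4 else 1)\<bar> \<le> C * D powr (-1 + \<eta>)"
proof -
  let ?f = "\<lambda>n. if prime n then 1 - real (rho (n ^ 2)) / real n ^ 4 else 1"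
  obtain C\<^sub>0 where C0: "C\<^sub>0 \<ge> 1" "\<And>d. squarefree d \<Longrightarrow> 18 ^ card (prime_factors d) \<le> C\<^sub>0 * real d powr (\<eta> / 2)"
    using power_omega_le[of 18 "\<eta> / 2"] \<eta> by auto
  have c: "\<bar>euler_coeff d\<bar> \<le> C\<^sub>0 * real d powr (\<eta> / 2 - 2)" for d
  proof (cases "squarefree d")
    case True
    hence d: "d > 0" by (metis gr0I not_squarefree_0)
    have "real (rho (d ^ 2)) \<le> real (18 ^ card (prime_factors d) * d ^ 2)"
      using rho_squarefree_le[OF True] by (simp only: of_nat_le_iff)
    also have "\<dots> \<le> C\<^sub>0 * real d powr (\<eta> / 2) * real d ^ 2"
      using C0(2)[OF True] by (simp add: mult_right_mono)
    finally have "real (rho (d ^ 2)) / real d ^ 4 \<le> C\<^sub>0 * real d powr (\<eta> / 2) * real d ^ 2 / real d ^ 4"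
      by (rule divide_right_mono) simp
    also have "\<dots> = C\<^sub>0 * real d powr (\<eta> / 2 - 2)"
      using d by (simp add: powr_diff power2_eq_square power4_eq_xxxx)
    finally show ?thesis
      unfolding euler_coeff_eq[OF True] by (simp add: abs_mult)
  qed (use C0 in \<open>simp add: euler_coeff_def\<close>)
  from C0 have C00: "C\<^sub>0 \<ge> 0" by simp
  obtain C where C: "C \<ge> 0" and sum: "summable (\<lambda>d. \<bar>euler_coeff d\<bar>)"
    and tail: "\<And>D E. D \<ge> 1 \<Longrightarrow> finite E \<Longrightarrow> {d. real d \<le> D \<and> euler_coeff d \<noteq> 0} \<subseteq> E \<Longrightarrow>
        \<bar>(\<Sum>d\<in>E. euler_coeff d) - suminf euler_coeff\<bar> \<le> C * D powr (-1 + \<eta>)"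
    using tail_bound_rankin[of \<eta> C\<^sub>0 euler_coeff, OF \<eta> C00 c] by blast
  \<comment> \<open>At a prime, the deviation of the factor from 1 is the coefficient at that prime,
    and elsewhere it is 0; absolute convergence of the series thus gives that of the
    product.\<close>
  have "summable (\<lambda>n. norm (?f n - 1))"
  proof (rule summable_comparison_test[OF _ sum], intro exI allI impI)
    fix n
    show "norm (norm (?f n - 1)) \<le> \<bar>euler_coeff n\<bar>"
      by (simp add: euler_coeff_def squarefree_prime prime_prime_factors)
  qed
  hence "convergent_prod ?f" by (intro abs_convergent_prod_imp_convergent_prod summable_imp_abs_convergent_prod)
  hence lim1: "(\<lambda>m. \<Prod>n\<le>m. ?f n) \<longlonglongrightarrow> prodinf ?f" by (rule convergent_prod_LIMSEQ)
  have bound: "norm ((\<Prod>n\<le>m. ?f n) - suminf euler_coeff) \<le> C * real m powr (-1 + \<eta>)" if "m \<ge> 1" for m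
  proof -
    define Q where "Q = {p. prime p \<and> p \<le> m}"
    have Q: "finite Q" "\<And>p. p \<in> Q \<Longrightarrow> prime p" by (auto simp: Q_def)
    have "(\<Prod>n\<le>m. ?f n) = (\<Prod>p\<in>Q. 1 + - (real (rho (p ^ 2)) / real p ^ 4))"
      by (rule prod.mono_neutral_cong_right) (auto simp: Q_def)
    also have "\<dots> = (\<Sum>d | squarefree d \<and> prime_factors d \<subseteq> Q. \<Prod>p\<in>prime_factors d. - (real (rho (p ^ 2)) / real p ^ 4))"
      by (rule sum_squarefree_prod[OF Q, symmetric])
    also have "\<dots> = (\<Sum>d | squarefree d \<and> prime_factors d \<subseteq> Q. euler_coeff d)"
      by (rule sum.cong) (auto simp: euler_coeff_def)
    also have "\<bar>\<dots> - suminf euler_coeff\<bar> \<le> C * real m powr (-1 + \<eta>)"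
    proof (rule tail[of "real m"])
      show "{d. real d \<le> real m \<and> euler_coeff d \<noteq> 0} \<subseteq> {d. squarefree d \<and> prime_factors d \<subseteq> Q}"
      proof clarify
        fix d assume d: "real d \<le> real m" "euler_coeff d \<noteq> 0"
        hence sq: "squarefree d" by (auto simp: euler_coeff_def split: if_splits)
        hence "d > 0" by (metis gr0I not_squarefree_0)
        hence "p \<le> m" if "p \<in> prime_factors d" for p
          using that d dvd_imp_le[of p d] by (auto simp: prime_factors_dvd)
        with sq show "squarefree d \<and> prime_factors d \<subseteq> Q" by (auto simp: Q_def)
      qed
    next
      show "finite {d. squarefree d \<and> prime_factors d \<subseteq> Q}" by (rule finite_squarefree_prime_factors_subset[OF Q])
    qed (use that in simp)
    finally show ?thesis unfolding real_norm_def .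
  qed
  have "(\<lambda>m. C * real m powr (-1 + \<eta>)) \<longlonglongrightarrow> C * 0"
    using \<eta> by (intro tendsto_mult tendsto_const tendsto_neg_powr filterlim_real_sequentially) auto
  hence lim0: "(\<lambda>m. C * real m powr (-1 + \<eta>)) \<longlonglongrightarrow> 0" by simp
  have "\<forall>\<^sub>F m in sequentially. norm ((\<Prod>n\<le>m. ?f n) - suminf euler_coeff) \<le> C * real m powr (-1 + \<eta>)"
    by (rule eventually_sequentiallyI[of 1]) (rule bound)
  from this lim0 have "(\<lambda>m. (\<Prod>n\<le>m. ?f n) - suminf euler_coeff) \<longlonglongrightarrow> 0"
    by (rule Lim_null_comparison)
  hence "(\<lambda>m. \<Prod>n\<le>m. ?f n) \<longlonglongrightarrow> suminf euler_coeff" by (simp add: LIM_zero_iff)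
  with lim1 have eq: "prodinf ?f = suminf euler_coeff" by (rule LIMSEQ_unique)
  have "\<bar>(\<Sum>d | squarefree d \<and> real d \<le> D. euler_coeff d) - prodinf ?f\<bar> \<le> C * D powr (-1 + \<eta>)" if "D \<ge> 1" for D
    unfolding eq
  proof (rule tail)
    show "finite {d. squarefree d \<and> real d \<le> D}"
      by (rule finite_subset[of _ "{..nat \<lfloor>D\<rfloor>}"]) (auto simp: le_nat_floor)
  qed (use that in \<open>auto simp: euler_coeff_def split: if_splits\<close>)
  with C show ?thesis using that by blast
qed

section \<open>Large square divisors and binary cubic forms\<close>

text \<open>The double root is a rational expression in A and B with denominator 2A, so
  invertibility of 2A produces it modulo \<open>d ^ 2\<close> at once, without lifting or a
  decomposition of d into primes.\<close>

lemma exists_double_root: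
  fixes A B d :: int
  assumes cop: "coprime (2 * A) d" and dvd: "d ^ 2 dvd Delta A B"
  obtains t where "d ^ 2 dvd 3 * t ^ 2 + A" "d ^ 2 dvd t ^ 3 + A * t + B"
proof -
  have cop2: "coprime (2 * A) (d ^ 2)" using cop by (rule coprime_power_right_iff[THEN iffD2, OF disjI1])
  then obtain x where x: "[(2 * A) * x = 1] (mod d ^ 2)"
    by (metis cong_solve_coprime_int)
  \<comment> \<open>the double root of x^3 + Ax + B modulo a divisor of the discriminant is -3B / 2A\<close>
  define t where "t = - 3 * B * x"
  have "[(2 * A) * x * (- 3 * B) = 1 * (- 3 * B)] (mod d ^ 2)" by (rule cong_scalar_right[OF x])
  hence "[2 * A * t = - 3 * B] (mod d ^ 2)" by (simp add: t_def mult_ac)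
  then obtain k where k: "- 3 * B = 2 * A * t + d ^ 2 * k" by (metis cong_iff_lin)
  hence k': "2 * A * t = - 3 * B - d ^ 2 * k" by simp
  have copA: "coprime A d" using cop by simp
  have cop2d: "coprime 2 d" using cop by simp
  have copn: "coprime (d ^ 2) (2 ^ i * A ^ j)" for i j :: nat
    using copA cop2d by (simp add: coprime_commute)
  \<comment> \<open>Clearing denominators: modulo \<open>d ^ 2\<close>, the derivative at t times
    (2A)^2 becomes \<open>Delta A B\<close>, and below the cubic at t times (2A)^3 becomes
    \<open>- B * Delta A B\<close>.\<close>
  have "2 ^ 2 * A ^ 2 * (3 * t ^ 2 + A) = 3 * (2 * A * t) ^ 2 + 4 * A ^ 3"
    by (simp add: power2_eq_square power3_eq_cube algebra_simps)
  also have "\<dots> = Delta A B + d ^ 2 * (3 * k * (6 * B + d ^ 2 * k))"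
    unfolding k' Delta_def by (simp add: power2_eq_square algebra_simps)
  finally have "d ^ 2 dvd 2 ^ 2 * A ^ 2 * (3 * t ^ 2 + A)" using dvd by (simp only: dvd_add dvd_triv_left)
  hence 1: "d ^ 2 dvd 3 * t ^ 2 + A" using coprime_dvd_mult_right_iff[OF copn] by blast
  have "2 ^ 3 * A ^ 3 * (t ^ 3 + A * t + B) = (2 * A * t) ^ 3 + 4 * A ^ 3 * (2 * A * t) + 8 * A ^ 3 * B"
    by (simp add: power2_eq_square power3_eq_cube algebra_simps)
  also have "\<dots> = - (B * Delta A B) + d ^ 2 * (- k * (27 * B ^ 2 + 9 * B * d ^ 2 * k + d ^ 2 * d ^ 2 * k ^ 2) - 4 * A ^ 3 * k)"
    unfolding k' Delta_def by (simp add: power2_eq_square power3_eq_cube algebra_simps)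
  finally have "d ^ 2 dvd 2 ^ 3 * A ^ 3 * (t ^ 3 + A * t + B)"
    using dvd by (simp only: dvd_add dvd_triv_left dvd_minus_iff dvd_mult)
  hence "d ^ 2 dvd t ^ 3 + A * t + B" using coprime_dvd_mult_right_iff[OF copn] by blast
  with 1 that show ?thesis by blast
qed

text \<open>Lagrange reduction in the lattice s \<equiv> ty (mod d), for the norm s^2 + W y^2. Two
  vectors of this lattice with determinant d form a basis, because d is its index in the integer
  lattice.\<close>

lemma exists_reduced_basis:
  fixes d t :: int and W :: real
  assumes d: "d > 0" and W: "W \<ge> 1"
  obtains s\<^sub>1 y\<^sub>1 s\<^sub>2 y\<^sub>2 :: int where
    "d dvd s\<^sub>1 - t * y\<^sub>1" "d dvd s\<^sub>2 - t * y\<^sub>2" "s\<^sub>1 * y\<^sub>2 - s\<^sub>2 * y\<^sub>1 = d"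
    "real_of_int s\<^sub>1 ^ 2 + W * real_of_int y\<^sub>1 ^ 2 \<le> real_of_int s\<^sub>2 ^ 2 + W * real_of_int y\<^sub>2 ^ 2"
    "(real_of_int s\<^sub>1 ^ 2 + W * real_of_int y\<^sub>1 ^ 2) * (real_of_int s\<^sub>2 ^ 2 + W * real_of_int y\<^sub>2 ^ 2) \<le> 4 * W * real_of_int d ^ 2"
proof -
  define q where "q s y = real_of_int s ^ 2 + W * real_of_int y ^ 2" for s y :: int
  define basis where "basis = (\<lambda>(s\<^sub>1, y\<^sub>1, s\<^sub>2, y\<^sub>2). d dvd s\<^sub>1 - t * y\<^sub>1 \<and> d dvd s\<^sub>2 - t * y\<^sub>2 \<and> s\<^sub>1 * y\<^sub>2 - s\<^sub>2 * y\<^sub>1 = d)"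
  define h where "h = (\<lambda>(s\<^sub>1, y\<^sub>1, s\<^sub>2, y\<^sub>2). q s\<^sub>1 y\<^sub>1 + q s\<^sub>2 y\<^sub>2)"
  \<comment> \<open>A basis minimising the sum of both squared lengths is reduced: adding one vector to the other
    does not shorten it, which bounds the inner product.\<close>
  define b0 where "b0 = (d, 0::int, t, 1::int)"
  define S where "S = {b. basis b \<and> h b \<le> h b0}"
  have b0: "basis b0" by (simp add: basis_def b0_def)
  have q0: "q s y \<ge> 0" for s y using W by (simp add: q_def)
  have le: "\<bar>real_of_int s\<bar> \<le> z" "\<bar>real_of_int y\<bar> \<le> z" if "q s y \<le> z" for s y z
  proof -
    have sq: "\<bar>real_of_int x\<bar> \<le> real_of_int x ^ 2" for x :: int
    proof (cases "x = 0")
      case False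
      hence "1 \<le> \<bar>real_of_int x\<bar>" by linarith
      hence "\<bar>real_of_int x\<bar> * 1 \<le> \<bar>real_of_int x\<bar> * \<bar>real_of_int x\<bar>" by (intro mult_left_mono) auto
      thus ?thesis by (simp add: power2_eq_square)
    qed simp
    have "real_of_int y ^ 2 \<le> W * real_of_int y ^ 2" using W by (simp add: mult_le_cancel_right1)
    moreover have "real_of_int s ^ 2 \<ge> 0" "W * real_of_int y ^ 2 \<ge> 0" using W by auto
    ultimately show "\<bar>real_of_int s\<bar> \<le> z" "\<bar>real_of_int y\<bar> \<le> z"
      using that sq[of s] sq[of y] unfolding q_def by linarith+
  qed
  have "S \<subseteq> (let I = {x::int. \<bar>real_of_int x\<bar> \<le> h b0} in I \<times> I \<times> I \<times> I)"
  proof (clarsimp simp: Let_def)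
    fix s\<^sub>1 y\<^sub>1 s\<^sub>2 y\<^sub>2 assume "(s\<^sub>1, y\<^sub>1, s\<^sub>2, y\<^sub>2) \<in> S"
    hence "q s\<^sub>1 y\<^sub>1 + q s\<^sub>2 y\<^sub>2 \<le> h b0" by (simp add: S_def h_def)
    hence "q s\<^sub>1 y\<^sub>1 \<le> h b0" "q s\<^sub>2 y\<^sub>2 \<le> h b0" using q0[of s\<^sub>1 y\<^sub>1] q0[of s\<^sub>2 y\<^sub>2] by linarith+
    thus "\<bar>real_of_int s\<^sub>1\<bar> \<le> h b0 \<and> \<bar>real_of_int y\<^sub>1\<bar> \<le> h b0 \<and> \<bar>real_of_int s\<^sub>2\<bar> \<le> h b0 \<and> \<bar>real_of_int y\<^sub>2\<bar> \<le> h b0"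
      using le by blast
  qed
  moreover have "finite (let I = {x::int. \<bar>real_of_int x\<bar> \<le> h b0} in I \<times> I \<times> I \<times> I)"
    by (simp add: Let_def)
  ultimately have "finite S" by (rule finite_subset)
  moreover have "b0 \<in> S" using b0 by (simp add: S_def)
  hence "S \<noteq> {}" by blast
  ultimately obtain b where "is_arg_min h (\<lambda>b. b \<in> S) b" using ex_is_arg_min_if_finite by blast
  hence bS: "b \<in> S" and bmin: "\<And>c. c \<in> S \<Longrightarrow> h b \<le> h c" by (auto simp: is_arg_min_linorder)
  have min: "h b \<le> h c" if "basis c" for c
  proof (cases "h c \<le> h b0")
    case True thus ?thesis using that bmin by (simp add: S_def)
  next
    case False thus ?thesis using bS by (simp add: S_def)
  qed
  obtain s\<^sub>1 y\<^sub>1 s\<^sub>2 y\<^sub>2 where b: "b = (s\<^sub>1, y\<^sub>1, s\<^sub>2, y\<^sub>2)" by (cases b) auto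
  have B: "d dvd s\<^sub>1 - t * y\<^sub>1" "d dvd s\<^sub>2 - t * y\<^sub>2" "s\<^sub>1 * y\<^sub>2 - s\<^sub>2 * y\<^sub>1 = d"
    using bS by (auto simp: S_def basis_def b)
  define u where "u = real_of_int s\<^sub>1 * s\<^sub>2 + W * y\<^sub>1 * y\<^sub>2"
  have shift: "basis (s\<^sub>1 + j * s\<^sub>2, y\<^sub>1 + j * y\<^sub>2, s\<^sub>2, y\<^sub>2)" "basis (s\<^sub>1, y\<^sub>1, s\<^sub>2 + j * s\<^sub>1, y\<^sub>2 + j * y\<^sub>1)" for j
  proof -
    have "s\<^sub>1 + j * s\<^sub>2 - t * (y\<^sub>1 + j * y\<^sub>2) = (s\<^sub>1 - t * y\<^sub>1) + j * (s\<^sub>2 - t * y\<^sub>2)"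
      "s\<^sub>2 + j * s\<^sub>1 - t * (y\<^sub>2 + j * y\<^sub>1) = (s\<^sub>2 - t * y\<^sub>2) + j * (s\<^sub>1 - t * y\<^sub>1)"
      by (simp_all add: algebra_simps)
    hence "d dvd s\<^sub>1 + j * s\<^sub>2 - t * (y\<^sub>1 + j * y\<^sub>2)" "d dvd s\<^sub>2 + j * s\<^sub>1 - t * (y\<^sub>2 + j * y\<^sub>1)"
      using B by (simp_all only: dvd_add dvd_mult)
    with B show "basis (s\<^sub>1 + j * s\<^sub>2, y\<^sub>1 + j * y\<^sub>2, s\<^sub>2, y\<^sub>2)" "basis (s\<^sub>1, y\<^sub>1, s\<^sub>2 + j * s\<^sub>1, y\<^sub>2 + j * y\<^sub>1)"
      by (simp_all add: basis_def algebra_simps)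
  qed
  have q_add: "q (s + j * s') (y + j * y') = q s y + 2 * j * (real_of_int s * s' + W * y * y') + j ^ 2 * q s' y'" for s s' y y' j
    by (simp add: q_def power2_eq_square algebra_simps)
  have "0 \<le> 2 * real_of_int j * u + j ^ 2 * q s\<^sub>2 y\<^sub>2" for j
    using min[OF shift(1)[of j]] unfolding b h_def prod.case q_add u_def by (simp add: algebra_simps)
  \<comment> \<open>The choices j = 1 and j = -1 cover both signs of the inner product.\<close>
  from this[of 1] this[of "-1"] have u1: "2 * \<bar>u\<bar> \<le> q s\<^sub>2 y\<^sub>2" by simp
  have "0 \<le> 2 * real_of_int j * u + j ^ 2 * q s\<^sub>1 y\<^sub>1" for j
    using min[OF shift(2)[of j]] unfolding b h_def prod.case q_add u_def by (simp add: algebra_simps)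
  from this[of 1] this[of "-1"] have u2: "2 * \<bar>u\<bar> \<le> q s\<^sub>1 y\<^sub>1" by simp
  \<comment> \<open>Gram determinant of the basis. Combined with the bound for \<open>u ^ 2\<close>
    it yields even the factor 4/3; the weaker factor 4 has the integral square root 2.\<close>
  have "q s\<^sub>1 y\<^sub>1 * q s\<^sub>2 y\<^sub>2 - u ^ 2 = W * (real_of_int s\<^sub>1 * y\<^sub>2 - s\<^sub>2 * y\<^sub>1) ^ 2"
    by (simp add: q_def u_def power2_eq_square algebra_simps)
  also have "real_of_int s\<^sub>1 * y\<^sub>2 - s\<^sub>2 * y\<^sub>1 = real_of_int d"
    unfolding B(3)[symmetric] by simp
  finally have det: "q s\<^sub>1 y\<^sub>1 * q s\<^sub>2 y\<^sub>2 - u ^ 2 = W * d ^ 2" by simp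
  have "(2 * \<bar>u\<bar>) * (2 * \<bar>u\<bar>) \<le> q s\<^sub>1 y\<^sub>1 * q s\<^sub>2 y\<^sub>2"
    using u1 u2 q0 by (intro mult_mono) auto
  hence "4 * u ^ 2 \<le> q s\<^sub>1 y\<^sub>1 * q s\<^sub>2 y\<^sub>2" by (simp add: power2_eq_square)
  moreover have "0 \<le> q s\<^sub>1 y\<^sub>1 * q s\<^sub>2 y\<^sub>2" using q0 by simp
  ultimately have prod: "q s\<^sub>1 y\<^sub>1 * q s\<^sub>2 y\<^sub>2 \<le> 4 * (W * d ^ 2)" using det by linarith
  show ?thesis
  proof (cases "q s\<^sub>1 y\<^sub>1 \<le> q s\<^sub>2 y\<^sub>2")
    case True
    show ?thesis by (rule that[OF B]) (use True prod in \<open>simp_all add: q_def mult_ac\<close>)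
  next
    case False
    \<comment> \<open>Exchanging the vectors reverses the sign of the determinant, and negating one
      of them restores it.\<close>
    have "d dvd - s\<^sub>1 - t * (- y\<^sub>1)" using B(1) by (metis dvd_minus_iff minus_diff_eq minus_mult_right diff_minus_eq_add uminus_add_conv_diff add.commute)
    moreover have "s\<^sub>2 * (- y\<^sub>1) - (- s\<^sub>1) * y\<^sub>2 = d" using B(3) by simp
    ultimately show ?thesis
      using that[of s\<^sub>2 y\<^sub>2 "- s\<^sub>1" "- y\<^sub>1"] B False prod by (simp add: q_def mult_ac)
  qed
qed

section \<open>The binary cubic form attached to a square divisor\<close>

text \<open>The cubic is monic, so after cancelling the gcd the denominator y' divides s'^3 and is a
  unit; being its own inverse, it gives the root s'y'. Without integer roots the form thus vanishes
  at no nonzero vector, which makes the extreme coefficients nonzero.\<close>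

lemma rational_root_imp_integer_root:
  fixes A B s y :: int
  assumes y: "y \<noteq> 0" and e: "s ^ 3 + A * s * y ^ 2 + B * y ^ 3 = 0"
  shows "\<exists>r. r ^ 3 + A * r + B = 0"
proof -
  define g where "g = gcd s y"
  have g: "g \<noteq> 0" using y by (simp add: g_def)
  obtain s' y' where s': "s = g * s'" "y = g * y'" "coprime s' y'"
    using gcd_coprime_exists[of s y] g unfolding g_def by (metis mult.commute)
  have "g ^ 3 * (s' ^ 3 + A * s' * y' ^ 2 + B * y' ^ 3) = 0"
    using e unfolding s' by (simp add: power2_eq_square power3_eq_cube algebra_simps)
  hence e': "s' ^ 3 + A * s' * y' ^ 2 + B * y' ^ 3 = 0" using g by simp
  hence "s' ^ 3 = y' * (- A * s' * y' - B * y' ^ 2)" by (simp add: power2_eq_square power3_eq_cube algebra_simps)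
  hence "y' dvd s' ^ 3" by simp
  moreover have "coprime y' (s' ^ 3)" using s'(3) by (simp add: coprime_commute)
  ultimately have "is_unit y'" by (meson coprime_common_divisor dvd_refl)
  hence y1: "y' ^ 2 = 1" "y' * y' = 1" by (auto simp: zdvd1_eq abs_if power2_eq_square split: if_splits)
  have "(s' * y') ^ 3 + A * (s' * y') + B = y' * (s' ^ 3 * (y' * y') + A * s' + B * y') + B * (1 - y' * y')"
    by (simp add: power2_eq_square power3_eq_cube algebra_simps)
  also have "\<dots> = y' * (s' ^ 3 + A * s' * y' ^ 2 + B * y' ^ 3)"
    using y1 by (simp add: power3_eq_cube)
  finally show ?thesis using e' by auto
qed

text \<open>
  For F(s, y) = s^3 + A s y^2 + B y^3 the Hessian covariant takes the value -3A at (1, 0), and the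
  Jacobian of F and its Hessian takes the value -27B there. The two functions below evaluate these
  covariants of the form (a, b, c, e) at (x, y).
\<close>

definition cubic_A :: "int \<times> int \<times> int \<times> int \<times> int \<times> int \<Rightarrow> int" where
  "cubic_A = (\<lambda>(a, b, c, e, x, y). - (((b\<^sup>2 - 3*a*c) * x\<^sup>2 + (b*c - 9*a*e) * x*y + (c\<^sup>2 - 3*b*e) * y\<^sup>2) div 3))"

definition cubic_B :: "int \<times> int \<times> int \<times> int \<times> int \<times> int \<Rightarrow> int" where
  "cubic_B = (\<lambda>(a, b, c, e, x, y).
     - (((3*a*x\<^sup>2 + 2*b*x*y + c*y\<^sup>2) * ((b*c - 9*a*e) * x + 2 * (c\<^sup>2 - 3*b*e) * y)
         - (b*x\<^sup>2 + 2*c*x*y + 3*e*y\<^sup>2) * (2 * (b\<^sup>2 - 3*a*c) * x + (b*c - 9*a*e) * y)) div 27))"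

text \<open>All powers of d cancel. The form (a, b, c, e) arises from s^3 + Asy^2 + By^3 by a
  substitution of determinant d and division by \<open>d\<^sup>2\<close>, and
  \<open>(y\<^sub>2, - y\<^sub>1)\<close> is mapped to (d, 0). The Hessian, of weight 2, degree 2
  and order 2, picks up d^2 d^(-4) d^2; the Jacobian, where all three are 3, picks up d^3 d^(-6)
  d^3. Hence the values at (1, 0) return exactly, and the divisions by 3 and 27 are exact as
  well.\<close>

lemma cubic_covariants:
  fixes A B d s\<^sub>1 y\<^sub>1 s\<^sub>2 y\<^sub>2 a b c e :: int
  assumes d: "s\<^sub>1 * y\<^sub>2 - s\<^sub>2 * y\<^sub>1 = d" "d \<noteq> 0"
    and a: "d\<^sup>2 * a = s\<^sub>1 ^ 3 + A * s\<^sub>1 * y\<^sub>1\<^sup>2 + B * y\<^sub>1 ^ 3"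
    and b: "d\<^sup>2 * b = 3 * s\<^sub>1\<^sup>2 * s\<^sub>2 + A * (2 * s\<^sub>1 * y\<^sub>1 * y\<^sub>2 + s\<^sub>2 * y\<^sub>1\<^sup>2) + 3 * B * y\<^sub>1\<^sup>2 * y\<^sub>2"
    and c: "d\<^sup>2 * c = 3 * s\<^sub>1 * s\<^sub>2\<^sup>2 + A * (2 * s\<^sub>2 * y\<^sub>1 * y\<^sub>2 + s\<^sub>1 * y\<^sub>2\<^sup>2) + 3 * B * y\<^sub>1 * y\<^sub>2\<^sup>2"
    and e: "d\<^sup>2 * e = s\<^sub>2 ^ 3 + A * s\<^sub>2 * y\<^sub>2\<^sup>2 + B * y\<^sub>2 ^ 3"
  shows "cubic_A (a, b, c, e, y\<^sub>2, - y\<^sub>1) = A" and "cubic_B (a, b, c, e, y\<^sub>2, - y\<^sub>1) = B"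
proof -
  define P where "P = b\<^sup>2 - 3*a*c"
  define Q where "Q = b*c - 9*a*e"
  define R where "R = c\<^sup>2 - 3*b*e"
  have d2: "d\<^sup>2 \<noteq> 0" using d(2) by simp
  have "d\<^sup>2 * (d\<^sup>2 * P) = (d\<^sup>2 * b)\<^sup>2 - 3 * (d\<^sup>2 * a) * (d\<^sup>2 * c)"
    by (simp add: P_def power2_eq_square algebra_simps)
  also have "\<dots> = d\<^sup>2 * (- 3 * A * s\<^sub>1\<^sup>2 - 9 * B * s\<^sub>1 * y\<^sub>1 + A\<^sup>2 * y\<^sub>1\<^sup>2)"
    unfolding a b c unfolding d(1)[symmetric] by (simp add: power2_eq_square power3_eq_cube algebra_simps)
  finally have P: "d\<^sup>2 * P = - 3 * A * s\<^sub>1\<^sup>2 - 9 * B * s\<^sub>1 * y\<^sub>1 + A\<^sup>2 * y\<^sub>1\<^sup>2" using d2 by (simp only: mult_cancel_left simp_thms)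
  have "d\<^sup>2 * (d\<^sup>2 * Q) = (d\<^sup>2 * b) * (d\<^sup>2 * c) - 9 * (d\<^sup>2 * a) * (d\<^sup>2 * e)"
    by (simp add: Q_def power2_eq_square algebra_simps)
  also have "\<dots> = d\<^sup>2 * (- 6 * A * s\<^sub>1 * s\<^sub>2 - 9 * B * (s\<^sub>1 * y\<^sub>2 + s\<^sub>2 * y\<^sub>1) + 2 * A\<^sup>2 * y\<^sub>1 * y\<^sub>2)"
    unfolding a b c e unfolding d(1)[symmetric] by (simp add: power2_eq_square power3_eq_cube algebra_simps)
  finally have Q: "d\<^sup>2 * Q = - 6 * A * s\<^sub>1 * s\<^sub>2 - 9 * B * (s\<^sub>1 * y\<^sub>2 + s\<^sub>2 * y\<^sub>1) + 2 * A\<^sup>2 * y\<^sub>1 * y\<^sub>2" using d2 by (simp only: mult_cancel_left simp_thms)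
  have "d\<^sup>2 * (d\<^sup>2 * R) = (d\<^sup>2 * c)\<^sup>2 - 3 * (d\<^sup>2 * b) * (d\<^sup>2 * e)"
    by (simp add: R_def power2_eq_square algebra_simps)
  also have "\<dots> = d\<^sup>2 * (- 3 * A * s\<^sub>2\<^sup>2 - 9 * B * s\<^sub>2 * y\<^sub>2 + A\<^sup>2 * y\<^sub>2\<^sup>2)"
    unfolding c b e unfolding d(1)[symmetric] by (simp add: power2_eq_square power3_eq_cube algebra_simps)
  finally have R: "d\<^sup>2 * R = - 3 * A * s\<^sub>2\<^sup>2 - 9 * B * s\<^sub>2 * y\<^sub>2 + A\<^sup>2 * y\<^sub>2\<^sup>2" using d2 by (simp only: mult_cancel_left simp_thms)
  have "d\<^sup>2 * (P * y\<^sub>2\<^sup>2 + Q * y\<^sub>2 * (- y\<^sub>1) + R * (- y\<^sub>1)\<^sup>2) = (d\<^sup>2 * P) * y\<^sub>2\<^sup>2 - (d\<^sup>2 * Q) * y\<^sub>1 * y\<^sub>2 + (d\<^sup>2 * R) * y\<^sub>1\<^sup>2"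
    by (simp add: power2_eq_square algebra_simps)
  also have "\<dots> = d\<^sup>2 * (- 3 * A)"
    unfolding P Q R unfolding d(1)[symmetric] by (simp add: power2_eq_square algebra_simps)
  finally have "P * y\<^sub>2\<^sup>2 + Q * y\<^sub>2 * (- y\<^sub>1) + R * (- y\<^sub>1)\<^sup>2 = 3 * (- A)" using d2 by (simp only: mult_cancel_left simp_thms)
  thus "cubic_A (a, b, c, e, y\<^sub>2, - y\<^sub>1) = A"
    unfolding cubic_A_def prod.case P_def[symmetric] Q_def[symmetric] R_def[symmetric] by (simp only: nonzero_mult_div_cancel_left)
  \<comment> \<open>At (d, 0) the gradient of s^3 + Asy^2 + By^3 is (3d^2, 0), so the quotient form
    has the partial derivatives \<open>3 * s\<^sub>1\<close> and \<open>3 * s\<^sub>2\<close> at the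
    corresponding point.\<close>
  have "d\<^sup>2 * (3 * a * y\<^sub>2\<^sup>2 + 2 * b * y\<^sub>2 * (- y\<^sub>1) + c * (- y\<^sub>1)\<^sup>2) = 3 * (d\<^sup>2 * a) * y\<^sub>2\<^sup>2 - 2 * (d\<^sup>2 * b) * y\<^sub>1 * y\<^sub>2 + (d\<^sup>2 * c) * y\<^sub>1\<^sup>2"
    by (simp add: power2_eq_square algebra_simps)
  also have "\<dots> = d\<^sup>2 * (3 * s\<^sub>1)"
    unfolding a b c unfolding d(1)[symmetric] by (simp add: power2_eq_square power3_eq_cube algebra_simps)
  finally have Fx: "3 * a * y\<^sub>2\<^sup>2 + 2 * b * y\<^sub>2 * (- y\<^sub>1) + c * (- y\<^sub>1)\<^sup>2 = 3 * s\<^sub>1" using d2 by (simp only: mult_cancel_left simp_thms)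
  have "d\<^sup>2 * (b * y\<^sub>2\<^sup>2 + 2 * c * y\<^sub>2 * (- y\<^sub>1) + 3 * e * (- y\<^sub>1)\<^sup>2) = (d\<^sup>2 * b) * y\<^sub>2\<^sup>2 - 2 * (d\<^sup>2 * c) * y\<^sub>1 * y\<^sub>2 + 3 * (d\<^sup>2 * e) * y\<^sub>1\<^sup>2"
    by (simp add: power2_eq_square algebra_simps)
  also have "\<dots> = d\<^sup>2 * (3 * s\<^sub>2)"
    unfolding e b c unfolding d(1)[symmetric] by (simp add: power2_eq_square power3_eq_cube algebra_simps)
  finally have Fy: "b * y\<^sub>2\<^sup>2 + 2 * c * y\<^sub>2 * (- y\<^sub>1) + 3 * e * (- y\<^sub>1)\<^sup>2 = 3 * s\<^sub>2" using d2 by (simp only: mult_cancel_left simp_thms)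
  have "d\<^sup>2 * ((3 * s\<^sub>1) * (Q * y\<^sub>2 + 2 * R * (- y\<^sub>1)) - (3 * s\<^sub>2) * (2 * P * y\<^sub>2 + Q * (- y\<^sub>1)))
      = (3 * s\<^sub>1) * ((d\<^sup>2 * Q) * y\<^sub>2 - 2 * (d\<^sup>2 * R) * y\<^sub>1) - (3 * s\<^sub>2) * (2 * (d\<^sup>2 * P) * y\<^sub>2 - (d\<^sup>2 * Q) * y\<^sub>1)"
    by (simp add: algebra_simps)
  also have "\<dots> = d\<^sup>2 * (27 * (- B))"
    unfolding P Q R unfolding d(1)[symmetric] by (simp add: power2_eq_square algebra_simps)
  finally have "(3 * s\<^sub>1) * (Q * y\<^sub>2 + 2 * R * (- y\<^sub>1)) - (3 * s\<^sub>2) * (2 * P * y\<^sub>2 + Q * (- y\<^sub>1)) = 27 * (- B)"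
    using d2 by (simp only: mult_cancel_left simp_thms)
  thus "cubic_B (a, b, c, e, y\<^sub>2, - y\<^sub>1) = B"
    unfolding cubic_B_def prod.case P_def[symmetric] Q_def[symmetric] R_def[symmetric] Fx Fy by simp
qed

text \<open>Each factor y absorbs one factor R: the bound \<open>R\<^sup>2\<close> for A pays for
  two of them and \<open>R ^ 3\<close> for B pays for three.\<close>

lemma cubic_form_bound:
  fixes R n\<^sub>1 n\<^sub>2 n\<^sub>3 A B s\<^sub>1 s\<^sub>2 s\<^sub>3 y\<^sub>1 y\<^sub>2 y\<^sub>3 :: real
  assumes "\<bar>s\<^sub>1\<bar> \<le> n\<^sub>1" "R * \<bar>y\<^sub>1\<bar> \<le> n\<^sub>1" "\<bar>s\<^sub>2\<bar> \<le> n\<^sub>2" "R * \<bar>y\<^sub>2\<bar> \<le> n\<^sub>2" "\<bar>s\<^sub>3\<bar> \<le> n\<^sub>3" "R * \<bar>y\<^sub>3\<bar> \<le> n\<^sub>3"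
    and R: "R \<ge> 0" and A: "\<bar>A\<bar> \<le> R\<^sup>2" and B: "\<bar>B\<bar> \<le> R ^ 3"
  shows "\<bar>s\<^sub>1 * s\<^sub>2 * s\<^sub>3\<bar> \<le> n\<^sub>1 * n\<^sub>2 * n\<^sub>3" "\<bar>A * (s\<^sub>1 * y\<^sub>2 * y\<^sub>3)\<bar> \<le> n\<^sub>1 * n\<^sub>2 * n\<^sub>3" "\<bar>B * (y\<^sub>1 * y\<^sub>2 * y\<^sub>3)\<bar> \<le> n\<^sub>1 * n\<^sub>2 * n\<^sub>3"
proof -
  have n: "n\<^sub>1 \<ge> 0" "n\<^sub>2 \<ge> 0" "n\<^sub>3 \<ge> 0" using assms(1,3,5) by linarith+
  show "\<bar>s\<^sub>1 * s\<^sub>2 * s\<^sub>3\<bar> \<le> n\<^sub>1 * n\<^sub>2 * n\<^sub>3"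
    unfolding abs_mult by (intro mult_mono mult_nonneg_nonneg assms n abs_ge_zero)
  have "\<bar>A * (s\<^sub>1 * y\<^sub>2 * y\<^sub>3)\<bar> \<le> R\<^sup>2 * \<bar>s\<^sub>1 * y\<^sub>2 * y\<^sub>3\<bar>"
    unfolding abs_mult[of A] using A by (intro mult_right_mono) auto
  also have "\<dots> = \<bar>s\<^sub>1\<bar> * (R * \<bar>y\<^sub>2\<bar>) * (R * \<bar>y\<^sub>3\<bar>)" by (simp add: abs_mult power2_eq_square)
  also have "\<dots> \<le> n\<^sub>1 * n\<^sub>2 * n\<^sub>3" by (intro mult_mono mult_nonneg_nonneg assms n abs_ge_zero)
  finally show "\<bar>A * (s\<^sub>1 * y\<^sub>2 * y\<^sub>3)\<bar> \<le> n\<^sub>1 * n\<^sub>2 * n\<^sub>3" .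
  have "\<bar>B * (y\<^sub>1 * y\<^sub>2 * y\<^sub>3)\<bar> \<le> R ^ 3 * \<bar>y\<^sub>1 * y\<^sub>2 * y\<^sub>3\<bar>"
    unfolding abs_mult[of B] using B by (intro mult_right_mono) auto
  also have "\<dots> = (R * \<bar>y\<^sub>1\<bar>) * (R * \<bar>y\<^sub>2\<bar>) * (R * \<bar>y\<^sub>3\<bar>)" by (simp add: abs_mult power3_eq_cube)
  also have "\<dots> \<le> n\<^sub>1 * n\<^sub>2 * n\<^sub>3" by (intro mult_mono mult_nonneg_nonneg assms n abs_ge_zero)
  finally show "\<bar>B * (y\<^sub>1 * y\<^sub>2 * y\<^sub>3)\<bar> \<le> n\<^sub>1 * n\<^sub>2 * n\<^sub>3" .
qed

lemma square_divisor_le: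
  fixes A B d :: int and R :: real
  assumes A: "\<bar>real_of_int A\<bar> \<le> R\<^sup>2" and B: "\<bar>real_of_int B\<bar> \<le> R ^ 3" and R: "R \<ge> 0"
    and d: "d ^ 2 dvd Delta A B" and nz: "Delta A B \<noteq> 0"
  shows "real_of_int d \<le> 6 * R ^ 3"
proof -
  have "d ^ 2 \<le> \<bar>Delta A B\<bar>" using dvd_imp_le_int[OF nz d] by simp
  hence "real_of_int d ^ 2 \<le> \<bar>real_of_int (Delta A B)\<bar>"
    by (metis of_int_abs of_int_le_iff of_int_power)
  also have "\<dots> \<le> 4 * \<bar>real_of_int A\<bar> ^ 3 + 27 * \<bar>real_of_int B\<bar> ^ 2"
    unfolding Delta_def by (simp add: power_abs[symmetric] abs_triangle_ineq[THEN order_trans] abs_mult)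
  also have "\<dots> \<le> 4 * (R\<^sup>2) ^ 3 + 27 * (R ^ 3) ^ 2"
    using A B by (intro add_mono mult_left_mono power_mono) auto
  \<comment> \<open>The 6 comes from 4 + 27 \<le> 36.\<close>
  also have "\<dots> \<le> (6 * R ^ 3) ^ 2" using R by (simp add: power_mult_distrib power_mult[symmetric])
  finally show ?thesis by (rule power2_le_imp_le) (use R in simp)
qed

text \<open>The lattice is s \<equiv> ty (mod d) for the double root t, reduced with weight
  \<open>R\<^sup>2\<close>; \<open>n\<^sub>1\<close> and \<open>n\<^sub>2\<close> are the lengths of
  the basis vectors. Since \<open>d\<^sup>2\<close> divides all coefficients of the restricted form,
  the bounds for them gain the factor \<open>1 / d\<^sup>2\<close>.\<close>

lemma cubic_form_parametrization:
  fixes A B d :: int and R :: real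
  assumes R: "R \<ge> 1" and A: "\<bar>real_of_int A\<bar> \<le> R\<^sup>2" and B: "\<bar>real_of_int B\<bar> \<le> R ^ 3"
    and d: "R \<le> real_of_int d" and cop: "coprime (2 * A) d" and dvd: "d ^ 2 dvd Delta A B"
    and irr: "\<And>r. r ^ 3 + A * r + B \<noteq> 0"
  obtains a b c e y\<^sub>1 y\<^sub>2 :: int and n\<^sub>1 n\<^sub>2 :: real where
    "R \<le> n\<^sub>1" "n\<^sub>1 \<le> n\<^sub>2" "n\<^sub>1 * n\<^sub>2 \<le> 2 * real_of_int d * R"
    "a \<noteq> 0" "e \<noteq> 0"
    "\<bar>real_of_int a\<bar> * real_of_int d ^ 2 \<le> 3 * n\<^sub>1 ^ 3" "\<bar>real_of_int b\<bar> * real_of_int d ^ 2 \<le> 9 * n\<^sub>1\<^sup>2 * n\<^sub>2"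
    "\<bar>real_of_int c\<bar> * real_of_int d ^ 2 \<le> 9 * n\<^sub>1 * n\<^sub>2\<^sup>2" "\<bar>real_of_int e\<bar> * real_of_int d ^ 2 \<le> 3 * n\<^sub>2 ^ 3"
    "R * \<bar>real_of_int y\<^sub>1\<bar> \<le> n\<^sub>1" "R * \<bar>real_of_int y\<^sub>2\<bar> \<le> n\<^sub>2"
    "A = cubic_A (a, b, c, e, y\<^sub>2, y\<^sub>1)" "B = cubic_B (a, b, c, e, y\<^sub>2, y\<^sub>1)"
proof -
  from R d have dpos: "d > 0" by linarith
  obtain t where t: "d ^ 2 dvd 3 * t ^ 2 + A" "d ^ 2 dvd t ^ 3 + A * t + B"
    by (rule exists_double_root[OF cop dvd])
  have R2: "R\<^sup>2 \<ge> 1" using R by simp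
  obtain s\<^sub>1 y\<^sub>1 s\<^sub>2 y\<^sub>2 where L: "d dvd s\<^sub>1 - t * y\<^sub>1" "d dvd s\<^sub>2 - t * y\<^sub>2" and det: "s\<^sub>1 * y\<^sub>2 - s\<^sub>2 * y\<^sub>1 = d"
    and q12: "real_of_int s\<^sub>1 ^ 2 + R\<^sup>2 * real_of_int y\<^sub>1 ^ 2 \<le> real_of_int s\<^sub>2 ^ 2 + R\<^sup>2 * real_of_int y\<^sub>2 ^ 2"
    and qq: "(real_of_int s\<^sub>1 ^ 2 + R\<^sup>2 * real_of_int y\<^sub>1 ^ 2) * (real_of_int s\<^sub>2 ^ 2 + R\<^sup>2 * real_of_int y\<^sub>2 ^ 2) \<le> 4 * R\<^sup>2 * real_of_int d ^ 2"
    by (rule exists_reduced_basis[OF dpos R2, of t])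
  define n\<^sub>1 where "n\<^sub>1 = sqrt (real_of_int s\<^sub>1 ^ 2 + R\<^sup>2 * real_of_int y\<^sub>1 ^ 2)"
  define n\<^sub>2 where "n\<^sub>2 = sqrt (real_of_int s\<^sub>2 ^ 2 + R\<^sup>2 * real_of_int y\<^sub>2 ^ 2)"
  have le: "\<bar>s\<bar> \<le> sqrt (s ^ 2 + R\<^sup>2 * y ^ 2)" "R * \<bar>y\<bar> \<le> sqrt (s ^ 2 + R\<^sup>2 * y ^ 2)" for s y :: real
    using R by (auto intro!: real_le_rsqrt simp: power_mult_distrib)
  have s: "\<bar>real_of_int s\<^sub>1\<bar> \<le> n\<^sub>1" "R * \<bar>real_of_int y\<^sub>1\<bar> \<le> n\<^sub>1" "\<bar>real_of_int s\<^sub>2\<bar> \<le> n\<^sub>2" "R * \<bar>real_of_int y\<^sub>2\<bar> \<le> n\<^sub>2"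
    unfolding n\<^sub>1_def n\<^sub>2_def by (rule le)+
  have n12: "n\<^sub>1 \<le> n\<^sub>2" unfolding n\<^sub>1_def n\<^sub>2_def using q12 by simp
  have "n\<^sub>1 * n\<^sub>2 \<le> sqrt ((2 * real_of_int d * R) ^ 2)"
    unfolding n\<^sub>1_def n\<^sub>2_def real_sqrt_mult[symmetric] using qq by (simp add: power_mult_distrib mult_ac)
  hence nn: "n\<^sub>1 * n\<^sub>2 \<le> 2 * real_of_int d * R" using dpos R by simp
  \<comment> \<open>A lattice vector with y = 0 has s divisible by d \<ge> R; any other has length
    at least R through its second coordinate.\<close>
  have R1: "R \<le> n\<^sub>1"
  proof (cases "y\<^sub>1 = 0")
    case True
    hence "s\<^sub>1 \<noteq> 0" "d dvd s\<^sub>1" using det dpos L by auto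
    hence "d \<le> \<bar>s\<^sub>1\<bar>" using dvd_imp_le_int[of s\<^sub>1 d] dpos by simp
    with d s(1) show ?thesis by linarith
  next
    case False
    hence "R * 1 \<le> R * \<bar>real_of_int y\<^sub>1\<bar>" using R by (intro mult_left_mono) auto
    with s(2) show ?thesis by linarith
  qed
  obtain k\<^sub>1 k\<^sub>2 where k: "s\<^sub>1 = t * y\<^sub>1 + d * k\<^sub>1" "s\<^sub>2 = t * y\<^sub>2 + d * k\<^sub>2"
    using L by (auto simp: dvd_def algebra_simps)
  \<comment> \<open>With s = ty + dk, Taylor expansion at t gives y^3 f(t) + dk y^2 f'(t) + 3t d^2
    k^2 y + d^3 k^3 for f(x) = x^3 + Ax + B. The double root makes the first two terms divisible by
    \<open>d\<^sup>2\<close>. The explicit cofactors below are this expansion and its polarised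
    versions.\<close>
  obtain u v where u: "3 * t ^ 2 + A = d ^ 2 * u" and v: "t ^ 3 + A * t + B = d ^ 2 * v" using t by blast
  have A': "A = d ^ 2 * u - 3 * t ^ 2" using u by simp
  have B': "B = d ^ 2 * v - A * t - t ^ 3" using v by simp
  have "d\<^sup>2 dvd s\<^sub>1 ^ 3 + A * s\<^sub>1 * y\<^sub>1\<^sup>2 + B * y\<^sub>1 ^ 3"
  proof
    show "s\<^sub>1 ^ 3 + A * s\<^sub>1 * y\<^sub>1\<^sup>2 + B * y\<^sub>1 ^ 3 = d\<^sup>2 * (v * y\<^sub>1 ^ 3 + d * u * k\<^sub>1 * y\<^sub>1\<^sup>2 + 3 * t * k\<^sub>1\<^sup>2 * y\<^sub>1 + d * k\<^sub>1 ^ 3)"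
      unfolding B' A' k by (simp add: power2_eq_square power3_eq_cube algebra_simps)
  qed
  then obtain a where a: "d\<^sup>2 * a = s\<^sub>1 ^ 3 + A * s\<^sub>1 * y\<^sub>1\<^sup>2 + B * y\<^sub>1 ^ 3" by (metis dvdE)
  have "d\<^sup>2 dvd 3 * s\<^sub>1\<^sup>2 * s\<^sub>2 + A * (2 * s\<^sub>1 * y\<^sub>1 * y\<^sub>2 + s\<^sub>2 * y\<^sub>1\<^sup>2) + 3 * B * y\<^sub>1\<^sup>2 * y\<^sub>2"
  proof
    show "3 * s\<^sub>1\<^sup>2 * s\<^sub>2 + A * (2 * s\<^sub>1 * y\<^sub>1 * y\<^sub>2 + s\<^sub>2 * y\<^sub>1\<^sup>2) + 3 * B * y\<^sub>1\<^sup>2 * y\<^sub>2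
        = d\<^sup>2 * (3 * v * y\<^sub>1\<^sup>2 * y\<^sub>2 + d * u * (2 * k\<^sub>1 * y\<^sub>1 * y\<^sub>2 + k\<^sub>2 * y\<^sub>1\<^sup>2) + 3 * t * (2 * k\<^sub>1 * k\<^sub>2 * y\<^sub>1 + k\<^sub>1\<^sup>2 * y\<^sub>2) + 3 * d * k\<^sub>1\<^sup>2 * k\<^sub>2)"
      unfolding B' A' k by (simp add: power2_eq_square power3_eq_cube algebra_simps)
  qed
  then obtain b where b: "d\<^sup>2 * b = 3 * s\<^sub>1\<^sup>2 * s\<^sub>2 + A * (2 * s\<^sub>1 * y\<^sub>1 * y\<^sub>2 + s\<^sub>2 * y\<^sub>1\<^sup>2) + 3 * B * y\<^sub>1\<^sup>2 * y\<^sub>2" by (metis dvdE)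
  have "d\<^sup>2 dvd 3 * s\<^sub>1 * s\<^sub>2\<^sup>2 + A * (2 * s\<^sub>2 * y\<^sub>1 * y\<^sub>2 + s\<^sub>1 * y\<^sub>2\<^sup>2) + 3 * B * y\<^sub>1 * y\<^sub>2\<^sup>2"
  proof
    show "3 * s\<^sub>1 * s\<^sub>2\<^sup>2 + A * (2 * s\<^sub>2 * y\<^sub>1 * y\<^sub>2 + s\<^sub>1 * y\<^sub>2\<^sup>2) + 3 * B * y\<^sub>1 * y\<^sub>2\<^sup>2
        = d\<^sup>2 * (3 * v * y\<^sub>2\<^sup>2 * y\<^sub>1 + d * u * (2 * k\<^sub>2 * y\<^sub>1 * y\<^sub>2 + k\<^sub>1 * y\<^sub>2\<^sup>2) + 3 * t * (2 * k\<^sub>1 * k\<^sub>2 * y\<^sub>2 + k\<^sub>2\<^sup>2 * y\<^sub>1) + 3 * d * k\<^sub>2\<^sup>2 * k\<^sub>1)"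
      unfolding B' A' k by (simp add: power2_eq_square power3_eq_cube algebra_simps)
  qed
  then obtain c where c: "d\<^sup>2 * c = 3 * s\<^sub>1 * s\<^sub>2\<^sup>2 + A * (2 * s\<^sub>2 * y\<^sub>1 * y\<^sub>2 + s\<^sub>1 * y\<^sub>2\<^sup>2) + 3 * B * y\<^sub>1 * y\<^sub>2\<^sup>2" by (metis dvdE)
  have "d\<^sup>2 dvd s\<^sub>2 ^ 3 + A * s\<^sub>2 * y\<^sub>2\<^sup>2 + B * y\<^sub>2 ^ 3"
  proof
    show "s\<^sub>2 ^ 3 + A * s\<^sub>2 * y\<^sub>2\<^sup>2 + B * y\<^sub>2 ^ 3 = d\<^sup>2 * (v * y\<^sub>2 ^ 3 + d * u * k\<^sub>2 * y\<^sub>2\<^sup>2 + 3 * t * k\<^sub>2\<^sup>2 * y\<^sub>2 + d * k\<^sub>2 ^ 3)"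
      unfolding B' A' k by (simp add: power2_eq_square power3_eq_cube algebra_simps)
  qed
  then obtain e where e: "d\<^sup>2 * e = s\<^sub>2 ^ 3 + A * s\<^sub>2 * y\<^sub>2\<^sup>2 + B * y\<^sub>2 ^ 3" by (metis dvdE)
  have nonzero: "x ^ 3 + A * x * y\<^sup>2 + B * y ^ 3 \<noteq> 0" if "x \<noteq> 0 \<or> y \<noteq> 0" for x y
    using rational_root_imp_integer_root[of y x A B] irr that by (cases "y = 0") auto
  have "s\<^sub>1 \<noteq> 0 \<or> y\<^sub>1 \<noteq> 0" "s\<^sub>2 \<noteq> 0 \<or> y\<^sub>2 \<noteq> 0" using det dpos by auto
  from this[THEN nonzero] have "a \<noteq> 0" "e \<noteq> 0" using a e by auto
  note bd = cubic_form_bound[where A = "real_of_int A" and B = "real_of_int B" and R = R]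
  have R0: "R \<ge> 0" using R by simp
  note bd111 = bd[OF s(1,2) s(1,2) s(1,2) R0 A B] and bd222 = bd[OF s(3,4) s(3,4) s(3,4) R0 A B]
    and bd112 = bd[OF s(1,2) s(1,2) s(3,4) R0 A B] and bd211 = bd[OF s(3,4) s(1,2) s(1,2) R0 A B]
    and bd122 = bd[OF s(1,2) s(3,4) s(3,4) R0 A B] and bd212 = bd[OF s(3,4) s(1,2) s(3,4) R0 A B]
  have tri: "\<bar>x + y + z\<bar> \<le> \<bar>x\<bar> + \<bar>y\<bar> + \<bar>z\<bar>" for x y z :: real by linarith
  have "\<bar>real_of_int a\<bar> * real_of_int d ^ 2 = \<bar>real_of_int (d\<^sup>2 * a)\<bar>" by (simp add: abs_mult)
  also have "\<dots> = \<bar>real_of_int s\<^sub>1 * s\<^sub>1 * s\<^sub>1 + A * (real_of_int s\<^sub>1 * y\<^sub>1 * y\<^sub>1) + B * (real_of_int y\<^sub>1 * y\<^sub>1 * y\<^sub>1)\<bar>"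
    unfolding a by (simp add: power2_eq_square power3_eq_cube mult_ac)
  also have "\<dots> \<le> 3 * (n\<^sub>1 * n\<^sub>1 * n\<^sub>1)" by (rule order_trans[OF tri]) (use bd111 in linarith)
  finally have ba: "\<bar>real_of_int a\<bar> * real_of_int d ^ 2 \<le> 3 * n\<^sub>1 ^ 3" by (simp add: power3_eq_cube mult_ac)
  have "\<bar>real_of_int e\<bar> * real_of_int d ^ 2 = \<bar>real_of_int (d\<^sup>2 * e)\<bar>" by (simp add: abs_mult)
  also have "\<dots> = \<bar>real_of_int s\<^sub>2 * s\<^sub>2 * s\<^sub>2 + A * (real_of_int s\<^sub>2 * y\<^sub>2 * y\<^sub>2) + B * (real_of_int y\<^sub>2 * y\<^sub>2 * y\<^sub>2)\<bar>"
    unfolding e by (simp add: power2_eq_square power3_eq_cube mult_ac)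
  also have "\<dots> \<le> 3 * (n\<^sub>2 * n\<^sub>2 * n\<^sub>2)" by (rule order_trans[OF tri]) (use bd222 in linarith)
  finally have be: "\<bar>real_of_int e\<bar> * real_of_int d ^ 2 \<le> 3 * n\<^sub>2 ^ 3" by (simp add: power3_eq_cube mult_ac)
  \<comment> \<open>The multiplicities 3 + 2 + 1 + 3 account for the constant 9 in the bounds for b
    and c, against 3 for a and e.\<close>
  have tri': "\<bar>3 * x + (2 * y + y') + 3 * z\<bar> \<le> 3 * \<bar>x\<bar> + 2 * \<bar>y\<bar> + \<bar>y'\<bar> + 3 * \<bar>z\<bar>" for x y y' z :: real by linarith
  have "\<bar>real_of_int b\<bar> * real_of_int d ^ 2 = \<bar>real_of_int (d\<^sup>2 * b)\<bar>" by (simp add: abs_mult)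
  also have "\<dots> = \<bar>3 * (real_of_int s\<^sub>1 * s\<^sub>1 * s\<^sub>2) + (2 * (A * (real_of_int s\<^sub>1 * y\<^sub>1 * y\<^sub>2)) + A * (real_of_int s\<^sub>2 * y\<^sub>1 * y\<^sub>1)) + 3 * (B * (real_of_int y\<^sub>1 * y\<^sub>1 * y\<^sub>2))\<bar>"
    unfolding b by (simp add: power2_eq_square algebra_simps)
  also have "\<dots> \<le> 3 * (n\<^sub>1 * n\<^sub>1 * n\<^sub>2) + 2 * (n\<^sub>1 * n\<^sub>1 * n\<^sub>2) + n\<^sub>2 * n\<^sub>1 * n\<^sub>1 + 3 * (n\<^sub>1 * n\<^sub>1 * n\<^sub>2)"
    by (rule order_trans[OF tri']) (intro add_mono mult_left_mono bd112 bd211; simp)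
  finally have bb: "\<bar>real_of_int b\<bar> * real_of_int d ^ 2 \<le> 9 * n\<^sub>1\<^sup>2 * n\<^sub>2" by (simp add: power2_eq_square mult_ac)
  have "\<bar>real_of_int c\<bar> * real_of_int d ^ 2 = \<bar>real_of_int (d\<^sup>2 * c)\<bar>" by (simp add: abs_mult)
  also have "\<dots> = \<bar>3 * (real_of_int s\<^sub>1 * s\<^sub>2 * s\<^sub>2) + (2 * (A * (real_of_int s\<^sub>2 * y\<^sub>1 * y\<^sub>2)) + A * (real_of_int s\<^sub>1 * y\<^sub>2 * y\<^sub>2)) + 3 * (B * (real_of_int y\<^sub>1 * y\<^sub>2 * y\<^sub>2))\<bar>"
    unfolding c by (simp add: power2_eq_square algebra_simps)
  also have "\<dots> \<le> 3 * (n\<^sub>1 * n\<^sub>2 * n\<^sub>2) + 2 * (n\<^sub>2 * n\<^sub>1 * n\<^sub>2) + n\<^sub>1 * n\<^sub>2 * n\<^sub>2 + 3 * (n\<^sub>1 * n\<^sub>2 * n\<^sub>2)"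
    by (rule order_trans[OF tri']) (intro add_mono mult_left_mono bd122 bd212; simp)
  finally have bc: "\<bar>real_of_int c\<bar> * real_of_int d ^ 2 \<le> 9 * n\<^sub>1 * n\<^sub>2\<^sup>2" by (simp add: power2_eq_square mult_ac)
  \<comment> \<open>The coordinates of (d, 0) are \<open>(y\<^sub>2, - y\<^sub>1)\<close>, so the
    conclusion is applied with the negated second coordinate of the first vector in place of
    \<open>y\<^sub>1\<close>.\<close>
  have AB: "A = cubic_A (a, b, c, e, y\<^sub>2, - y\<^sub>1)" "B = cubic_B (a, b, c, e, y\<^sub>2, - y\<^sub>1)"
    using cubic_covariants[OF det _ a b c e] dpos by auto
  have y: "R * \<bar>real_of_int (- y\<^sub>1)\<bar> \<le> n\<^sub>1" using s(2) by simp
  from \<open>a \<noteq> 0\<close> \<open>e \<noteq> 0\<close> show ?thesis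
    using that[OF R1 n12 nn _ _ ba bb bc be y s(4) AB] by blast
qed

section \<open>Counting cubic forms in dyadic ranges\<close>

text \<open>Leaving out 0 removes the summand 1, so the second bound remains proportional to Z even
  for Z < 1. It is meant for the two extreme coefficients.\<close>

lemma card_int_box_le:
  assumes "Z \<ge> 0"
  shows "real (card {x::int. \<bar>real_of_int x\<bar> \<le> Z}) \<le> 2 * Z + 1"
    and "real (card {x::int. x \<noteq> 0 \<and> \<bar>real_of_int x\<bar> \<le> Z}) \<le> 2 * Z"
proof -
  have 0: "{x::int. \<bar>real_of_int x\<bar> \<le> Z} = {-\<lfloor>Z\<rfloor>..\<lfloor>Z\<rfloor>}"
    by (auto simp: le_floor_iff minus_le_iff abs_le_iff)
  have f: "\<lfloor>Z\<rfloor> \<ge> 0" using assms by simp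
  have c: "card {x::int. \<bar>real_of_int x\<bar> \<le> Z} = nat (2 * \<lfloor>Z\<rfloor> + 1)"
    unfolding 0 by simp
  with f show "real (card {x::int. \<bar>real_of_int x\<bar> \<le> Z}) \<le> 2 * Z + 1"
    by simp
  have "{x::int. x \<noteq> 0 \<and> \<bar>real_of_int x\<bar> \<le> Z} = {x::int. \<bar>real_of_int x\<bar> \<le> Z} - {0}" by auto
  hence "card {x::int. x \<noteq> 0 \<and> \<bar>real_of_int x\<bar> \<le> Z} = card {x::int. \<bar>real_of_int x\<bar> \<le> Z} - 1"
    using assms by (simp add: card_Diff_singleton)
  moreover have "nat (2 * \<lfloor>Z\<rfloor> + 1) - 1 = nat (2 * \<lfloor>Z\<rfloor>)" by simp
  ultimately show "real (card {x::int. x \<noteq> 0 \<and> \<bar>real_of_int x\<bar> \<le> Z}) \<le> 2 * Z"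
    using c f by simp
qed

text \<open>
  (a, b, c, e) is the cubic form F / d^2 in a reduced lattice basis with vectors of lengths
  n1 and n2 (after scaling y by R), and (y2, y1) are the coordinates of (d, 0) in this basis.
\<close>

definition cubic_rep :: "real \<Rightarrow> int \<Rightarrow> int \<Rightarrow> real \<Rightarrow> real \<Rightarrow> bool" where
  "cubic_rep R A B d n\<^sub>1 \<longleftrightarrow> (\<exists>(a::int) (b::int) (c::int) (e::int) (y\<^sub>1::int) (y\<^sub>2::int) (n\<^sub>2::real).
     R \<le> n\<^sub>1 \<and> n\<^sub>1 \<le> n\<^sub>2 \<and> n\<^sub>1 * n\<^sub>2 \<le> 2 * d * R \<and> a \<noteq> 0 \<and> e \<noteq> 0 \<and>
     \<bar>real_of_int a\<bar> * d ^ 2 \<le> 3 * n\<^sub>1 ^ 3 \<and> \<bar>real_of_int b\<bar> * d ^ 2 \<le> 9 * n\<^sub>1\<^sup>2 * n\<^sub>2 \<and>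
     \<bar>real_of_int c\<bar> * d ^ 2 \<le> 9 * n\<^sub>1 * n\<^sub>2\<^sup>2 \<and> \<bar>real_of_int e\<bar> * d ^ 2 \<le> 3 * n\<^sub>2 ^ 3 \<and>
     R * \<bar>real_of_int y\<^sub>1\<bar> \<le> n\<^sub>1 \<and> R * \<bar>real_of_int y\<^sub>2\<bar> \<le> n\<^sub>2 \<and>
     A = cubic_A (a, b, c, e, y\<^sub>2, y\<^sub>1) \<and> B = cubic_B (a, b, c, e, y\<^sub>2, y\<^sub>1))"

text \<open>The last four inequalities say that the ranges of b, c, \<open>y\<^sub>1\<close> and
  \<open>y\<^sub>2\<close> have length at least 1, so that counting them loses only a constant. The
  one for b depends on a being nonzero: this gives D^2 \<le> 24 N^3, and multiplying by D \<le> 6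
  R^3 yields D^3 \<le> 144 (NR)^3.\<close>

lemma cubic_rep_bounds:
  fixes a b c e y\<^sub>1 y\<^sub>2 d n\<^sub>1 n\<^sub>2 R D N :: real
  assumes R: "R \<ge> 1" and D: "0 < D" "D \<le> d" "d < 2 * D" and N: "0 < N" "N \<le> n\<^sub>1" "n\<^sub>1 < 2 * N" and dR: "d \<le> 6 * R ^ 3"
    and n: "R \<le> n\<^sub>1" "n\<^sub>1 \<le> n\<^sub>2" "n\<^sub>1 * n\<^sub>2 \<le> 2 * d * R"
    and a1: "1 \<le> \<bar>a\<bar>" and a: "\<bar>a\<bar> * d ^ 2 \<le> 3 * n\<^sub>1 ^ 3" and b: "\<bar>b\<bar> * d ^ 2 \<le> 9 * n\<^sub>1\<^sup>2 * n\<^sub>2"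
    and c: "\<bar>c\<bar> * d ^ 2 \<le> 9 * n\<^sub>1 * n\<^sub>2\<^sup>2" and e: "\<bar>e\<bar> * d ^ 2 \<le> 3 * n\<^sub>2 ^ 3"
    and y: "R * \<bar>y\<^sub>1\<bar> \<le> n\<^sub>1" "R * \<bar>y\<^sub>2\<bar> \<le> n\<^sub>2"
  shows "\<bar>a\<bar> \<le> 24 * N ^ 3 / D ^ 2" "\<bar>b\<bar> \<le> 36 * N * R / D" "\<bar>c\<bar> \<le> 36 * R ^ 2 / N" "\<bar>e\<bar> \<le> 48 * D * R ^ 3 / N ^ 3"
    "\<bar>y\<^sub>1\<bar> \<le> 2 * N / R" "\<bar>y\<^sub>2\<bar> \<le> 4 * D / N"
    "1 \<le> 36 * N * R / D" "1 \<le> 36 * R ^ 2 / N" "1 \<le> 2 * N / R" "1 \<le> 4 * D / N"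
proof -
  have pos: "d > 0" "n\<^sub>1 > 0" "n\<^sub>2 > 0" "R > 0" using assms by linarith+
  have "\<bar>a\<bar> * D ^ 2 \<le> \<bar>a\<bar> * d ^ 2" using D by (intro mult_left_mono power_mono) auto
  also have "\<dots> \<le> 3 * n\<^sub>1 ^ 3" by (rule a)
  also have "\<dots> \<le> 3 * (2 * N) ^ 3" using N pos by (intro mult_left_mono power_mono) auto
  finally show aa: "\<bar>a\<bar> \<le> 24 * N ^ 3 / D ^ 2" using D by (simp add: field_simps)
  have "N * n\<^sub>2 \<le> n\<^sub>1 * n\<^sub>2" using N pos by (intro mult_right_mono) auto
  also have "\<dots> \<le> 2 * d * R" by (rule n)
  also have "\<dots> \<le> 2 * (2 * D) * R" using D pos by (intro mult_mono) auto
  finally have Nn2: "N * n\<^sub>2 \<le> 4 * D * R" by simp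
  have "d * (\<bar>b\<bar> * d) \<le> 9 * n\<^sub>1 * (n\<^sub>1 * n\<^sub>2)" using b by (simp add: power2_eq_square mult_ac)
  also have "\<dots> \<le> 9 * n\<^sub>1 * (2 * d * R)" using n pos by (intro mult_left_mono) auto
  also have "\<dots> = d * (18 * n\<^sub>1 * R)" by simp
  finally have "\<bar>b\<bar> * d \<le> 18 * n\<^sub>1 * R" using pos by simp
  moreover have "\<bar>b\<bar> * D \<le> \<bar>b\<bar> * d" using D by (intro mult_left_mono) auto
  moreover have "18 * n\<^sub>1 * R \<le> 18 * (2 * N) * R" using N pos by (intro mult_mono) auto
  ultimately show "\<bar>b\<bar> \<le> 36 * N * R / D" using D by (simp add: field_simps)
  have "d * (\<bar>c\<bar> * d) \<le> 9 * n\<^sub>2 * (n\<^sub>1 * n\<^sub>2)" using c by (simp add: power2_eq_square mult_ac)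
  also have "\<dots> \<le> 9 * n\<^sub>2 * (2 * d * R)" using n pos by (intro mult_left_mono) auto
  also have "\<dots> = d * (18 * n\<^sub>2 * R)" by simp
  finally have "\<bar>c\<bar> * d \<le> 18 * n\<^sub>2 * R" using pos by simp
  hence "n\<^sub>1 * (\<bar>c\<bar> * d) \<le> n\<^sub>1 * (18 * n\<^sub>2 * R)" using pos by (intro mult_left_mono) auto
  also have "\<dots> = 18 * R * (n\<^sub>1 * n\<^sub>2)" by simp
  also have "\<dots> \<le> 18 * R * (2 * d * R)" using n pos by (intro mult_left_mono) auto
  also have "\<dots> = d * (36 * R ^ 2)" by (simp add: power2_eq_square)
  finally have "d * (n\<^sub>1 * \<bar>c\<bar>) \<le> d * (36 * R ^ 2)" by (simp add: mult_ac)
  hence "n\<^sub>1 * \<bar>c\<bar> \<le> 36 * R ^ 2" using pos by simp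
  moreover have "N * \<bar>c\<bar> \<le> n\<^sub>1 * \<bar>c\<bar>" using N by (intro mult_right_mono) auto
  ultimately show "\<bar>c\<bar> \<le> 36 * R ^ 2 / N" using N by (simp add: field_simps)
  have "(\<bar>e\<bar> * d ^ 2) * n\<^sub>1 ^ 3 \<le> (3 * n\<^sub>2 ^ 3) * n\<^sub>1 ^ 3" using e pos by (intro mult_right_mono) auto
  also have "\<dots> = 3 * (n\<^sub>1 * n\<^sub>2) ^ 3" by (simp add: power_mult_distrib)
  also have "\<dots> \<le> 3 * (2 * d * R) ^ 3" using n pos by (intro mult_left_mono power_mono) auto
  also have "\<dots> = d ^ 2 * (24 * d * R ^ 3)" by (simp add: power_mult_distrib power2_eq_square power3_eq_cube)
  finally have "d ^ 2 * (\<bar>e\<bar> * n\<^sub>1 ^ 3) \<le> d ^ 2 * (24 * d * R ^ 3)" by (simp add: mult_ac)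
  hence "\<bar>e\<bar> * n\<^sub>1 ^ 3 \<le> 24 * d * R ^ 3" using pos by simp
  moreover have "\<bar>e\<bar> * N ^ 3 \<le> \<bar>e\<bar> * n\<^sub>1 ^ 3" using N by (intro mult_left_mono power_mono) auto
  moreover have "24 * d * R ^ 3 \<le> 24 * (2 * D) * R ^ 3" using D pos by (intro mult_mono) auto
  ultimately show "\<bar>e\<bar> \<le> 48 * D * R ^ 3 / N ^ 3" using N by (simp add: field_simps)
  show "\<bar>y\<^sub>1\<bar> \<le> 2 * N / R" using y(1) N pos by (simp add: field_simps)
  have "N * (R * \<bar>y\<^sub>2\<bar>) \<le> N * n\<^sub>2" using y(2) N by (intro mult_left_mono) auto
  also note Nn2
  finally have "R * (N * \<bar>y\<^sub>2\<bar>) \<le> R * (4 * D)" by (simp add: mult_ac)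
  hence "N * \<bar>y\<^sub>2\<bar> \<le> 4 * D" using pos by simp
  thus "\<bar>y\<^sub>2\<bar> \<le> 4 * D / N" using N by (simp add: field_simps)
  have "1 \<le> 24 * N ^ 3 / D ^ 2" using a1 aa by linarith
  hence D2: "D ^ 2 \<le> 24 * N ^ 3" using D by (simp add: field_simps)
  have "D ^ 3 = D * D ^ 2" by (simp add: power2_eq_square power3_eq_cube)
  also have "\<dots> \<le> (6 * R ^ 3) * (24 * N ^ 3)" using D2 D dR pos by (intro mult_mono) auto
  also have "\<dots> \<le> (36 * N * R) ^ 3" using N pos by (simp add: power_mult_distrib)
  finally have "D \<le> 36 * N * R" by (subst (asm) power_mono_iff) (use N D pos in auto)
  thus "1 \<le> 36 * N * R / D" using D by (simp add: field_simps)
  have "N ^ 2 \<le> n\<^sub>1 * n\<^sub>2" unfolding power2_eq_square using N n pos by (intro mult_mono) auto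
  also have "\<dots> \<le> 2 * d * R" by (rule n)
  also have "\<dots> \<le> 2 * (6 * R ^ 3) * R" using dR pos by (intro mult_mono) auto
  also have "\<dots> \<le> (36 * R ^ 2) ^ 2" using pos by (simp add: power_mult_distrib power2_eq_square power3_eq_cube)
  finally have "N \<le> 36 * R ^ 2" by (rule power2_le_imp_le) simp
  thus "1 \<le> 36 * R ^ 2 / N" using N by (simp add: field_simps)
  show "1 \<le> 2 * N / R" using n N pos by (simp add: field_simps)
  have "N * R \<le> N * n\<^sub>2" using N n by (intro mult_left_mono) auto
  also note Nn2
  finally have "N \<le> 4 * D" using pos by simp
  thus "1 \<le> 4 * D / N" using N by (simp add: field_simps)
qed

text \<open>The pair is a function of six integers, and in the product of their ranges all powers of
  N cancel, leaving R^5/D. The constant is 48 * 108 * 108 * 96 * 12 * 6, in the order of the factors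
  of \<open>Q\<close>.\<close>

lemma card_dyadic_cubic_rep:
  fixes R D N :: real
  assumes R: "R \<ge> 1" and D: "D > 0" and N: "N > 0"
  defines "T \<equiv> {(A, B). \<exists>d n\<^sub>1. D \<le> d \<and> d < 2 * D \<and> N \<le> n\<^sub>1 \<and> n\<^sub>1 < 2 * N \<and> d \<le> 6 * R ^ 3 \<and> cubic_rep R A B d n\<^sub>1}"
  shows "finite T" and "real (card T) \<le> 3869835264 * R ^ 5 / D"
proof -
  define I where "I Z = {x::int. \<bar>real_of_int x\<bar> \<le> Z}" for Z
  define J where "J Z = {x::int. x \<noteq> 0 \<and> \<bar>real_of_int x\<bar> \<le> Z}" for Z
  define Q where "Q = J (24 * N ^ 3 / D ^ 2) \<times> I (36 * N * R / D) \<times> I (36 * R ^ 2 / N) \<times> J (48 * D * R ^ 3 / N ^ 3)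
      \<times> I (4 * D / N) \<times> I (2 * N / R)"
  have finI: "finite (I Z)" for Z by (simp add: I_def)
  have finJ: "finite (J Z)" for Z by (rule finite_subset[OF _ finI[of Z]]) (auto simp: I_def J_def)
  have finQ: "finite Q" unfolding Q_def by (intro finite_cartesian_product finI finJ)
  have main: "(A, B) \<in> (\<lambda>z. (cubic_A z, cubic_B z)) ` Q \<and> 1 \<le> 36 * N * R / D \<and> 1 \<le> 36 * R ^ 2 / N \<and> 1 \<le> 2 * N / R \<and> 1 \<le> 4 * D / N"
    if "(A, B) \<in> T" for A B
  proof -
    from that obtain d n\<^sub>1 where d: "D \<le> d" "d < 2 * D" and n1: "N \<le> n\<^sub>1" "n\<^sub>1 < 2 * N" and dR: "d \<le> 6 * R ^ 3"
      and rep: "cubic_rep R A B d n\<^sub>1" unfolding T_def by blast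
    from rep obtain a b c e y\<^sub>1 y\<^sub>2 :: int and n\<^sub>2 :: real where
      h: "R \<le> n\<^sub>1" "n\<^sub>1 \<le> n\<^sub>2" "n\<^sub>1 * n\<^sub>2 \<le> 2 * d * R" and ae: "a \<noteq> 0" "e \<noteq> 0" and
      h2: "\<bar>real_of_int a\<bar> * d ^ 2 \<le> 3 * n\<^sub>1 ^ 3" "\<bar>real_of_int b\<bar> * d ^ 2 \<le> 9 * n\<^sub>1\<^sup>2 * n\<^sub>2"
        "\<bar>real_of_int c\<bar> * d ^ 2 \<le> 9 * n\<^sub>1 * n\<^sub>2\<^sup>2" "\<bar>real_of_int e\<bar> * d ^ 2 \<le> 3 * n\<^sub>2 ^ 3"
        "R * \<bar>real_of_int y\<^sub>1\<bar> \<le> n\<^sub>1" "R * \<bar>real_of_int y\<^sub>2\<bar> \<le> n\<^sub>2"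
      and AB: "A = cubic_A (a, b, c, e, y\<^sub>2, y\<^sub>1)" "B = cubic_B (a, b, c, e, y\<^sub>2, y\<^sub>1)"
      unfolding cubic_rep_def by blast
    have a1: "1 \<le> \<bar>real_of_int a\<bar>" using ae by linarith
    note bounds = cubic_rep_bounds[OF R D d N n1 dR h a1 h2]
    have "(a, b, c, e, y\<^sub>2, y\<^sub>1) \<in> Q" unfolding Q_def I_def J_def using bounds(1-6) ae by simp
    with AB bounds(7-10) show ?thesis by blast
  qed
  have sub: "T \<subseteq> (\<lambda>z. (cubic_A z, cubic_B z)) ` Q"
    using main by auto
  thus "finite T" by (rule finite_subset) (use finQ in simp)
  show "real (card T) \<le> 3869835264 * R ^ 5 / D"
  \<comment> \<open>The lower bounds 1 for the ranges come from a member of \<open>T\<close>, so the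
    empty case stands apart.\<close>
  proof (cases "T = {}")
    case True thus ?thesis using R D by simp
  next
    case False
    then obtain A B where "(A, B) \<in> T" by fastforce
    from main[OF this] have ge1: "1 \<le> 36 * N * R / D" "1 \<le> 36 * R ^ 2 / N" "1 \<le> 2 * N / R" "1 \<le> 4 * D / N" by blast+
    have cI: "real (card (I Z)) \<le> 3 * Z" if "1 \<le> Z" for Z
      using card_int_box_le(1)[of Z] that unfolding I_def by linarith
    have cJ: "real (card (J Z)) \<le> 2 * Z" if "0 \<le> Z" for Z
      using card_int_box_le(2)[of Z] that unfolding J_def by simp
    have "card T \<le> card ((\<lambda>z. (cubic_A z, cubic_B z)) ` Q)" using sub finQ by (intro card_mono) auto
    also have "\<dots> \<le> card Q" by (rule card_image_le[OF finQ])
    finally have "real (card T) \<le> real (card Q)" by simp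
    also have "\<dots> = real (card (J (24 * N ^ 3 / D ^ 2))) * (real (card (I (36 * N * R / D))) * (real (card (I (36 * R ^ 2 / N)))
        * (real (card (J (48 * D * R ^ 3 / N ^ 3))) * (real (card (I (4 * D / N))) * real (card (I (2 * N / R)))))))"
      by (simp add: Q_def card_cartesian_product)
    also have "\<dots> \<le> (2 * (24 * N ^ 3 / D ^ 2)) * ((3 * (36 * N * R / D)) * ((3 * (36 * R ^ 2 / N))
        * ((2 * (48 * D * R ^ 3 / N ^ 3)) * ((3 * (4 * D / N)) * (3 * (2 * N / R))))))"
      using R D N ge1 by (intro mult_mono cI cJ mult_nonneg_nonneg of_nat_0_le_iff) auto
    also have "\<dots> = 3869835264 * R ^ 5 / D" using R D N
      by (simp add: field_simps power2_eq_square power3_eq_cube eval_nat_numeral)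
    finally show ?thesis .
  qed
qed

lemma exists_dyadic:
  fixes x M :: real
  assumes "1 \<le> x" "x \<le> M"
  obtains i where "i \<le> nat \<lfloor>log 2 M\<rfloor>" "2 ^ i \<le> x" "x < 2 * 2 ^ i"
proof -
  define i where "i = nat \<lfloor>log 2 x\<rfloor>"
  have l0: "log 2 x \<ge> 0" using assms by simp
  have "log 2 x \<le> log 2 M" using assms by simp
  hence "i \<le> nat \<lfloor>log 2 M\<rfloor>" unfolding i_def by (intro nat_mono floor_mono)
  moreover have i: "real i \<le> log 2 x" "log 2 x < real i + 1" using l0 unfolding i_def by linarith+
  have "2 powr real i \<le> x" using i(1) assms by (simp add: le_log_iff)
  hence "2 ^ i \<le> x" by (simp add: powr_realpow)
  moreover have "x < 2 powr (real i + 1)" using i(2) assms by (simp add: log_less_iff)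
  hence "x < 2 * 2 ^ i" by (simp add: powr_add powr_realpow mult.commute)
  ultimately show ?thesis using that by blast
qed

text \<open>Both d and the shorter length \<open>n\<^sub>1\<close> lie between 1 and
  \<open>6 * R ^ 3\<close>, so each runs through at most L + 1 dyadic ranges, and d > T excludes the
  lower ranges of d.\<close>

lemma card_large_square_divisor:
  fixes R T :: real
  assumes R: "R \<ge> 1" and T: "T \<ge> R"
  defines "S \<equiv> {(A, B). \<bar>real_of_int A\<bar> \<le> R\<^sup>2 \<and> \<bar>real_of_int B\<bar> \<le> R ^ 3 \<and> (\<forall>r. r ^ 3 + A * r + B \<noteq> 0) \<and> Delta A B \<noteq> 0 \<and>
      (\<exists>d::int. T < real_of_int d \<and> coprime (2 * A) d \<and> d ^ 2 dvd Delta A B)}"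
  shows "finite S" and "real (card S) \<le> 7739670528 * (1 + log 2 (6 * R ^ 3)) ^ 2 * R ^ 5 / T"
proof -
  define L where "L = nat \<lfloor>log 2 (6 * R ^ 3)\<rfloor>"
  define W where "W D N = {(A, B). \<exists>d n\<^sub>1. D \<le> d \<and> d < 2 * D \<and> N \<le> n\<^sub>1 \<and> n\<^sub>1 < 2 * N \<and> d \<le> 6 * R ^ 3 \<and> cubic_rep R A B d n\<^sub>1}" for D N
  define E where "E = {i \<in> {..L}. T < 2 * 2 ^ i}"
  define K :: real where "K = 3869835264"
  have W: "finite (W D N)" "real (card (W D N)) \<le> K * R ^ 5 / D" if "D > 0" "N > 0" for D N
    using card_dyadic_cubic_rep[OF R that] unfolding W_def K_def by simp_all
  have sub: "S \<subseteq> (\<Union>i\<in>E. \<Union>j\<in>{..L}. W (2 ^ i) (2 ^ j))"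
  proof clarify
    fix A B assume "(A, B) \<in> S"
    then obtain d :: int where AB: "\<bar>real_of_int A\<bar> \<le> R\<^sup>2" "\<bar>real_of_int B\<bar> \<le> R ^ 3" and irr: "\<And>r. r ^ 3 + A * r + B \<noteq> 0"
      and nz: "Delta A B \<noteq> 0" and d: "T < real_of_int d" "coprime (2 * A) d" "d ^ 2 dvd Delta A B"
      unfolding S_def by blast
    have Rd: "R \<le> real_of_int d" using d T by linarith
    have dR: "real_of_int d \<le> 6 * R ^ 3" using square_divisor_le[OF AB _ d(3) nz] R by simp
    obtain n\<^sub>1 n\<^sub>2 where n: "R \<le> n\<^sub>1" "n\<^sub>1 \<le> n\<^sub>2" "n\<^sub>1 * n\<^sub>2 \<le> 2 * real_of_int d * R" and rep: "cubic_rep R A B (real_of_int d) n\<^sub>1"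
    proof (rule cubic_form_parametrization[OF R AB Rd d(2,3) irr])
      fix a b c e y\<^sub>1 y\<^sub>2 :: int and n\<^sub>1 n\<^sub>2 :: real
      assume h: "R \<le> n\<^sub>1" "n\<^sub>1 \<le> n\<^sub>2" "n\<^sub>1 * n\<^sub>2 \<le> 2 * real_of_int d * R" "a \<noteq> 0" "e \<noteq> 0"
        "\<bar>real_of_int a\<bar> * real_of_int d ^ 2 \<le> 3 * n\<^sub>1 ^ 3" "\<bar>real_of_int b\<bar> * real_of_int d ^ 2 \<le> 9 * n\<^sub>1\<^sup>2 * n\<^sub>2"
        "\<bar>real_of_int c\<bar> * real_of_int d ^ 2 \<le> 9 * n\<^sub>1 * n\<^sub>2\<^sup>2" "\<bar>real_of_int e\<bar> * real_of_int d ^ 2 \<le> 3 * n\<^sub>2 ^ 3"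
        "R * \<bar>real_of_int y\<^sub>1\<bar> \<le> n\<^sub>1" "R * \<bar>real_of_int y\<^sub>2\<bar> \<le> n\<^sub>2"
        "A = cubic_A (a, b, c, e, y\<^sub>2, y\<^sub>1)" "B = cubic_B (a, b, c, e, y\<^sub>2, y\<^sub>1)"
      have "cubic_rep R A B d n\<^sub>1" unfolding cubic_rep_def
        by (rule exI[of _ a], rule exI[of _ b], rule exI[of _ c], rule exI[of _ e], rule exI[of _ y\<^sub>1], rule exI[of _ y\<^sub>2], rule exI[of _ n\<^sub>2])
          (intro conjI h)
      with h(1-3) show ?thesis by (rule that)
    qed
    have "n\<^sub>1 ^ 2 \<le> n\<^sub>1 * n\<^sub>2" unfolding power2_eq_square using n R by (intro mult_left_mono) auto
    also have "\<dots> \<le> 2 * real_of_int d * R" by (rule n)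
    also have "\<dots> \<le> 2 * (6 * R ^ 3) * R ^ 3"
      using dR R self_le_power[of R 3] Rd by (intro mult_mono) auto
    also have "\<dots> \<le> (6 * R ^ 3) ^ 2" by (simp add: power2_eq_square)
    finally have n1R: "n\<^sub>1 \<le> 6 * R ^ 3" by (rule power2_le_imp_le) (use R in simp)
    obtain i where i: "i \<le> L" "2 ^ i \<le> real_of_int d" "real_of_int d < 2 * 2 ^ i"
      using exists_dyadic[of "real_of_int d" "6 * R ^ 3"] dR Rd R unfolding L_def by (metis order_trans)
    obtain j where j: "j \<le> L" "2 ^ j \<le> n\<^sub>1" "n\<^sub>1 < 2 * 2 ^ j"
      using exists_dyadic[of n\<^sub>1 "6 * R ^ 3"] n1R n R unfolding L_def by (metis order_trans)
    have "i \<in> E" using i d(1) unfolding E_def by simp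
    moreover have "(A, B) \<in> W (2 ^ i) (2 ^ j)" unfolding W_def using i j dR rep by blast
    ultimately show "(A, B) \<in> (\<Union>i\<in>E. \<Union>j\<in>{..L}. W (2 ^ i) (2 ^ j))" using j by blast
  qed
  have finE: "finite E" by (simp add: E_def)
  have finU: "finite (\<Union>i\<in>E. \<Union>j\<in>{..L}. W (2 ^ i) (2 ^ j))" using finE W(1) by (intro finite_UN_I) auto
  show "finite S" by (rule finite_subset[OF sub finU])
  have T0: "T > 0" using R T by linarith
  \<comment> \<open>Membership in \<open>E\<close> turns \<open>1 / 2 ^ i\<close> into at most 2/T,
    whence the doubled constant. The bounds decay geometrically in i; using the largest for all i
    costs one logarithm.\<close>
  have each: "real (card (W (2 ^ i) (2 ^ j))) \<le> 2 * K * R ^ 5 / T" if "i \<in> E" for i j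
  proof -
    have "real (card (W (2 ^ i) (2 ^ j))) \<le> K * R ^ 5 / 2 ^ i" by (rule W) auto
    also have "\<dots> = 2 * K * R ^ 5 / (2 * 2 ^ i)" by simp
    also have "\<dots> \<le> 2 * K * R ^ 5 / T" using that R T0 unfolding E_def K_def by (intro divide_left_mono) auto
    finally show ?thesis .
  qed
  have "card S \<le> card (\<Union>i\<in>E. \<Union>j\<in>{..L}. W (2 ^ i) (2 ^ j))" by (rule card_mono[OF finU sub])
  also have "\<dots> \<le> (\<Sum>i\<in>E. card (\<Union>j\<in>{..L}. W (2 ^ i) (2 ^ j)))" by (rule card_UN_le[OF finE])
  also have "\<dots> \<le> (\<Sum>i\<in>E. \<Sum>j\<le>L. card (W (2 ^ i) (2 ^ j)))" by (intro sum_mono card_UN_le) auto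
  finally have "real (card S) \<le> (\<Sum>i\<in>E. \<Sum>j\<le>L. real (card (W (2 ^ i) (2 ^ j))))"
    by (simp only: of_nat_sum[symmetric] of_nat_le_iff)
  also have "\<dots> \<le> (\<Sum>i\<in>E. \<Sum>j\<le>L. 2 * K * R ^ 5 / T)" by (intro sum_mono each)
  also have "\<dots> = real (card E) * (real (L + 1) * (2 * K * R ^ 5 / T))" by simp
  also have "\<dots> \<le> real (L + 1) * (real (L + 1) * (2 * K * R ^ 5 / T))"
  proof (rule mult_right_mono)
    have "card E \<le> card {..L}" unfolding E_def by (rule card_mono) auto
    thus "real (card E) \<le> real (L + 1)" by simp
  qed (use R T0 in \<open>simp add: K_def\<close>)
  also have "\<dots> = real (L + 1) ^ 2 * (2 * K * R ^ 5 / T)" by (simp add: power2_eq_square)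
  also have "\<dots> \<le> (1 + log 2 (6 * R ^ 3)) ^ 2 * (2 * K * R ^ 5 / T)"
  proof (intro mult_right_mono power_mono)
    have "1 \<le> R ^ 3" using R by simp
    hence "1 \<le> 6 * R ^ 3" by linarith
    hence "log 2 (6 * R ^ 3) \<ge> 0" by (subst zero_le_log_cancel_iff; linarith)
    thus "real (L + 1) \<le> 1 + log 2 (6 * R ^ 3)" unfolding L_def by linarith
  qed (use R T0 in \<open>simp_all add: K_def\<close>)
  finally show "real (card S) \<le> 7739670528 * (1 + log 2 (6 * R ^ 3)) ^ 2 * R ^ 5 / T"
    by (simp add: K_def mult_ac)
qed

text \<open>An integer root r satisfies |r| \<le> 2R, as otherwise r^3 would exceed Ar + B in size,
  and A and r determine B. The constant 15 comes from (2R^2 + 1)(4R + 1) \<le> 3R^2 * 5R.\<close>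

lemma card_reducible:
  fixes R :: real
  assumes R: "R \<ge> 1"
  defines "S \<equiv> {(A, B). \<bar>real_of_int A\<bar> \<le> R\<^sup>2 \<and> \<bar>real_of_int B\<bar> \<le> R ^ 3 \<and> (\<exists>r. r ^ 3 + A * r + B = 0)}"
  shows "finite S" and "real (card S) \<le> 15 * R ^ 3"
proof -
  define Q where "Q = {x::int. \<bar>real_of_int x\<bar> \<le> R\<^sup>2} \<times> {x::int. \<bar>real_of_int x\<bar> \<le> 2 * R}"
  have finQ: "finite Q" by (simp add: Q_def)
  have sub: "S \<subseteq> (\<lambda>(A, r). (A, - (r ^ 3) - A * r)) ` Q"
  proof clarify
    fix A B assume "(A, B) \<in> S"
    then obtain r where A: "\<bar>real_of_int A\<bar> \<le> R\<^sup>2" and B: "\<bar>real_of_int B\<bar> \<le> R ^ 3" and r: "r ^ 3 + A * r + B = 0"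
      unfolding S_def by blast
    have B': "B = - (r ^ 3) - A * r" using r by simp
    define x where "x = \<bar>real_of_int r\<bar>"
    have "real_of_int (r ^ 3) = - real_of_int A * r - real_of_int B" unfolding B' by simp
    hence "x ^ 3 = \<bar>- real_of_int A * r - real_of_int B\<bar>" unfolding x_def by (simp add: power_abs[symmetric])
    also have "\<dots> \<le> \<bar>real_of_int A\<bar> * x + \<bar>real_of_int B\<bar>"
      unfolding x_def abs_mult[symmetric] by linarith
    also have "\<dots> \<le> R\<^sup>2 * x + R ^ 3" using A B by (intro add_mono mult_right_mono) (auto simp: x_def)
    finally have x3: "x ^ 3 \<le> R\<^sup>2 * x + R ^ 3" .
    have "x \<le> 2 * R"
    proof (rule ccontr)
      assume "\<not> x \<le> 2 * R"
      hence x: "2 * R < x" by simp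
      have "(2 * R) ^ 2 * x \<le> x ^ 2 * x" using x R by (intro mult_right_mono power_mono) auto
      hence "4 * R\<^sup>2 * x \<le> x ^ 3" by (simp add: power_mult_distrib power2_eq_square power3_eq_cube)
      moreover have "R\<^sup>2 * (2 * R) \<le> R\<^sup>2 * x" using x by (intro mult_left_mono) auto
      hence "2 * R ^ 3 \<le> R\<^sup>2 * x" by (simp add: power2_eq_square power3_eq_cube)
      moreover have "R ^ 3 > 0" using R by simp
      ultimately show False using x3 by linarith
    qed
    hence "(A, r) \<in> Q" using A unfolding Q_def x_def by simp
    thus "(A, B) \<in> (\<lambda>(A, r). (A, - (r ^ 3) - A * r)) ` Q" unfolding B' by (rule rev_image_eqI) simp
  qed
  show "finite S" by (rule finite_subset[OF sub]) (use finQ in simp)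
  have "card S \<le> card ((\<lambda>(A, r). (A, - (r ^ 3) - A * r)) ` Q)" using sub finQ by (intro card_mono) auto
  also have "\<dots> \<le> card Q" by (rule card_image_le[OF finQ])
  finally have "real (card S) \<le> real (card Q)" by simp
  also have "\<dots> = real (card {x::int. \<bar>real_of_int x\<bar> \<le> R\<^sup>2}) * real (card {x::int. \<bar>real_of_int x\<bar> \<le> 2 * R})"
    by (simp add: Q_def card_cartesian_product)
  also have "\<dots> \<le> (2 * R\<^sup>2 + 1) * (2 * (2 * R) + 1)" using R by (intro mult_mono card_int_box_le) auto
  also have "\<dots> \<le> (3 * R\<^sup>2) * (5 * R)" using R one_le_power[OF R, of 2] by (intro mult_mono) auto
  finally show "real (card S) \<le> 15 * R ^ 3" by (simp add: power2_eq_square power3_eq_cube)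
qed

section \<open>The sieve\<close>

text \<open>Each A admits at most the two values b and -b. These pairs are separated because every
  d^2 divides a vanishing discriminant.\<close>

lemma card_Delta_zero:
  assumes Y: "Y \<ge> 0"
  shows "finite {(A, B). \<bar>real_of_int A\<bar> \<le> Y \<and> Delta A B = 0}"
    and "real (card {(A, B). \<bar>real_of_int A\<bar> \<le> Y \<and> Delta A B = 0}) \<le> 2 * (2 * Y + 1)"
proof -
  let ?F = "\<lambda>A. {B. Delta A B = 0}"
  have F: "finite (?F A) \<and> card (?F A) \<le> 2" for A
  proof (cases "?F A = {}")
    case False
    then obtain b where b: "Delta A b = 0" by blast
    have sub: "?F A \<subseteq> {b, - b}"
    proof
      fix c assume "c \<in> ?F A"
      with b have "c ^ 2 = b ^ 2" by (simp add: Delta_def)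
      thus "c \<in> {b, - b}" by (simp add: power2_eq_iff)
    qed
    hence "card (?F A) \<le> card {b, - b}" by (intro card_mono) auto
    also have "\<dots> \<le> 2" by (simp add: card_insert_if)
    finally show ?thesis using finite_subset[OF sub] by simp
  qed simp
  have eq: "{(A, B). \<bar>real_of_int A\<bar> \<le> Y \<and> Delta A B = 0} = Sigma {A. \<bar>real_of_int A\<bar> \<le> Y} ?F" by auto
  show "finite {(A, B). \<bar>real_of_int A\<bar> \<le> Y \<and> Delta A B = 0}"
    unfolding eq using F by (intro finite_SigmaI) auto
  have "card (Sigma {A. \<bar>real_of_int A\<bar> \<le> Y} ?F) = (\<Sum>A | \<bar>real_of_int A\<bar> \<le> Y. card (?F A))"
    using F by (intro card_SigmaI) auto
  also have "\<dots> \<le> (\<Sum>A::int | \<bar>real_of_int A\<bar> \<le> Y. 2)" using F by (intro sum_mono) auto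
  also have "\<dots> = 2 * card {A::int. \<bar>real_of_int A\<bar> \<le> Y}" by simp
  finally have "real (card (Sigma {A. \<bar>real_of_int A\<bar> \<le> Y} ?F)) \<le> real (2 * card {A::int. \<bar>real_of_int A\<bar> \<le> Y})"
    by (simp only: of_nat_le_iff)
  also have "\<dots> = 2 * real (card {A::int. \<bar>real_of_int A\<bar> \<le> Y})" by simp
  also have "\<dots> \<le> 2 * (2 * Y + 1)" using card_int_box_le(1)[OF Y] by simp
  finally show "real (card {(A, B). \<bar>real_of_int A\<bar> \<le> Y \<and> Delta A B = 0}) \<le> 2 * (2 * Y + 1)"
    unfolding eq .
qed

text \<open>Multiplication by e permutes the residues modulo \<open>d ^ 2\<close>, so a period
  contains no more solutions than the equation without e.\<close>

lemma card_roots_scaled: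
  fixes d e :: nat
  assumes sq: "squarefree d" and cop: "coprime (int d) A" "coprime (int d) (int e)" and Z: "Z \<ge> 0"
  shows "real (card {B. \<bar>real_of_int B\<bar> \<le> Z \<and> int (d ^ 2) dvd Delta A (int e * B)})
      \<le> 9 ^ card (prime_factors d) * (2 * Z / d ^ 2 + 1)"
proof -
  have d: "d > 0" using sq by (metis gr0I not_squarefree_0)
  let ?q = "int (d ^ 2)"
  have q: "?q > 0" using d by simp
  let ?\<phi> = "\<lambda>B. of_bool (?q dvd Delta A (int e * B)) :: real"
  define s where "s = card {b \<in> {0..<?q}. ?q dvd Delta A (int e * b)}"
  have "s \<le> roots_count A (d ^ 2)"
    unfolding roots_count_def s_def
  proof (rule card_inj_on_le[where f = "\<lambda>b. int e * b mod ?q"])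
    show "inj_on (\<lambda>b. int e * b mod ?q) {b \<in> {0..<?q}. ?q dvd Delta A (int e * b)}"
    proof (rule inj_onI)
      fix x y assume x: "x \<in> {b \<in> {0..<?q}. ?q dvd Delta A (int e * b)}"
        and y: "y \<in> {b \<in> {0..<?q}. ?q dvd Delta A (int e * b)}" and eq: "int e * x mod ?q = int e * y mod ?q"
      have "coprime (int e) ?q" using cop(2) by (simp add: coprime_commute)
      moreover from eq have "[int e * x = int e * y] (mod ?q)" by (simp add: cong_def)
      ultimately have "[x = y] (mod ?q)" using cong_mult_lcancel by blast
      thus "x = y" using x y by (auto simp: cong_def)
    qed
    show "(\<lambda>b. int e * b mod ?q) ` {b \<in> {0..<?q}. ?q dvd Delta A (int e * b)}
        \<subseteq> {b. 0 \<le> b \<and> b < ?q \<and> ?q dvd Delta A b}"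
      using q by (auto simp: Delta_mod simp del: of_nat_power)
  qed simp
  also have "\<dots> \<le> 9 ^ card (prime_factors d)" by (rule roots_count_squarefree_le[OF sq cop(1)])
  finally have "real s \<le> real (9 ^ card (prime_factors d))" by (simp only: of_nat_le_iff)
  hence s: "real s \<le> 9 ^ card (prime_factors d)" by simp
  have sum1: "(\<Sum>a\<in>{0..<?q}. ?\<phi> a) = s" unfolding s_def by (rule sum_indicator_eq_card) simp
  have sum2: "(\<Sum>x | real_of_int \<bar>x\<bar> \<le> Z. ?\<phi> x) = real (card {B. \<bar>real_of_int B\<bar> \<le> Z \<and> ?q dvd Delta A (int e * B)})"
    by (subst sum_indicator_eq_card) auto
  have per: "?\<phi> (x mod ?q) = ?\<phi> x" for x
  proof -
    have "?q dvd Delta A (int e * (x mod ?q)) \<longleftrightarrow> ?q dvd Delta A (int e * x)"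
      by (rule Delta_cong) (auto intro: cong_scalar_left)
    thus ?thesis by simp
  qed
  have "(\<Sum>x | real_of_int \<bar>x\<bar> \<le> Z. ?\<phi> x) \<le> 2 * Z / ?q * s + s"
    using sum_int_box_periodic[of ?q Z ?\<phi>, OF q Z _ per] unfolding sum1 by simp
  also have "\<dots> = real s * (2 * Z / d ^ 2 + 1)" by (simp add: algebra_simps)
  also have "\<dots> \<le> 9 ^ card (prime_factors d) * (2 * Z / d ^ 2 + 1)"
    using s Z by (intro mult_right_mono) auto
  finally show ?thesis unfolding sum2 .
qed

text \<open>Dividing both coordinates by e shrinks the box in both directions, after which B is
  counted modulo \<open>d ^ 2\<close> for each A. Excluding A = 0 keeps the number of A at most
  \<open>2 * Y / e\<close>, without a summand 1.\<close>

lemma card_common_divisor: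
  fixes d e :: nat
  assumes sq: "squarefree d" and e: "e > 0" and Y: "Y \<ge> 0" and Z: "Z \<ge> 0"
  defines "U \<equiv> {(A, B). A \<noteq> 0 \<and> \<bar>real_of_int A\<bar> \<le> Y \<and> \<bar>real_of_int B\<bar> \<le> Z \<and> int e dvd A \<and> int e dvd B \<and>
      coprime (int d) A \<and> int (d ^ 2) dvd Delta A B}"
  shows "finite U" and "real (card U) \<le> 9 ^ card (prime_factors d) * (2 * Y / e) * (2 * Z / (e * d ^ 2) + 1)"
proof -
  define F where "F A = (if coprime (int d) (int e * A) then
     {B. \<bar>real_of_int B\<bar> \<le> Z / e \<and> int (d ^ 2) dvd Delta (int e * A) (int e * B)} else {})" for A
  define J where "J = {x::int. x \<noteq> 0 \<and> \<bar>real_of_int x\<bar> \<le> Y / e}"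
  have finJ: "finite J" unfolding J_def by (rule finite_subset[OF _ finite_int_box[of "Y / e"]]) auto
  have finF: "finite (F A)" for A by (simp add: F_def)
  have fin: "finite (Sigma J F)" using finJ finF by blast
  have sub: "U \<subseteq> (\<lambda>(A, B). (int e * A, int e * B)) ` Sigma J F"
  proof clarify
    fix A B assume "(A, B) \<in> U"
    then obtain a b where h: "A = int e * a" "B = int e * b" "A \<noteq> 0" "\<bar>real_of_int A\<bar> \<le> Y" "\<bar>real_of_int B\<bar> \<le> Z"
      "coprime (int d) A" "int (d ^ 2) dvd Delta A B" unfolding U_def by (auto elim!: dvdE)
    have "\<bar>real_of_int a\<bar> \<le> Y / e" "\<bar>real_of_int b\<bar> \<le> Z / e" using h e by (auto simp: abs_mult field_simps)
    hence "a \<in> J" "b \<in> F a" using h unfolding J_def F_def by auto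
    thus "(A, B) \<in> (\<lambda>(A, B). (int e * A, int e * B)) ` Sigma J F" unfolding h(1,2) by force
  qed
  show "finite U" by (rule finite_subset[OF sub]) (use fin in simp)
  have "card U \<le> card ((\<lambda>(A, B). (int e * A, int e * B)) ` Sigma J F)" using sub fin by (intro card_mono) auto
  also have "\<dots> \<le> card (Sigma J F)" by (rule card_image_le[OF fin])
  also have "\<dots> = (\<Sum>A\<in>J. card (F A))" using finJ finF by (intro card_SigmaI) auto
  finally have "real (card U) \<le> (\<Sum>A\<in>J. real (card (F A)))" by (simp only: of_nat_sum[symmetric] of_nat_le_iff)
  also have "\<dots> \<le> (\<Sum>A\<in>J. 9 ^ card (prime_factors d) * (2 * Z / (e * d ^ 2) + 1))"
  proof (rule sum_mono)
    fix A
    show "real (card (F A)) \<le> 9 ^ card (prime_factors d) * (2 * Z / (e * d ^ 2) + 1)"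
    proof (cases "coprime (int d) (int e * A)")
      case True
      hence "coprime (int d) (int e)" by simp
      from card_roots_scaled[OF sq True this, of "Z / e"] show ?thesis using True Z by (simp add: F_def)
    next
      case False
      have "F A = {}" unfolding F_def using False by (rule if_not_P)
      thus ?thesis using Z by simp
    qed
  qed
  also have "\<dots> = real (card J) * (9 ^ card (prime_factors d) * (2 * Z / (e * d ^ 2) + 1))" by simp
  also have "\<dots> \<le> (2 * (Y / e)) * (9 ^ card (prime_factors d) * (2 * Z / (e * d ^ 2) + 1))"
    unfolding J_def using Y Z by (intro mult_right_mono card_int_box_le) auto
  finally show "real (card U) \<le> 9 ^ card (prime_factors d) * (2 * Y / e) * (2 * Z / (e * d ^ 2) + 1)"
    by (simp add: mult_ac)
qed

section \<open>Primes whose square divides the discriminant\<close>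

text \<open>For n = 0 this is the set of all primes, whose product is 1 by convention for infinite
  sets; its product therefore has the intended meaning only for n \<noteq> 0.\<close>

definition square_primes :: "int \<Rightarrow> nat set" where
  "square_primes n = {p. prime p \<and> int p ^ 2 dvd n}"

lemma finite_square_primes: "n \<noteq> 0 \<Longrightarrow> finite (square_primes n)"
proof (rule finite_subset)
  assume n: "n \<noteq> 0"
  show "square_primes n \<subseteq> {..nat \<bar>n\<bar>}"
  proof
    fix p assume "p \<in> square_primes n"
    hence "int p ^ 2 dvd n" by (simp add: square_primes_def)
    hence "int p dvd n" by (metis dvd_trans dvd_triv_left power2_eq_square)
    from dvd_imp_le_int[OF n this] show "p \<in> {..nat \<bar>n\<bar>}" by simp
  qed
qed simp

lemma prime_square_primes: "p \<in> square_primes n \<Longrightarrow> prime p"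
  by (simp add: square_primes_def)

lemma prod_primes_power_dvd:
  fixes S :: "nat set" and n :: int
  assumes "finite S" "\<And>p. p \<in> S \<Longrightarrow> prime p" "\<And>p. p \<in> S \<Longrightarrow> int p ^ k dvd n"
  shows "int (\<Prod>S) ^ k dvd n"
  using assms
proof (induction S rule: finite_induct)
  case (insert p S)
  have "coprime p (\<Prod>S)"
    using insert by (intro prod_coprime_right) (metis insertCI primes_coprime)
  hence "coprime (int p) (int (\<Prod>S))" by (simp only: coprime_int_iff)
  hence "coprime (int p ^ k) (int (\<Prod>S) ^ k)" by (simp del: of_nat_prod)
  moreover have "int p ^ k dvd n" "int (\<Prod>S) ^ k dvd n" using insert by auto
  ultimately have "int p ^ k * int (\<Prod>S) ^ k dvd n" using divides_mult by blast
  thus ?case using insert by (simp add: power_mult_distrib)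
qed simp

lemma squarefree_square_dvd_iff:
  assumes "squarefree d"
  shows "int d ^ 2 dvd n \<longleftrightarrow> prime_factors d \<subseteq> square_primes n"
proof
  assume d: "int d ^ 2 dvd n"
  show "prime_factors d \<subseteq> square_primes n"
  proof
    fix p assume p: "p \<in> prime_factors d"
    hence "int p dvd int d" by auto
    hence "int p ^ 2 dvd int d ^ 2" by (rule dvd_power_same)
    with d p show "p \<in> square_primes n" unfolding square_primes_def by (auto intro: dvd_trans)
  qed
next
  assume "prime_factors d \<subseteq> square_primes n"
  hence "int (\<Prod>(prime_factors d)) ^ 2 dvd n"
    by (intro prod_primes_power_dvd) (auto simp: square_primes_def)
  thus "int d ^ 2 dvd n" using squarefree_eq_prod_prime_factors[OF assms] by simp
qed

lemma squarefree_iff_square_primes: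
  assumes "n \<noteq> 0"
  shows "squarefree n \<longleftrightarrow> square_primes n = {}"
proof -
  have "(\<forall>p::int. prime p \<longrightarrow> \<not> p ^ 2 dvd n) \<longleftrightarrow> square_primes n = {}"
  proof
    assume *: "square_primes n = {}"
    show "\<forall>p::int. prime p \<longrightarrow> \<not> p ^ 2 dvd n"
    proof (intro allI impI notI)
      fix p :: int assume p: "prime p" "p ^ 2 dvd n"
      hence "nat p \<in> square_primes n" using prime_ge_0_int[OF p(1)] by (simp add: square_primes_def)
      with * show False by simp
    qed
  qed (auto simp: square_primes_def)
  thus ?thesis using squarefree_factorial_semiring[OF assms] by simp
qed

text \<open>On squarefree d this is the Moebius function, written as a product over primes to match
  \<open>sum_squarefree_prod\<close>. It does not vanish at other d, so every sum over it is
  restricted to squarefree d explicitly.\<close>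

definition mu :: "nat \<Rightarrow> real" where
  "mu d = (\<Prod>p\<in>prime_factors d. -1)"

lemma abs_mu [simp]: "\<bar>mu d\<bar> = 1"
  by (simp add: mu_def abs_prod)

text \<open>The squarefree d with d^2 | n correspond to the subsets of
  \<open>square_primes n\<close>, so the sum is a product of factors 1 - 1, which is empty exactly
  when n is squarefree.\<close>

lemma of_bool_squarefree_eq_sum_mu:
  assumes n: "n \<noteq> 0"
  shows "finite {d. squarefree d \<and> int d ^ 2 dvd n}"
    and "card {d. squarefree d \<and> int d ^ 2 dvd n} = 2 ^ card (square_primes n)"
    and "of_bool (squarefree n) = (\<Sum>d | squarefree d \<and> int d ^ 2 dvd n. mu d)"
proof -
  note Q = finite_square_primes[OF n] prime_square_primes
  have eq: "{d. squarefree d \<and> int d ^ 2 dvd n} = {d. squarefree d \<and> prime_factors d \<subseteq> square_primes n}"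
    using squarefree_square_dvd_iff by blast
  show "finite {d. squarefree d \<and> int d ^ 2 dvd n}"
    unfolding eq by (rule finite_squarefree_prime_factors_subset[OF Q])
  show "card {d. squarefree d \<and> int d ^ 2 dvd n} = 2 ^ card (square_primes n)"
    unfolding eq using bij_betw_same_card[OF bij_betw_prod_primes(1)[OF Q]] card_Pow[OF Q(1)] by simp
  have "(\<Sum>d | squarefree d \<and> int d ^ 2 dvd n. mu d) = (\<Prod>p\<in>square_primes n. 1 + (-1))"
    unfolding eq mu_def by (rule sum_squarefree_prod[OF Q])
  also have "\<dots> = of_bool (squarefree n)"
    using Q(1) by (simp add: squarefree_iff_square_primes[OF n] card_eq_0_iff power_0_left)
  finally show "of_bool (squarefree n) = (\<Sum>d | squarefree d \<and> int d ^ 2 dvd n. mu d)" by simp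
qed

text \<open>Odd primes not dividing A go to d. A prime p > 3 that divides A and the discriminant
  divides 27 B^2, hence B, and goes to e. What remains is contained in {2, 3}, whence the factor
  6.\<close>

lemma square_primes_split:
  fixes A B :: int
  defines "Q \<equiv> square_primes (Delta A B)"
  assumes nz: "Delta A B \<noteq> 0"
  obtains d e :: nat where "squarefree d" "d > 0" "e > 0" "\<Prod>Q \<le> 6 * d * e" "coprime (2 * A) (int d)"
    "int d ^ 2 dvd Delta A B" "int e dvd A" "int e dvd B"
proof -
  note fin = finite_square_primes[OF nz, folded Q_def]
  have pr: "prime p" if "p \<in> Q" for p using that prime_square_primes unfolding Q_def by blast
  define Q1 where "Q1 = {p \<in> Q. p \<noteq> 2 \<and> \<not> int p dvd A}"
  define Q2 where "Q2 = {p \<in> Q. p > 3 \<and> int p dvd A}"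
  define Q3 where "Q3 = Q - Q1 - Q2"
  have fins: "finite Q1" "finite Q2" "finite Q3" using fin by (auto simp: Q1_def Q2_def Q3_def)
  have disj: "Q = Q1 \<union> (Q2 \<union> Q3)" "Q1 \<inter> (Q2 \<union> Q3) = {}" "Q2 \<inter> Q3 = {}"
    by (auto simp: Q1_def Q2_def Q3_def)
  have pos: "\<Prod>S > 0" if "S \<subseteq> Q" for S
  proof (rule prod_pos)
    fix i assume "i \<in> S" thus "0 < i" using that pr by (auto simp: prime_gt_0_nat)
  qed
  have "Q3 \<subseteq> {2, 3}"
  proof
    fix p assume p: "p \<in> Q3"
    hence "p = 2 \<or> p \<le> 3" unfolding Q3_def Q1_def Q2_def by auto
    moreover have "p \<ge> 2" using p pr unfolding Q3_def by (simp add: prime_ge_2_nat)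
    ultimately show "p \<in> {2, 3}" by auto
  qed
  hence "\<Prod>Q3 dvd \<Prod>{2, 3}" by (intro prod_dvd_prod_subset) auto
  hence Q3: "\<Prod>Q3 \<le> 6" by (intro dvd_imp_le) auto
  have "\<Prod>Q = \<Prod>Q1 * (\<Prod>Q2 * \<Prod>Q3)"
    using disj fins by (simp add: prod.union_disjoint)
  also have "\<dots> \<le> \<Prod>Q1 * (\<Prod>Q2 * 6)" using Q3 by (intro mult_le_mono) auto
  finally have le: "\<Prod>Q \<le> 6 * \<Prod>Q1 * \<Prod>Q2" by (simp add: mult_ac)
  have Q1pr: "prime p" if "p \<in> Q1" for p using that pr by (simp add: Q1_def)
  have Q2pr: "prime p" if "p \<in> Q2" for p using that pr by (simp add: Q2_def)
  have sq: "squarefree (\<Prod>Q1)"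
    using bij_betw_prod_primes(1)[OF fins(1) Q1pr] by (auto simp: bij_betw_def)
  have dvd: "int (\<Prod>Q1) ^ 2 dvd Delta A B"
    by (rule prod_primes_power_dvd[OF fins(1) Q1pr]) (simp_all add: Q1_def Q_def square_primes_def)
  have cop: "coprime (2 * A) (int (\<Prod>Q1))"
    unfolding of_nat_prod
  proof (rule prod_coprime_right)
    fix p assume p: "p \<in> Q1"
    hence "\<not> p dvd 2" using primes_dvd_imp_eq[of p 2] Q1pr[OF p] by (auto simp: Q1_def)
    hence "\<not> int p dvd 2" by (metis of_nat_dvd_iff of_nat_numeral)
    with p have "\<not> int p dvd 2 * A" using Q1pr[OF p] by (auto simp: Q1_def prime_dvd_mult_iff)
    hence "coprime (int p) (2 * A)" using Q1pr[OF p] by (intro prime_imp_coprime) auto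
    thus "coprime (2 * A) (int p)" by (simp add: coprime_commute)
  qed
  have "int (\<Prod>Q2) ^ 1 dvd A" using fins Q2pr by (intro prod_primes_power_dvd) (auto simp: Q2_def)
  moreover have "int (\<Prod>Q2) ^ 1 dvd B"
  proof (intro prod_primes_power_dvd)
    fix p assume p: "p \<in> Q2"
    hence pA: "int p dvd A" and "int p ^ 2 dvd Delta A B" and p3: "p > 3" by (auto simp: Q2_def Q_def square_primes_def)
    hence "int p dvd Delta A B" by (metis dvd_trans dvd_triv_left power2_eq_square)
    moreover have "int p dvd 4 * A ^ 3" using pA by (simp add: power3_eq_cube)
    ultimately have "int p dvd 27 * B ^ 2" by (simp add: Delta_def dvd_add_right_iff)
    moreover have "\<not> int p dvd 27" using not_dvd_small[OF Q2pr[OF p] p3, of 27] by simp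
    moreover have "prime (int p)" using Q2pr[OF p] by simp
    ultimately have "int p dvd B" by (metis prime_dvd_mult_iff prime_dvd_power)
    thus "int p ^ 1 dvd B" by simp
  qed (use fins Q2pr in auto)
  ultimately have "int (\<Prod>Q2) dvd A" "int (\<Prod>Q2) dvd B" by simp_all
  moreover have "\<Prod>Q1 > 0" "\<Prod>Q2 > 0" using pos by (auto simp: Q1_def Q2_def)
  ultimately show ?thesis using that sq le cop dvd by blast
qed

section \<open>Pairs whose discriminant has a large square part\<close>

lemma power_mult_powr:
  fixes X :: real
  assumes "X > 0"
  shows "X ^ n * X powr a = X powr (real n + a)"
  using assms by (simp add: powr_add powr_realpow)

lemma power_powr:
  fixes X :: real
  assumes "X > 0"
  shows "(X ^ n) powr a = X powr (real n * a)"
  using assms powr_powr[of X "real n" a] by (simp add: powr_realpow)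

text \<open>The argument \<open>6 * X ^ 6\<close> is the upper bound 6 R^3 of the dyadic ranges at R
  = X^2.\<close>

lemma log_square_bound:
  fixes \<eta> :: real
  assumes \<eta>: "\<eta> > 0"
  obtains C where "C \<ge> 0" "\<And>X::real. X \<ge> 1 \<Longrightarrow> (1 + log 2 (6 * X ^ 6)) ^ 2 \<le> C * X powr \<eta>"
proof -
  define c where "c = 1 + log 2 6 + 6 * (2 / (\<eta> * ln 2))"
  have l6: "log 2 6 \<ge> (0::real)" by simp
  have c0: "c \<ge> 0" unfolding c_def using l6 \<eta> by simp
  have "(1 + log 2 (6 * X ^ 6)) ^ 2 \<le> c ^ 2 * X powr \<eta>" if X: "X \<ge> 1" for X :: real
  proof -
    have p1: "X powr (\<eta> / 2) \<ge> 1" using X \<eta> by (simp add: ge_one_powr_ge_zero)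
    have "log 2 (6 * X ^ 6) = log 2 6 + 6 * log 2 X"
      using X by (simp add: log_mult log_nat_power)
    moreover have "log 2 X \<le> 2 / (\<eta> * ln 2) * X powr (\<eta> / 2)"
    proof -
      have "ln X \<le> X powr (\<eta> / 2) / (\<eta> / 2)" using X \<eta> by (intro ln_powr_bound) auto
      hence "ln X / ln 2 \<le> X powr (\<eta> / 2) / (\<eta> / 2) / ln 2" by (intro divide_right_mono) auto
      thus ?thesis by (simp add: log_def mult_ac)
    qed
    moreover have "1 + log 2 6 \<le> (1 + log 2 6) * X powr (\<eta> / 2)"
    proof -
      have "(1 + log 2 6) * 1 \<le> (1 + log 2 6) * X powr (\<eta> / 2)" using p1 l6 by (intro mult_left_mono) auto
      thus ?thesis by (simp only: mult_1_right)
    qed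
    ultimately have "1 + log 2 (6 * X ^ 6) \<le> c * X powr (\<eta> / 2)"
      by (simp add: c_def distrib_right)
    moreover have "0 \<le> 1 + log 2 (6 * X ^ 6)"
    proof -
      have "1 \<le> X ^ 6" using X by simp
      hence "1 \<le> 6 * X ^ 6" by linarith
      hence "log 2 (6 * X ^ 6) \<ge> 0" by (subst zero_le_log_cancel_iff; linarith)
      thus ?thesis by simp
    qed
    ultimately have "(1 + log 2 (6 * X ^ 6)) ^ 2 \<le> (c * X powr (\<eta> / 2)) ^ 2" by (intro power_mono)
    also have "\<dots> = c ^ 2 * X powr \<eta>" by (simp add: power_mult_distrib power2_eq_square powr_add[symmetric])
    finally show ?thesis .
  qed
  thus ?thesis using that[of "c ^ 2"] by simp
qed

lemma sum_powr_le_suminf: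
  fixes \<eta> :: real
  assumes "\<eta> > 0" "finite F"
  shows "(\<Sum>n\<in>F. real n powr (-1 - \<eta>)) \<le> (\<Sum>n. real n powr (-1 - \<eta>))"
  using assms summable_powr_less_minus1[of \<eta>] by (intro sum_le_suminf) auto

text \<open>A squarefree d with d^2 | \<Delta> divides the product of \<open>square_primes\<close>.
  Among the pairs with nonzero discriminant, these are therefore the only ones for which a Moebius
  sum up to \<open>X ^ 3\<close> can miss a term.\<close>

definition bad_pairs :: "real \<Rightarrow> (int \<times> int) set" where
  "bad_pairs X = {(A, B). \<bar>real_of_int A\<bar> \<le> X ^ 4 \<and> \<bar>real_of_int B\<bar> \<le> X ^ 6 \<and> Delta A B \<noteq> 0 \<and>
     real (\<Prod>(square_primes (Delta A B))) > X ^ 3}"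

text \<open>Here R = X^2. \<open>S1\<close> collects the pairs with d > X^3, \<open>S2\<close> those
  whose cubic has an integer root, \<open>S3\<close> those with A = 0, and the sets
  \<open>U d e\<close> those with d \<le> X^3. The loss \<open>7 * \<eta>\<close> comes from d \<le>
  X^3 in the bound for the number of roots and from e \<le> X^4 in making 1/e summable.\<close>

lemma card_bad_pairs:
  fixes \<eta> :: real
  assumes \<eta>: "0 < \<eta>" "\<eta> < 1"
  obtains C where "C \<ge> 0" "\<And>X. X \<ge> 1 \<Longrightarrow> real (card (bad_pairs X)) \<le> C * X powr (7 + 7 * \<eta>)"
proof -
  obtain C1 where C1: "C1 \<ge> 0" "\<And>X::real. X \<ge> 1 \<Longrightarrow> (1 + log 2 (6 * X ^ 6)) ^ 2 \<le> C1 * X powr \<eta>"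
    using log_square_bound[OF \<eta>(1)] by blast
  obtain C9 where C9: "C9 \<ge> 1" "\<And>d. squarefree d \<Longrightarrow> 9 ^ card (prime_factors d) \<le> C9 * real d powr \<eta>"
    using power_omega_le[of 9 \<eta>] \<eta> by auto
  define \<delta> where "\<delta> n = real n powr (-1 - \<eta>)" for n :: nat
  define Z where "Z = (\<Sum>n. \<delta> n)"
  have \<delta>0: "\<delta> n \<ge> 0" for n by (simp add: \<delta>_def)
  have Zle: "(\<Sum>n\<in>F. \<delta> n) \<le> Z" if "finite F" for F
    unfolding \<delta>_def Z_def by (rule sum_powr_le_suminf[OF \<eta>(1) that])
  have Z0: "Z \<ge> 0" using Zle[of "{}"] by simp
  \<comment> \<open>The 18 is 15 for the reducible cubics plus 3 for A = 0; the bracket collects the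
    main count and the boundary term of the sets \<open>U d e\<close>.\<close>
  define C where "C = 7739670528 * C1 + 18 + C9 * (24 * Z ^ 2 + 2 * Z)"
  have "real (card (bad_pairs X)) \<le> C * X powr (7 + 7 * \<eta>)" if X: "X \<ge> 1" for X :: real
  proof -
    have X0: "X > 0" using X by simp
    define S1 where "S1 = {(A, B). \<bar>real_of_int A\<bar> \<le> (X\<^sup>2)\<^sup>2 \<and> \<bar>real_of_int B\<bar> \<le> (X\<^sup>2) ^ 3 \<and> (\<forall>r. r ^ 3 + A * r + B \<noteq> 0) \<and> Delta A B \<noteq> 0 \<and>
      (\<exists>d::int. X ^ 3 < real_of_int d \<and> coprime (2 * A) d \<and> d ^ 2 dvd Delta A B)}"
    define S2 where "S2 = {(A, B). \<bar>real_of_int A\<bar> \<le> (X\<^sup>2)\<^sup>2 \<and> \<bar>real_of_int B\<bar> \<le> (X\<^sup>2) ^ 3 \<and> (\<exists>r. r ^ 3 + A * r + B = 0)}"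
    define S3 where "S3 = {0::int} \<times> {B::int. \<bar>real_of_int B\<bar> \<le> X ^ 6}"
    define U where "U d e = {(A, B). A \<noteq> 0 \<and> \<bar>real_of_int A\<bar> \<le> X ^ 4 \<and> \<bar>real_of_int B\<bar> \<le> X ^ 6 \<and> int e dvd A \<and> int e dvd B \<and>
      coprime (int d) A \<and> int (d ^ 2) dvd Delta A B}" for d e
    define D where "D = {1..nat \<lfloor>X ^ 3\<rfloor>}"
    define E where "E = {1..nat \<lfloor>X ^ 4\<rfloor>}"
    define P where "P = {(d, e). (d, e) \<in> D \<times> E \<and> squarefree d \<and> X ^ 3 < 6 * real d * real e}"
    have finP: "finite P" by (rule finite_subset[of _ "D \<times> E"]) (auto simp: P_def D_def E_def)
    have pw: "(X\<^sup>2)\<^sup>2 = X ^ 4" "(X\<^sup>2) ^ 3 = X ^ 6" by (simp_all add: power_mult[symmetric])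
    have R1: "X\<^sup>2 \<ge> 1" using X by simp
    have "X\<^sup>2 \<le> X ^ 3" using X by (intro power_increasing) auto
    note S1 = card_large_square_divisor[OF R1 this, folded S1_def]
    note S2 = card_reducible[OF R1, folded S2_def]
    have U: "finite (U d e)" "real (card (U d e)) \<le> 9 ^ card (prime_factors d) * (2 * X ^ 4 / e) * (2 * X ^ 6 / (e * d ^ 2) + 1)"
      if "squarefree d" "e > 0" for d e
      using card_common_divisor[OF that, of "X ^ 4" "X ^ 6"] X0 unfolding U_def by simp_all
    have finU: "finite (\<Union>z\<in>P. case z of (d, e) \<Rightarrow> U d e)"
      using finP U(1) by (intro finite_UN_I) (auto simp: P_def E_def)
    have finS3: "finite S3" by (simp add: S3_def)
    have sub: "bad_pairs X \<subseteq> S1 \<union> (S2 \<union> (S3 \<union> (\<Union>z\<in>P. case z of (d, e) \<Rightarrow> U d e)))"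
    proof (rule subrelI, rule ccontr)
      fix A B assume bad: "(A, B) \<in> bad_pairs X"
        and not_in: "(A, B) \<notin> S1 \<union> (S2 \<union> (S3 \<union> (\<Union>z\<in>P. case z of (d, e) \<Rightarrow> U d e)))"
      hence n2: "(A, B) \<notin> S2" and n3: "(A, B) \<notin> S3"
        and nU: "(A, B) \<notin> (\<Union>z\<in>P. case z of (d, e) \<Rightarrow> U d e)" by blast+
      from bad have A: "\<bar>real_of_int A\<bar> \<le> X ^ 4" and B: "\<bar>real_of_int B\<bar> \<le> X ^ 6" and nz: "Delta A B \<noteq> 0"
        and big: "real (\<Prod>(square_primes (Delta A B))) > X ^ 3" by (auto simp: bad_pairs_def)
      have irr: "\<forall>r. r ^ 3 + A * r + B \<noteq> 0" using n2 A B by (simp add: S2_def pw)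
      have A0: "A \<noteq> 0" using n3 B by (simp add: S3_def)
      obtain d e :: nat where de: "squarefree d" "d > 0" "e > 0" "\<Prod>(square_primes (Delta A B)) \<le> 6 * d * e" "coprime (2 * A) (int d)"
        "int d ^ 2 dvd Delta A B" "int e dvd A" "int e dvd B" by (rule square_primes_split[OF nz])
      have "real (\<Prod>(square_primes (Delta A B))) \<le> real (6 * d * e)" using de(4) by (simp only: of_nat_le_iff)
      hence big': "X ^ 3 < 6 * real d * real e" using big by simp
      have "(A, B) \<in> S1"
      proof (cases "X ^ 3 < real d")
        case True
        hence "X ^ 3 < real_of_int (int d)" by simp
        thus ?thesis unfolding S1_def pw using A B irr nz de by blast
      next
        case False
        have "int e \<le> \<bar>A\<bar>" using dvd_imp_le_int[OF A0 de(7)] by simp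
        hence "real e \<le> X ^ 4" using A by linarith
        hence "(d, e) \<in> P" using False de big' unfolding P_def D_def E_def by (simp add: le_nat_floor)
        moreover have "(A, B) \<in> U d e" unfolding U_def using A B A0 de by (simp add: coprime_commute)
        ultimately show ?thesis using nU by blast
      qed
      thus False using not_in by blast
    qed
    have each: "real (card (U d e)) \<le> C9 * X powr (3 * \<eta>) * (24 * X powr (7 + 3 * \<eta>) * (\<delta> d * \<delta> e) + 2 * X powr (4 + 4 * \<eta>) * \<delta> e)"
      if "(d, e) \<in> P" for d e
    proof -
      from that have d: "squarefree d" "d > 0" "real d \<le> X ^ 3" and e: "e > 0" "real e \<le> X ^ 4" and big: "X ^ 3 < 6 * real d * real e"
        using X0 by (auto simp: P_def D_def E_def le_nat_iff le_floor_iff)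
      have "9 ^ card (prime_factors d) \<le> C9 * real d powr \<eta>" by (rule C9(2)[OF d(1)])
      also have "\<dots> \<le> C9 * (X ^ 3) powr \<eta>" using d C9 \<eta> by (intro mult_left_mono powr_mono2) auto
      also have "(X ^ 3) powr \<eta> = X powr (3 * \<eta>)" using X0 by (simp add: power_powr)
      finally have w: "9 ^ card (prime_factors d) \<le> C9 * X powr (3 * \<eta>)" .
      have t: "X ^ 3 / 6 > 0" "X ^ 3 / 6 \<le> real d * real e" using X0 big by auto
      \<comment> \<open>Rankin's device again: X^3 < 6de converts part of the exponent into the
        saving X^(-3), and the rest factors into two convergent sums over d and e.\<close>
      have "1 / (real d * real e) ^ 2 = (real d * real e) powr (-2)"
        using d e by (simp add: powr_minus divide_inverse powr_numeral)
      also have "\<dots> = (real d * real e) powr (-1 + \<eta>) * (real d * real e) powr (-1 - \<eta>)"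
        by (simp add: powr_add[symmetric])
      also have "\<dots> \<le> (X ^ 3 / 6) powr (-1 + \<eta>) * (real d * real e) powr (-1 - \<eta>)"
        using t \<eta> by (intro mult_right_mono powr_mono2') auto
      also have "(real d * real e) powr (-1 - \<eta>) = \<delta> d * \<delta> e" unfolding \<delta>_def by (simp add: powr_mult)
      also have "(X ^ 3 / 6) powr (-1 + \<eta>) = (X ^ 3) powr (-1 + \<eta>) / 6 powr (-1 + \<eta>)"
        using X0 by (intro powr_divide) 
      also have "\<dots> = 6 powr (1 - \<eta>) * X powr (-3 + 3 * \<eta>)"
      proof -
        have "6 powr (1 - \<eta>) = 1 / 6 powr (-1 + \<eta>)" using powr_minus_divide[of 6 "-1 + \<eta>"] by simp
        thus ?thesis using X0 by (simp add: power_powr algebra_simps)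
      qed
      also have "\<dots> \<le> 6 * X powr (-3 + 3 * \<eta>)"
        using powr_mono[of "1 - \<eta>" 1 "6::real"] \<eta> by (intro mult_right_mono) auto
      finally have 1: "1 / (real d * real e) ^ 2 \<le> 6 * X powr (-3 + 3 * \<eta>) * (\<delta> d * \<delta> e)"
        using \<delta>0 by (simp add: mult_right_mono)
      have "1 / real e = real e powr (-1)" using e by (simp add: powr_minus divide_inverse)
      also have "\<dots> = real e powr \<eta> * real e powr (-1 - \<eta>)" by (simp add: powr_add[symmetric])
      also have "\<dots> \<le> (X ^ 4) powr \<eta> * real e powr (-1 - \<eta>)" using e \<eta> by (intro mult_right_mono powr_mono2) auto
      also have "(X ^ 4) powr \<eta> = X powr (4 * \<eta>)" using X0 by (simp add: power_powr)
      finally have 2: "1 / real e \<le> X powr (4 * \<eta>) * \<delta> e" unfolding \<delta>_def .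
      have "real (card (U d e)) \<le> 9 ^ card (prime_factors d) * (2 * X ^ 4 / e) * (2 * X ^ 6 / (e * d ^ 2) + 1)"
        by (rule U[OF d(1) e(1)])
      also have "\<dots> = 9 ^ card (prime_factors d) * (4 * X ^ 10 * (1 / (real d * real e) ^ 2) + 2 * X ^ 4 * (1 / real e))"
        using d e by (simp add: field_simps power2_eq_square eval_nat_numeral)
      also have "\<dots> \<le> (C9 * X powr (3 * \<eta>)) * (4 * X ^ 10 * (6 * X powr (-3 + 3 * \<eta>) * (\<delta> d * \<delta> e)) + 2 * X ^ 4 * (X powr (4 * \<eta>) * \<delta> e))"
        using w 1 2 X0 by (intro mult_mono add_mono mult_left_mono) (auto intro: order_trans[OF _ w])
      also have "\<dots> = C9 * X powr (3 * \<eta>) * (24 * (X ^ 10 * X powr (-3 + 3 * \<eta>)) * (\<delta> d * \<delta> e) + 2 * (X ^ 4 * X powr (4 * \<eta>)) * \<delta> e)"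
        by (simp add: mult_ac)
      finally show ?thesis using X0 by (simp add: power_mult_powr)
    qed
    have "card (\<Union>z\<in>P. case z of (d, e) \<Rightarrow> U d e) \<le> (\<Sum>z\<in>P. card (case z of (d, e) \<Rightarrow> U d e))"
      by (rule card_UN_le[OF finP])
    hence "real (card (\<Union>z\<in>P. case z of (d, e) \<Rightarrow> U d e)) \<le> (\<Sum>z\<in>P. real (card (case z of (d, e) \<Rightarrow> U d e)))"
      by (simp only: of_nat_sum[symmetric] of_nat_le_iff)
    also have "\<dots> \<le> (\<Sum>z\<in>P. case z of (d, e) \<Rightarrow> C9 * X powr (3 * \<eta>) * (24 * X powr (7 + 3 * \<eta>) * (\<delta> d * \<delta> e) + 2 * X powr (4 + 4 * \<eta>) * \<delta> e))"
      using each by (intro sum_mono) auto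
    \<comment> \<open>The condition on de has served its purpose; all terms are nonnegative, so it
      is dropped to let the double sum factor.\<close>
    also have "\<dots> \<le> (\<Sum>z\<in>D \<times> E. case z of (d, e) \<Rightarrow> C9 * X powr (3 * \<eta>) * (24 * X powr (7 + 3 * \<eta>) * (\<delta> d * \<delta> e) + 2 * X powr (4 + 4 * \<eta>) * \<delta> e))"
      using \<delta>0 C9(1) by (intro sum_mono2) (auto simp: P_def D_def E_def)
    also have "\<dots> = C9 * X powr (3 * \<eta>) * (24 * X powr (7 + 3 * \<eta>) * ((\<Sum>d\<in>D. \<delta> d) * (\<Sum>e\<in>E. \<delta> e)) + 2 * X powr (4 + 4 * \<eta>) * (real (card D) * (\<Sum>e\<in>E. \<delta> e)))"
      by (simp add: sum.cartesian_product[symmetric] sum.distrib sum_distrib_left[symmetric] sum_product)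
    also have "\<dots> \<le> C9 * X powr (3 * \<eta>) * (24 * X powr (7 + 3 * \<eta>) * (Z * Z) + 2 * X powr (4 + 4 * \<eta>) * (X ^ 3 * Z))"
    proof -
      \<comment> \<open>The boundary term of the B-count occurs once for each d, contributing X^3 *
        X^4 = X^7 up to the loss in the exponent.\<close>
      have "real (card D) \<le> X ^ 3" unfolding D_def using X0 by simp
      thus ?thesis using Zle Z0 C9(1) \<delta>0 X0
        by (intro mult_left_mono add_mono mult_mono sum_nonneg) (auto simp: D_def E_def)
    qed
    also have "\<dots> = C9 * (24 * (X powr (3 * \<eta>) * X powr (7 + 3 * \<eta>)) * Z ^ 2 + 2 * (X ^ 3 * X powr (3 * \<eta>) * X powr (4 + 4 * \<eta>)) * Z)"
      by (simp add: algebra_simps power2_eq_square)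
    also have "X powr (3 * \<eta>) * X powr (7 + 3 * \<eta>) = X powr (7 + 6 * \<eta>)"
      unfolding powr_add[symmetric] by (rule arg_cong[where f = "\<lambda>a. X powr a"]) simp
    also have "X ^ 3 * X powr (3 * \<eta>) * X powr (4 + 4 * \<eta>) = X powr (7 + 7 * \<eta>)"
      unfolding power_mult_powr[OF X0] powr_add[symmetric] by (rule arg_cong[where f = "\<lambda>a. X powr a"]) simp
    also have "C9 * (24 * X powr (7 + 6 * \<eta>) * Z ^ 2 + 2 * X powr (7 + 7 * \<eta>) * Z) \<le> C9 * (24 * X powr (7 + 7 * \<eta>) * Z ^ 2 + 2 * X powr (7 + 7 * \<eta>) * Z)"
      using C9(1) X \<eta> by (intro mult_left_mono add_right_mono mult_right_mono powr_mono) auto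
    finally have bU: "real (card (\<Union>z\<in>P. case z of (d, e) \<Rightarrow> U d e)) \<le> C9 * (24 * Z ^ 2 + 2 * Z) * X powr (7 + 7 * \<eta>)"
      by (simp add: algebra_simps)
    have X6: "X ^ 6 \<le> X powr (7 + 7 * \<eta>)"
      using powr_mono[of 6 "7 + 7 * \<eta>" X] X \<eta> by (simp add: powr_numeral)
    have "real (card S1) \<le> 7739670528 * (1 + log 2 (6 * X ^ 6)) ^ 2 * (X\<^sup>2) ^ 5 / X ^ 3"
      using S1(2) by (simp only: pw)
    also have "\<dots> = 7739670528 * (X ^ 7 * (1 + log 2 (6 * X ^ 6)) ^ 2)"
      using X0 by (simp add: field_simps power_mult[symmetric] power_add[symmetric])
    also have "\<dots> \<le> 7739670528 * (X ^ 7 * (C1 * X powr \<eta>))"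
      using C1(2)[OF X] X0 by (intro mult_left_mono) auto
    also have "\<dots> = 7739670528 * C1 * (X ^ 7 * X powr \<eta>)" by simp
    also have "X ^ 7 * X powr \<eta> = X powr (7 + \<eta>)" using X0 by (simp add: power_mult_powr)
    also have "7739670528 * C1 * X powr (7 + \<eta>) \<le> 7739670528 * C1 * X powr (7 + 7 * \<eta>)"
      using X \<eta> C1 by (intro mult_left_mono powr_mono) auto
    finally have bS1: "real (card S1) \<le> 7739670528 * C1 * X powr (7 + 7 * \<eta>)" .
    have bS2: "real (card S2) \<le> 15 * X powr (7 + 7 * \<eta>)" using S2(2) X6 unfolding pw by linarith
    have "real (card S3) = real (card {B::int. \<bar>real_of_int B\<bar> \<le> X ^ 6})" by (simp add: S3_def card_cartesian_product)
    also have "\<dots> \<le> 2 * X ^ 6 + 1" using X0 by (intro card_int_box_le) auto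
    also have "\<dots> \<le> 3 * X ^ 6" using one_le_power[OF X, of 6] by simp
    finally have bS3: "real (card S3) \<le> 3 * X powr (7 + 7 * \<eta>)" using X6 by linarith
    have "card (bad_pairs X) \<le> card (S1 \<union> (S2 \<union> (S3 \<union> (\<Union>z\<in>P. case z of (d, e) \<Rightarrow> U d e))))"
      using sub S1(1) S2(1) finS3 finU by (intro card_mono) auto
    also have "\<dots> \<le> card S1 + (card S2 + (card S3 + card (\<Union>z\<in>P. case z of (d, e) \<Rightarrow> U d e)))"
      by (meson card_Un_le add_left_mono order_trans)
    finally have "real (card (bad_pairs X)) \<le> real (card S1 + (card S2 + (card S3 + card (\<Union>z\<in>P. case z of (d, e) \<Rightarrow> U d e))))"
      by (simp only: of_nat_le_iff)
    also have "\<dots> = real (card S1) + (real (card S2) + (real (card S3) + real (card (\<Union>z\<in>P. case z of (d, e) \<Rightarrow> U d e))))"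
      by (simp only: of_nat_add)
    also have "\<dots> \<le> 7739670528 * C1 * X powr (7 + 7 * \<eta>) + (15 * X powr (7 + 7 * \<eta>) + (3 * X powr (7 + 7 * \<eta>) + C9 * (24 * Z ^ 2 + 2 * Z) * X powr (7 + 7 * \<eta>)))"
      by (intro add_mono bS1 bS2 bS3 bU)
    also have "\<dots> = C * X powr (7 + 7 * \<eta>)" by (simp add: C_def algebra_simps)
    finally show ?thesis .
  qed
  moreover have "C \<ge> 0" unfolding C_def using C1 C9 Z0 by simp
  ultimately show ?thesis using that by blast
qed

section \<open>The truncated Moebius sum over the box\<close>

lemma finite_squarefree_le: "finite {d. squarefree d \<and> real d \<le> D}"
  by (rule finite_subset[of _ "{..nat \<lfloor>D\<rfloor>}"]) (auto simp: le_nat_floor)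

lemma sum_squarefree_le:
  assumes "D \<ge> 0" "\<And>d. d > 0 \<Longrightarrow> real d \<le> D \<Longrightarrow> f d \<le> c" "c \<ge> 0"
  shows "(\<Sum>d | squarefree d \<and> real d \<le> D. f d) \<le> D * (c :: real)"
proof -
  let ?S = "{d. squarefree d \<and> real d \<le> D}"
  have sub: "?S \<subseteq> {1..nat \<lfloor>D\<rfloor>}"
  proof
    fix d assume d: "d \<in> ?S"
    hence "d \<noteq> 0" by (metis (mono_tags) mem_Collect_eq not_squarefree_0)
    with d show "d \<in> {1..nat \<lfloor>D\<rfloor>}" by (simp add: le_nat_floor)
  qed
  have "(\<Sum>d\<in>?S. f d) \<le> (\<Sum>d\<in>?S. c)"
  proof (rule sum_mono)
    fix d assume d: "d \<in> ?S"
    hence "d > 0" using sub by force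
    with d show "f d \<le> c" using assms(2) by simp
  qed
  also have "\<dots> = real (card ?S) * c" by simp
  also have "\<dots> \<le> D * c"
  proof (rule mult_right_mono[OF _ assms(3)])
    have "card ?S \<le> nat \<lfloor>D\<rfloor>" using card_mono[OF _ sub] by simp
    hence "real (card ?S) \<le> real (nat \<lfloor>D\<rfloor>)" by (simp only: of_nat_le_iff)
    also have "\<dots> \<le> D" using assms(1) by simp
    finally show "real (card ?S) \<le> D" .
  qed
  finally show ?thesis .
qed

definition coeff_box :: "real \<Rightarrow> (int \<times> int) set" where
  "coeff_box X = {p. real_of_int \<bar>fst p\<bar> \<le> X ^ 4 \<and> real_of_int \<bar>snd p\<bar> \<le> X ^ 6}"

lemma finite_coeff_box: "finite (coeff_box X)"
proof (rule finite_subset)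
  show "coeff_box X \<subseteq> {A. \<bar>real_of_int A\<bar> \<le> X ^ 4} \<times> {B. \<bar>real_of_int B\<bar> \<le> X ^ 6}" by (auto simp: coeff_box_def)
qed simp

lemma S_count_eq: "S_count X = (\<Sum>p\<in>coeff_box X. of_bool (Delta (fst p) (snd p) \<noteq> 0 \<and> squarefree (Delta (fst p) (snd p))))"
  unfolding S_count_def coeff_box_def
  by (rule sum.cong) (auto simp: moebius_int_def power_mult[symmetric] mult.commute[of _ 2])

text \<open>At n = 0 the divisibility condition is void and truncation leaves a finite sum over all
  squarefree d \<le> D. Pairs of discriminant 0 thus enter the main count, and their contribution is
  bounded separately.\<close>

definition sieve_sum :: "real \<Rightarrow> int \<Rightarrow> real" where
  "sieve_sum D n = (\<Sum>d | squarefree d \<and> real d \<le> D \<and> int d ^ 2 dvd n. mu d)"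

lemma sieve_sum_zero_le:
  assumes "D \<ge> 0"
  shows "\<bar>sieve_sum D 0\<bar> \<le> D"
proof -
  have "sieve_sum D 0 = (\<Sum>d | squarefree d \<and> real d \<le> D. mu d)" by (simp add: sieve_sum_def)
  hence "\<bar>sieve_sum D 0\<bar> \<le> (\<Sum>d | squarefree d \<and> real d \<le> D. \<bar>mu d\<bar>)" by (simp only: sum_abs)
  also have "\<dots> \<le> D * 1" using assms by (intro sum_squarefree_le) auto
  finally show ?thesis by simp
qed

text \<open>Every squarefree d with d^2 | n divides the product of \<open>square_primes n\<close>,
  so the truncation omits nothing.\<close>

lemma sieve_sum_eq:
  assumes n: "n \<noteq> 0" and le: "real (\<Prod>(square_primes n)) \<le> D"
  shows "sieve_sum D n = of_bool (squarefree n)"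
proof -
  have "real d \<le> D" if d: "squarefree d" "int d ^ 2 dvd n" for d
  proof -
    have "d = \<Prod>(prime_factors d)" by (rule squarefree_eq_prod_prime_factors[OF d(1)])
    also have "\<dots> dvd \<Prod>(square_primes n)"
      using d finite_square_primes[OF n] by (intro prod_dvd_prod_subset) (auto simp: squarefree_square_dvd_iff)
    finally have "d dvd \<Prod>(square_primes n)" .
    moreover have "\<Prod>(square_primes n) > 0"
      by (rule prod_pos) (auto simp: prime_gt_0_nat dest: prime_square_primes)
    ultimately have "d \<le> \<Prod>(square_primes n)" by (rule dvd_imp_le)
    hence "real d \<le> real (\<Prod>(square_primes n))" by (simp only: of_nat_le_iff)
    with le show ?thesis by linarith
  qed
  hence "{d. squarefree d \<and> real d \<le> D \<and> int d ^ 2 dvd n} = {d. squarefree d \<and> int d ^ 2 dvd n}" by blast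
  thus ?thesis unfolding sieve_sum_def of_bool_squarefree_eq_sum_mu(3)[OF n] by simp
qed

text \<open>The omitted terms are at most as many as the subsets of \<open>square_primes n\<close>.
  This is of size X^\<epsilon> on the box, which suffices for the few bad pairs.\<close>

lemma sieve_sum_diff_le:
  assumes n: "n \<noteq> 0"
  shows "\<bar>of_bool (squarefree n) - sieve_sum D n\<bar> \<le> 2 ^ card (square_primes n)"
proof -
  let ?S = "{d. squarefree d \<and> int d ^ 2 dvd n}" and ?T = "{d. squarefree d \<and> real d \<le> D \<and> int d ^ 2 dvd n}"
  have fin: "finite ?S" by (rule of_bool_squarefree_eq_sum_mu(1)[OF n])
  have sub: "?T \<subseteq> ?S" by blast
  have "of_bool (squarefree n) - sieve_sum D n = (\<Sum>d\<in>?S - ?T. mu d)"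
    unfolding sieve_sum_def of_bool_squarefree_eq_sum_mu(3)[OF n] by (rule sum_diff[OF fin sub, symmetric])
  also have "\<bar>\<dots>\<bar> \<le> (\<Sum>d\<in>?S - ?T. \<bar>mu d\<bar>)" by (rule sum_abs)
  also have "\<dots> = real (card (?S - ?T))" by simp
  also have "\<dots> \<le> real (card ?S)" by (intro of_nat_mono card_mono fin) auto
  also have "\<dots> = 2 ^ card (square_primes n)" using of_bool_squarefree_eq_sum_mu(2)[OF n] by simp
  finally show ?thesis .
qed

lemma sum_sieve_sum:
  "(\<Sum>p\<in>coeff_box X. sieve_sum D (Delta (fst p) (snd p)))
     = (\<Sum>d | squarefree d \<and> real d \<le> D. mu d * real (card {p \<in> coeff_box X. int d ^ 2 dvd Delta (fst p) (snd p)}))"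
proof -
  let ?S = "{d. squarefree d \<and> real d \<le> D}"
  have "sieve_sum D n = (\<Sum>d\<in>?S. mu d * of_bool (int d ^ 2 dvd n))" for n
    unfolding sieve_sum_def
    by (rule sum.mono_neutral_cong_left) (auto simp: finite_squarefree_le)
  hence "(\<Sum>p\<in>coeff_box X. sieve_sum D (Delta (fst p) (snd p)))
      = (\<Sum>p\<in>coeff_box X. \<Sum>d\<in>?S. mu d * of_bool (int d ^ 2 dvd Delta (fst p) (snd p)))" by simp
  also have "\<dots> = (\<Sum>d\<in>?S. \<Sum>p\<in>coeff_box X. mu d * of_bool (int d ^ 2 dvd Delta (fst p) (snd p)))" by (rule sum.swap)
  also have "\<dots> = (\<Sum>d\<in>?S. mu d * (\<Sum>p\<in>coeff_box X. of_bool (int d ^ 2 dvd Delta (fst p) (snd p))))"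
    by (simp only: sum_distrib_left)
  also have "\<dots> = (\<Sum>d\<in>?S. mu d * real (card {p \<in> coeff_box X. int d ^ 2 dvd Delta (fst p) (snd p)}))"
    by (simp only: sum_indicator_eq_card[OF finite_coeff_box])
  finally show ?thesis .
qed

text \<open>One loss \<open>X powr (3 * \<eta>)\<close> bounds
  \<open>18 ^ card (prime_factors d)\<close>, another makes 1/d summable; the term X^4, occurring
  for up to X^3 values of d, dominates. Replacing the partial sum of the coefficients by the product
  costs X^10 times the tail at D = X^3.\<close>

lemma sieve_main_term:
  fixes \<eta> :: real
  assumes \<eta>: "0 < \<eta>" "\<eta> < 1"
  obtains C where "C \<ge> 0" "\<And>X. X \<ge> 1 \<Longrightarrow> \<bar>(\<Sum>p\<in>coeff_box X. sieve_sum (X ^ 3) (Delta (fst p) (snd p)))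
      - 4 * X ^ 10 * (\<Prod>n. if prime n then 1 - real (rho (n ^ 2)) / real n ^ 4 else 1)\<bar> \<le> C * X powr (7 + 6 * \<eta>)"
proof -
  obtain C18 where C18: "C18 \<ge> 1" "\<And>d. squarefree d \<Longrightarrow> 18 ^ card (prime_factors d) \<le> C18 * real d powr \<eta>"
    using power_omega_le[of 18 \<eta>] \<eta> by auto
  obtain Ce where Ce: "Ce \<ge> 0" "\<And>D. D \<ge> 1 \<Longrightarrow> \<bar>(\<Sum>d | squarefree d \<and> real d \<le> D. euler_coeff d)
        - (\<Prod>n. if prime n then 1 - real (rho (n ^ 2)) / real n ^ 4 else 1)\<bar> \<le> Ce * D powr (-1 + \<eta>)"
    using euler_product_approx[OF \<eta>] by blast
  define pi where "pi = (\<Prod>n. if prime n then 1 - real (rho (n ^ 2)) / real n ^ 4 else (1::real))"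
  define Z where "Z = (\<Sum>n. real n powr (-1 - \<eta>))"
  have Z0: "Z \<ge> 0" using sum_powr_le_suminf[OF \<eta>(1), of "{}"] by (simp add: Z_def)
  define C where "C = C18 * (2 * Z + 3) + 4 * Ce"
  have "\<bar>(\<Sum>p\<in>coeff_box X. sieve_sum (X ^ 3) (Delta (fst p) (snd p))) - 4 * X ^ 10 * pi\<bar> \<le> C * X powr (7 + 6 * \<eta>)" if X: "X \<ge> 1" for X
  proof -
    have X0: "X > 0" using X by simp
    let ?S = "{d. squarefree d \<and> real d \<le> X ^ 3}"
    define M where "M d = real (card {p \<in> coeff_box X. int d ^ 2 dvd Delta (fst p) (snd p)})" for d :: nat
    have mu_euler: "mu d * (real (rho (d ^ 2)) / real d ^ 4) = euler_coeff d" if "squarefree d" for d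
      using euler_coeff_eq[OF that] by (simp add: mu_def)
    have each: "\<bar>mu d * M d - 4 * X ^ 10 * euler_coeff d\<bar> \<le> C18 * X powr (3 * \<eta>) * (2 * X ^ 6 * (X powr (3 * \<eta>) * real d powr (-1 - \<eta>)) + 3 * X ^ 4)"
      if d: "d \<in> ?S" for d
    proof -
      from d have sq: "squarefree d" and dX: "real d \<le> X ^ 3" by auto
      have d0: "d > 0" using sq by (metis gr0I not_squarefree_0)
      have "mu d * M d - 4 * X ^ 10 * euler_coeff d = mu d * (M d - 4 * X ^ 4 * X ^ 6 * (real (rho (d ^ 2)) / d ^ 4))"
        unfolding mu_euler[OF sq, symmetric] by (simp add: algebra_simps power_add[symmetric])
      hence "\<bar>mu d * M d - 4 * X ^ 10 * euler_coeff d\<bar> = \<bar>M d - 4 * X ^ 4 * X ^ 6 * (real (rho (d ^ 2)) / d ^ 4)\<bar>"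
        by (simp add: abs_mult)
      also have "\<dots> \<le> 18 ^ card (prime_factors d) * (2 * X ^ 6 / d + 2 * X ^ 4 + d)"
        using card_square_divisor_box[OF sq, of "X ^ 4" "X ^ 6"] X0 by (simp add: M_def coeff_box_def conj_assoc)
      also have "\<dots> \<le> (C18 * X powr (3 * \<eta>)) * (2 * X ^ 6 * (X powr (3 * \<eta>) * real d powr (-1 - \<eta>)) + 3 * X ^ 4)"
      proof (rule mult_mono)
        have "18 ^ card (prime_factors d) \<le> C18 * real d powr \<eta>" by (rule C18(2)[OF sq])
        also have "\<dots> \<le> C18 * (X ^ 3) powr \<eta>" using dX C18 \<eta> by (intro mult_left_mono powr_mono2) auto
        finally show "18 ^ card (prime_factors d) \<le> C18 * X powr (3 * \<eta>)" using X0 by (simp add: power_powr)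
        have "1 / real d = real d powr (-1)" using d0 by (simp add: powr_minus divide_inverse)
        also have "\<dots> = real d powr \<eta> * real d powr (-1 - \<eta>)" by (simp add: powr_add[symmetric])
        also have "\<dots> \<le> (X ^ 3) powr \<eta> * real d powr (-1 - \<eta>)" using dX \<eta> by (intro mult_right_mono powr_mono2) auto
        finally have "1 / real d \<le> X powr (3 * \<eta>) * real d powr (-1 - \<eta>)" using X0 by (simp add: power_powr)
        hence "2 * X ^ 6 * (1 / real d) \<le> 2 * X ^ 6 * (X powr (3 * \<eta>) * real d powr (-1 - \<eta>))"
          using X0 by (intro mult_left_mono) auto
        \<comment> \<open>The error term d of the box count is merged into X^4, so
          \<open>2 * X ^ 4\<close> becomes \<open>3 * X ^ 4\<close>.\<close>
        moreover have "real d \<le> X ^ 4" using dX power_increasing[of 3 4 X] X by simp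
        ultimately show "2 * X ^ 6 / d + 2 * X ^ 4 + d \<le> 2 * X ^ 6 * (X powr (3 * \<eta>) * real d powr (-1 - \<eta>)) + 3 * X ^ 4"
          by simp
      qed (use C18(1) X0 in auto)
      finally show ?thesis .
    qed
    have lin: "(\<Sum>d\<in>F. a * (b * (c * f d) + k)) = a * (b * (c * (\<Sum>d\<in>F. f d)) + (\<Sum>d\<in>F. k))"
      for a b c k :: real and f :: "nat \<Rightarrow> real" and F
      by (induction F rule: infinite_finite_induct) (simp_all add: algebra_simps)
    have eq: "(\<Sum>p\<in>coeff_box X. sieve_sum (X ^ 3) (Delta (fst p) (snd p))) - 4 * X ^ 10 * (\<Sum>d\<in>?S. euler_coeff d)
        = (\<Sum>d\<in>?S. mu d * M d - 4 * X ^ 10 * euler_coeff d)"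
      unfolding sum_sieve_sum M_def by (simp add: sum_subtractf sum_distrib_left)
    have "\<bar>(\<Sum>d\<in>?S. mu d * M d - 4 * X ^ 10 * euler_coeff d)\<bar> \<le> (\<Sum>d\<in>?S. C18 * X powr (3 * \<eta>) * (2 * X ^ 6 * (X powr (3 * \<eta>) * real d powr (-1 - \<eta>)) + 3 * X ^ 4))"
      by (rule order_trans[OF sum_abs]) (intro sum_mono each)
    also have "\<dots> = C18 * X powr (3 * \<eta>) * (2 * X ^ 6 * (X powr (3 * \<eta>) * (\<Sum>d\<in>?S. real d powr (-1 - \<eta>))) + (\<Sum>d\<in>?S. 3 * X ^ 4))"
      by (rule lin)
    also have "\<dots> \<le> C18 * X powr (3 * \<eta>) * (2 * X ^ 6 * (X powr (3 * \<eta>) * Z) + X ^ 3 * (3 * X ^ 4))"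
      unfolding Z_def using X0 C18(1)
      by (intro mult_left_mono add_mono sum_powr_le_suminf[OF \<eta>(1)] finite_squarefree_le sum_squarefree_le) auto
    also have "\<dots> = C18 * (2 * Z * (X ^ 6 * (X powr (3 * \<eta>) * X powr (3 * \<eta>))) + 3 * (X ^ 7 * X powr (3 * \<eta>)))"
      by (simp add: algebra_simps power_add[symmetric])
    also have "\<dots> = C18 * (2 * Z * X powr (6 + 6 * \<eta>) + 3 * X powr (7 + 3 * \<eta>))"
      using X0 by (simp add: power_mult_powr powr_add[symmetric])
    also have "\<dots> \<le> C18 * (2 * Z * X powr (7 + 6 * \<eta>) + 3 * X powr (7 + 6 * \<eta>))"
      using X \<eta> Z0 C18(1) by (intro mult_left_mono add_mono powr_mono) auto
    finally have 1: "\<bar>(\<Sum>p\<in>coeff_box X. sieve_sum (X ^ 3) (Delta (fst p) (snd p))) - 4 * X ^ 10 * (\<Sum>d\<in>?S. euler_coeff d)\<bar>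
        \<le> C18 * (2 * Z + 3) * X powr (7 + 6 * \<eta>)" unfolding eq by (simp only: distrib_right mult.assoc)
    have "\<bar>(\<Sum>d\<in>?S. euler_coeff d) - pi\<bar> \<le> Ce * (X ^ 3) powr (-1 + \<eta>)"
      unfolding pi_def by (rule Ce(2)) (use X in simp)
    hence "4 * X ^ 10 * \<bar>(\<Sum>d\<in>?S. euler_coeff d) - pi\<bar> \<le> 4 * X ^ 10 * (Ce * (X ^ 3) powr (-1 + \<eta>))"
      using X0 by (intro mult_left_mono) auto
    also have "\<dots> = 4 * Ce * (X ^ 10 * X powr (-3 + 3 * \<eta>))" using X0 by (simp add: power_powr algebra_simps)
    also have "\<dots> = 4 * Ce * X powr (7 + 3 * \<eta>)" using X0 by (simp add: power_mult_powr)
    also have "\<dots> \<le> 4 * Ce * X powr (7 + 6 * \<eta>)" using X \<eta> Ce(1) by (intro mult_left_mono powr_mono) auto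
    also have "4 * X ^ 10 * \<bar>(\<Sum>d\<in>?S. euler_coeff d) - pi\<bar> = \<bar>4 * X ^ 10 * (\<Sum>d\<in>?S. euler_coeff d) - 4 * X ^ 10 * pi\<bar>"
      using X0 by (simp add: abs_mult right_diff_distrib[symmetric])
    finally have 2: "\<bar>4 * X ^ 10 * (\<Sum>d\<in>?S. euler_coeff d) - 4 * X ^ 10 * pi\<bar> \<le> 4 * Ce * X powr (7 + 6 * \<eta>)" .
    have "C * X powr (7 + 6 * \<eta>) = C18 * (2 * Z + 3) * X powr (7 + 6 * \<eta>) + 4 * Ce * X powr (7 + 6 * \<eta>)"
      by (simp add: C_def algebra_simps)
    with 1 2 show ?thesis by linarith
  qed
  moreover have "C \<ge> 0" unfolding C_def using C18(1) Z0 Ce(1) by simp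
  ultimately show ?thesis using that unfolding pi_def by blast
qed

text \<open>Discriminant 0 occurs for O(X^4) pairs with an error of at most X^3 each. The bad pairs
  number O(X^(7 + 7\<eta>)) and have an error of at most \<open>w\<close>, of size X^(6\<eta>),
  which adds up to the exponent 13\<eta>.\<close>

lemma sieve_error:
  fixes \<eta> :: real
  assumes \<eta>: "0 < \<eta>" "\<eta> < 1"
  obtains C where "C \<ge> 0"
    "\<And>X. X \<ge> 1 \<Longrightarrow> \<bar>S_count X - (\<Sum>p\<in>coeff_box X. sieve_sum (X ^ 3) (Delta (fst p) (snd p)))\<bar> \<le> C * X powr (7 + 13 * \<eta>)"
proof -
  obtain C2 where C2: "C2 \<ge> 1" "\<And>Q. finite Q \<Longrightarrow> (\<And>p. p \<in> Q \<Longrightarrow> prime p) \<Longrightarrow> 2 ^ card Q \<le> C2 * real (\<Prod>Q) powr \<eta>"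
    using power_card_primes_le[of 2 \<eta>] \<eta> by auto
  obtain Cb where Cb: "Cb \<ge> 0" "\<And>X. X \<ge> 1 \<Longrightarrow> real (card (bad_pairs X)) \<le> Cb * X powr (7 + 7 * \<eta>)"
    using card_bad_pairs[OF \<eta>] by blast
  define C where "C = 6 + 6 * C2 * Cb"
  have "\<bar>S_count X - (\<Sum>p\<in>coeff_box X. sieve_sum (X ^ 3) (Delta (fst p) (snd p)))\<bar> \<le> C * X powr (7 + 13 * \<eta>)" if X: "X \<ge> 1" for X
  proof -
    have X0: "X > 0" using X by simp
    define zero where "zero = {(A, B). \<bar>real_of_int A\<bar> \<le> X ^ 4 \<and> Delta A B = 0}"
    define w where "w = 6 * C2 * X powr (6 * \<eta>)"
    have w0: "w \<ge> 0" using C2(1) by (simp add: w_def)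
    have zero: "finite zero" "real (card zero) \<le> 2 * (2 * X ^ 4 + 1)"
      unfolding zero_def using card_Delta_zero[of "X ^ 4"] by simp_all
    have bad: "finite (bad_pairs X)"
      by (rule finite_subset[OF _ finite_coeff_box[of X]]) (auto simp: bad_pairs_def coeff_box_def)
    have each: "\<bar>of_bool (Delta A B \<noteq> 0 \<and> squarefree (Delta A B)) - sieve_sum (X ^ 3) (Delta A B)\<bar>
        \<le> X ^ 3 * of_bool ((A, B) \<in> zero) + w * of_bool ((A, B) \<in> bad_pairs X)" if AB: "(A, B) \<in> coeff_box X" for A B
    proof (cases "Delta A B = 0")
      case True
      hence "(A, B) \<in> zero" using AB by (simp add: zero_def coeff_box_def)
      thus ?thesis using True sieve_sum_zero_le[of "X ^ 3"] X0 w0 by simp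
    next
      case nz: False
      show ?thesis
      proof (cases "real (\<Prod>(square_primes (Delta A B))) \<le> X ^ 3")
        case True
        thus ?thesis using sieve_sum_eq[OF nz True] nz X0 w0 by simp
      next
        case False
        hence inbad: "(A, B) \<in> bad_pairs X" using AB nz by (simp add: bad_pairs_def coeff_box_def)
        let ?Q = "square_primes (Delta A B)"
        \<comment> \<open>The full product is itself a square divisor, hence at most 6 X^6; this is
          what bounds the number of its subsets by a small power of X.\<close>
        have "int (\<Prod>?Q) ^ 2 dvd Delta A B"
          by (rule prod_primes_power_dvd[OF finite_square_primes[OF nz]]) (simp_all add: square_primes_def)
        hence "real_of_int (int (\<Prod>?Q)) \<le> 6 * (X\<^sup>2) ^ 3"
          using AB X0 nz by (intro square_divisor_le[of A "X\<^sup>2" B]) (auto simp: coeff_box_def power_mult[symmetric])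
        hence Qle: "real (\<Prod>?Q) \<le> 6 * X ^ 6" by (simp add: power_mult[symmetric] del: of_nat_prod)
        have "\<bar>of_bool (Delta A B \<noteq> 0 \<and> squarefree (Delta A B)) - sieve_sum (X ^ 3) (Delta A B)\<bar> \<le> 2 ^ card ?Q"
          using sieve_sum_diff_le[OF nz, of "X ^ 3"] nz by simp
        also have "\<dots> \<le> C2 * real (\<Prod>?Q) powr \<eta>" by (rule C2(2)[OF finite_square_primes[OF nz] prime_square_primes])
        also have "\<dots> \<le> C2 * (6 * X ^ 6) powr \<eta>" using Qle \<eta> C2(1) by (intro mult_left_mono powr_mono2 of_nat_0_le_iff) auto
        also have "(6 * X ^ 6) powr \<eta> = 6 powr \<eta> * X powr (6 * \<eta>)" using X0 by (simp add: powr_mult power_powr)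
        also have "C2 * (6 powr \<eta> * X powr (6 * \<eta>)) \<le> C2 * (6 * X powr (6 * \<eta>))"
          using powr_mono[of \<eta> 1 "6::real"] \<eta> C2(1) by (intro mult_left_mono mult_right_mono) auto
        also have "\<dots> = w" by (simp add: w_def)
        also have "w \<le> X ^ 3 * of_bool ((A, B) \<in> zero) + w * of_bool ((A, B) \<in> bad_pairs X)"
          using inbad X0 by simp
        finally show ?thesis .
      qed
    qed
    have "S_count X - (\<Sum>p\<in>coeff_box X. sieve_sum (X ^ 3) (Delta (fst p) (snd p)))
        = (\<Sum>p\<in>coeff_box X. of_bool (Delta (fst p) (snd p) \<noteq> 0 \<and> squarefree (Delta (fst p) (snd p))) - sieve_sum (X ^ 3) (Delta (fst p) (snd p)))"
      unfolding S_count_eq by (rule sum_subtractf[symmetric])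
    also have "\<bar>\<dots>\<bar> \<le> (\<Sum>p\<in>coeff_box X. X ^ 3 * of_bool (p \<in> zero) + w * of_bool (p \<in> bad_pairs X))"
    proof (rule order_trans[OF sum_abs], rule sum_mono)
      fix p assume "p \<in> coeff_box X"
      thus "\<bar>of_bool (Delta (fst p) (snd p) \<noteq> 0 \<and> squarefree (Delta (fst p) (snd p))) - sieve_sum (X ^ 3) (Delta (fst p) (snd p))\<bar>
          \<le> X ^ 3 * of_bool (p \<in> zero) + w * of_bool (p \<in> bad_pairs X)"
        using each[of "fst p" "snd p"] by (simp only: prod.collapse)
    qed
    also have "\<dots> = X ^ 3 * (\<Sum>p\<in>coeff_box X. of_bool (p \<in> zero)) + w * (\<Sum>p\<in>coeff_box X. of_bool (p \<in> bad_pairs X))"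
      by (simp only: sum.distrib sum_distrib_left)
    also have "\<dots> = X ^ 3 * real (card {p \<in> coeff_box X. p \<in> zero}) + w * real (card {p \<in> coeff_box X. p \<in> bad_pairs X})"
      by (simp only: sum_indicator_eq_card[OF finite_coeff_box])
    also have "\<dots> \<le> X ^ 3 * real (card zero) + w * real (card (bad_pairs X))"
      using zero(1) bad X0 w0 by (intro add_mono mult_left_mono of_nat_mono card_mono) auto
    also have "\<dots> \<le> X ^ 3 * (2 * (2 * X ^ 4 + 1)) + w * (Cb * X powr (7 + 7 * \<eta>))"
      using zero(2) Cb(2)[OF X] X0 w0 by (intro add_mono mult_left_mono) auto
    also have "X ^ 3 * (2 * (2 * X ^ 4 + 1)) \<le> X ^ 3 * (6 * X ^ 4)"
      using X0 one_le_power[OF X, of 4] by (intro mult_left_mono) auto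
    also have "X ^ 3 * (6 * X ^ 4) = 6 * X powr 7" using X0 by (simp add: powr_numeral power_add[symmetric])
    also have "6 * X powr 7 \<le> 6 * X powr (7 + 13 * \<eta>)" using X \<eta> by (intro mult_left_mono powr_mono) auto
    also have "w * (Cb * X powr (7 + 7 * \<eta>)) = 6 * C2 * Cb * (X powr (6 * \<eta>) * X powr (7 + 7 * \<eta>))" by (simp add: w_def)
    also have "X powr (6 * \<eta>) * X powr (7 + 7 * \<eta>) = X powr (7 + 13 * \<eta>)"
      unfolding powr_add[symmetric] by (rule arg_cong[where f = "\<lambda>a. X powr a"]) simp
    finally show ?thesis by (simp add: C_def algebra_simps)
  qed
  moreover have "C \<ge> 0" unfolding C_def using C2(1) Cb(1) by simp
  ultimately show ?thesis using that by blast
qed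

theorem theorem1p3:
  fixes \<epsilon> :: real
  assumes "\<epsilon> > 0"
  shows "\<exists>K. \<forall>X::real. X \<ge> 1 \<longrightarrow>
           \<bar>S_count X - 4 * X ^ 10 *
              (\<Prod>n. if prime n then 1 - real (rho (n ^ 2)) / real n ^ 4 else 1)\<bar>
           \<le> K * X powr (7 + \<epsilon>)"
proof -
  \<comment> \<open>The 13 matches the exponent lost in the sieve error, and 1/2 keeps \<eta> below
    1 for large \<epsilon>.\<close>
  define \<eta> where "\<eta> = min (1 / 2) (\<epsilon> / 13)"
  have \<eta>: "0 < \<eta>" "\<eta> < 1" "13 * \<eta> \<le> \<epsilon>" using assms by (auto simp: \<eta>_def)
  obtain C where C: "C \<ge> 0" "\<And>X. X \<ge> 1 \<Longrightarrow> \<bar>(\<Sum>p\<in>coeff_box X. sieve_sum (X ^ 3) (Delta (fst p) (snd p)))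
      - 4 * X ^ 10 * (\<Prod>n. if prime n then 1 - real (rho (n ^ 2)) / real n ^ 4 else 1)\<bar> \<le> C * X powr (7 + 6 * \<eta>)"
    using sieve_main_term[OF \<eta>(1,2)] by blast
  obtain C' where C': "C' \<ge> 0"
    "\<And>X. X \<ge> 1 \<Longrightarrow> \<bar>S_count X - (\<Sum>p\<in>coeff_box X. sieve_sum (X ^ 3) (Delta (fst p) (snd p)))\<bar> \<le> C' * X powr (7 + 13 * \<eta>)"
    using sieve_error[OF \<eta>(1,2)] by blast
  show ?thesis
  proof (intro exI allI impI)
    fix X :: real assume X: "X \<ge> 1"
    have "C * X powr (7 + 6 * \<eta>) \<le> C * X powr (7 + \<epsilon>)" using X \<eta> C(1) by (intro mult_left_mono powr_mono) auto
    moreover have "C' * X powr (7 + 13 * \<eta>) \<le> C' * X powr (7 + \<epsilon>)" using X \<eta> C'(1) by (intro mult_left_mono powr_mono) auto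
    moreover have "(C + C') * X powr (7 + \<epsilon>) = C * X powr (7 + \<epsilon>) + C' * X powr (7 + \<epsilon>)" by (rule distrib_right)
    ultimately show "\<bar>S_count X - 4 * X ^ 10 * (\<Prod>n. if prime n then 1 - real (rho (n ^ 2)) / real n ^ 4 else 1)\<bar>
        \<le> (C + C') * X powr (7 + \<epsilon>)"
      using C(2)[OF X] C'(2)[OF X] by linarith
  qed
qed

end
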